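(* \textsc{Maximum Happy Edges} is $\mathsf{W}[1]$-hard when parameterized by the distance to graphs that are a disjoint union of paths on three vertices, and it is $\mathsf{W}[1]$-hard when parameterized by the distance to graphs that are a disjoint union of cycles of length three.
   Context: All graphs are finite, simple and undirected; $[\ell]=\{1,\dots,\ell\}$. Given a graph $G$ and a coloring $c: V(G)\to[\ell]$, an edge $uv$ is happy if $c(u)=c(v)$. \textsc{Maximum Happy Edges}: given a graph $G$, a partial coloring $p: S\to[\ell]$ for some $S\subseteq V(G)$, and an integer $k$, decide whether there is a coloring $c:V(G)\to[\ell]$ extending $p$ with at least $k$ happy edges. For a graph class $\mathcal{G}$, the distance to $\mathcal{G}$ of $G$ is the minimum size of $X\subseteq V(G)$ with $G-X\in\mathcal{G}$. *)

theory Defs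
  imports Main
begin

section \<open>A random access machine with uniform cost\<close>

text \<open>
  Programs are structured programs over finitely many named registers and finitely many
  named arrays of natural numbers (a state is the register contents together with
  the array contents).  The arithmetic is addition, truncated subtraction and halving;
  multiplication is deliberately absent, so that numbers grow by at most a constant number of
  bits per step and uniform cost is polynomially related to Turing machine time.  An expression
  has constant size for a fixed program, so an assignment or a test costs one step.
\<close>

type_synonym state = "(nat \<Rightarrow> nat) \<times> (nat \<Rightarrow> nat \<Rightarrow> nat)"

datatype expr =
    Num nat
  | Reg nat
  | Get nat expr
  | Plus expr expr
  | Minus expr expr
  | Half expr

fun val :: "expr \<Rightarrow> state \<Rightarrow> nat" where
  "val (Num n) s = n"
| "val (Reg r) s = fst s r"
| "val (Get a e) s = snd s a (val e s)"
| "val (Plus e1 e2) s = val e1 s + val e2 s"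
| "val (Minus e1 e2) s = val e1 s - val e2 s"
| "val (Half e) s = val e s div 2"

datatype com =
    Assign nat expr
  | Put nat expr expr
  | Seq com com
  | Cond expr com com
  | While expr com

text \<open>A test succeeds iff its value is nonzero.\<close>

inductive exec :: "com \<Rightarrow> state \<Rightarrow> nat \<Rightarrow> state \<Rightarrow> bool" where
  Assign: "exec (Assign r e) s 1 ((fst s)(r := val e s), snd s)"
| Put: "exec (Put a i e) s 1 (fst s, (snd s)(a := (snd s a)(val i s := val e s)))"
| Seq: "exec c1 s1 t1 s2 \<Longrightarrow> exec c2 s2 t2 s3 \<Longrightarrow> exec (Seq c1 c2) s1 (t1 + t2) s3"
| CondTrue: "val e s \<noteq> 0 \<Longrightarrow> exec c1 s t s' \<Longrightarrow> exec (Cond e c1 c2) s (1 + t) s'"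
| CondFalse: "val e s = 0 \<Longrightarrow> exec c2 s t s' \<Longrightarrow> exec (Cond e c1 c2) s (1 + t) s'"
| WhileFalse: "val e s = 0 \<Longrightarrow> exec (While e c) s 1 s"
| WhileTrue: "val e s1 \<noteq> 0 \<Longrightarrow> exec c s1 t1 s2 \<Longrightarrow> exec (While e c) s2 t2 s3
    \<Longrightarrow> exec (While e c) s1 (1 + t1 + t2) s3"

inductive_cases AssignE: "exec (Assign r e) s t s'"
inductive_cases PutE: "exec (Put a i e) s t s'"
inductive_cases SeqE: "exec (Seq c1 c2) s t s'"
inductive_cases CondE: "exec (Cond e c1 c2) s t s'"
inductive_cases WhileE: "exec (While e c) s t s'"

lemma exec_deterministic:
  "exec c s t s' \<Longrightarrow> exec c s u s'' \<Longrightarrow> u = t \<and> s'' = s'"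
proof (induction arbitrary: u s'' rule: exec.induct)
  case (Assign r e s)
  then show ?case by (auto elim: AssignE)
next
  case (Put a i e s)
  then show ?case by (auto elim: PutE)
next
  case (Seq c1 s1 t1 s2 c2 t2 s3)
  from Seq.prems obtain v1 w v2
    where u: "u = v1 + v2" and c1: "exec c1 s1 v1 w" and c2: "exec c2 w v2 s''"
    by (rule SeqE)
  from Seq.IH(1)[OF c1] have "v1 = t1" "w = s2" by simp_all
  with Seq.IH(2) c2 u show ?case by simp
next
  case (CondTrue e s c1 t s' c2)
  from CondTrue.prems CondTrue.hyps obtain v where "u = 1 + v" "exec c1 s v s''"
    by (auto elim: CondE)
  with CondTrue.IH[of v s''] show ?case by simp
next
  case (CondFalse e s c2 t s' c1)
  from CondFalse.prems CondFalse.hyps obtain v where "u = 1 + v" "exec c2 s v s''"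
    by (auto elim: CondE)
  with CondFalse.IH[of v s''] show ?case by simp
next
  case (WhileFalse e s c)
  then show ?case by (auto elim: WhileE)
next
  case (WhileTrue e s1 c t1 s2 t2 s3)
  from WhileTrue.prems WhileTrue.hyps(1) obtain v1 w v2
    where u: "u = 1 + v1 + v2" and c: "exec c s1 v1 w" and w: "exec (While e c) w v2 s''"
    by (auto elim: WhileE)
  from WhileTrue.IH(1)[OF c] have "v1 = t1" "w = s2" by simp_all
  with WhileTrue.IH(2) w u show ?case by simp
qed

text \<open>
  A string occupies an initial segment of an array; the bits are stored as 1 and 2, so that 0,
  the initial content of every cell, marks the end of the string.  In particular a
  program has to write every bit of its output.  Input is in array 0 and output in array 1.
\<close>

definition cell :: "bool list \<Rightarrow> nat \<Rightarrow> nat" where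
  "cell w i = (if i < length w then (if w ! i then 2 else 1) else 0)"

definition input_state :: "bool list \<Rightarrow> state" where
  "input_state w = ((\<lambda>_. 0), (\<lambda>_ _. 0)(0 := cell w))"

definition outputs :: "state \<Rightarrow> bool list \<Rightarrow> bool" where
  "outputs s w \<longleftrightarrow> (\<forall>i \<le> length w. snd s 1 i = cell w i)"

definition computes_in_time ::
    "com \<Rightarrow> (bool list \<Rightarrow> bool list) \<Rightarrow> (bool list \<Rightarrow> nat) \<Rightarrow> bool" where
  "computes_in_time c F T \<longleftrightarrow>
     (\<forall>w. \<exists>t s. exec c (input_state w) t s \<and> t \<le> T w \<and> outputs s (F w))"

definition computable :: "(nat \<Rightarrow> nat) \<Rightarrow> bool" where
  "computable f \<longleftrightarrow>
     (\<exists>c. \<forall>n. \<exists>t s. exec c ((\<lambda>_. 0)(0 := n), (\<lambda>_ _. 0)) t s \<and> fst s 0 = f n)"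


section \<open>Parameterized problems and fpt-reductions\<close>

text \<open>A parameterized problem is a language together with a parameterization.\<close>

type_synonym pproblem = "bool list set \<times> (bool list \<Rightarrow> nat)"

definition fpt_reducible :: "pproblem \<Rightarrow> pproblem \<Rightarrow> bool"  (infix "\<le>\<^sub>f\<^sub>p\<^sub>t" 50) where
  "A \<le>\<^sub>f\<^sub>p\<^sub>t B \<longleftrightarrow>
     (\<exists>F c f g d. computable f \<and> computable g \<and>
        (\<forall>x. x \<in> fst A \<longleftrightarrow> F x \<in> fst B) \<and>
        (\<forall>x. snd B (F x) \<le> g (snd A x)) \<and>
        computes_in_time c F (\<lambda>x. f (snd A x) * (length x + 1) ^ d))"

text \<open>
  The parameterized problem given by an encoding of instances, a predicate singling out the
  legal instances, the yes-instances, and a parameter.  Strings that encode no legal instance are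
  not in the language and get parameter 0.  The encodings below are injective on legal
  instances.
\<close>

definition encoded_problem ::
    "('i \<Rightarrow> bool list) \<Rightarrow> ('i \<Rightarrow> bool) \<Rightarrow> ('i \<Rightarrow> bool) \<Rightarrow> ('i \<Rightarrow> nat) \<Rightarrow> pproblem" where
  "encoded_problem enc legal yes par =
     (enc ` {I. legal I \<and> yes I},
      \<lambda>x. if \<exists>I. legal I \<and> enc I = x then par (THE I. legal I \<and> enc I = x) else 0)"

lemma encoded_problem_simps:
  assumes "inj_on enc {I. legal I}" and "legal I"
  shows "enc I \<in> fst (encoded_problem enc legal yes par) \<longleftrightarrow> yes I"
    and "snd (encoded_problem enc legal yes par) (enc I) = par I"
proof -
  have *: "J = I" if "legal J" "enc J = enc I" for J
    using assms that by (auto dest: inj_onD)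
  then show "enc I \<in> fst (encoded_problem enc legal yes par) \<longleftrightarrow> yes I"
    using assms(2) by (force simp: encoded_problem_def)
  have "(THE J. legal J \<and> enc J = enc I) = I"
    using * assms(2) by blast
  then show "snd (encoded_problem enc legal yes par) (enc I) = par I"
    using assms(2) by (auto simp: encoded_problem_def)
qed

text \<open>
  Numbers are written in bijective base 2 (digits 1 and 2, least significant digit first), each
  digit preceded by a continuation bit; this makes the code prefix-free.
\<close>

fun code_nat :: "nat \<Rightarrow> bool list" where
  "code_nat 0 = [False]"
| "code_nat (Suc n) = True # odd n # code_nat (n div 2)"

definition code_int :: "int \<Rightarrow> bool list" where
  "code_int k = (k < 0) # code_nat (nat \<bar>k\<bar>)"

definition code_list :: "('a \<Rightarrow> bool list) \<Rightarrow> 'a list \<Rightarrow> bool list" where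
  "code_list f xs = code_nat (length xs) @ concat (map f xs)"

lemma code_nat_prefix_free [simp]:
  "code_nat m @ xs = code_nat n @ ys \<longleftrightarrow> m = n \<and> xs = ys"
proof (induction m arbitrary: n rule: code_nat.induct)
  case 1
  then show ?case by (cases n) auto
next
  case (2 m)
  show ?case
  proof (cases n)
    case (Suc k)
    have "odd m = odd k \<and> m div 2 = k div 2 \<longleftrightarrow> m = k"
      by presburger
    then show ?thesis using "2.IH" Suc by auto
  qed simp
qed

lemma code_int_prefix_free [simp]:
  "code_int k @ xs = code_int l @ ys \<longleftrightarrow> k = l \<and> xs = ys"
  by (auto simp: code_int_def)

lemma code_list_prefix_free:
  assumes f: "\<And>x y us vs. x \<in> A \<Longrightarrow> y \<in> A \<Longrightarrow> f x @ us = f y @ vs \<longleftrightarrow> x = y \<and> us = vs"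
    and "set xs \<subseteq> A" "set ys \<subseteq> A"
  shows "code_list f xs @ us = code_list f ys @ vs \<longleftrightarrow> xs = ys \<and> us = vs"
proof -
  have "concat (map f xs) @ us = concat (map f ys) @ vs \<longleftrightarrow> xs = ys \<and> us = vs"
    if "length xs = length ys"
    using that assms(2,3) by (induction xs ys rule: list_induct2) (auto simp: f)
  then show ?thesis by (auto simp: code_list_def)
qed


section \<open>Weighted circuit satisfiability and the W-hierarchy\<close>

text \<open>
  A Boolean circuit is given by its gates in topological order; gates refer to their
  predecessors by index.  The output is the last gate.  Fan-in one is negation, and conjunctions
  and disjunctions have fan-in at least two.
\<close>

datatype gate = Input | Neg nat | Conj "nat list" | Disj "nat list"

fun preds :: "gate \<Rightarrow> nat list" where
  "preds Input = []"
| "preds (Neg j) = [j]"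
| "preds (Conj js) = js"
| "preds (Disj js) = js"

fun fanin_ok :: "gate \<Rightarrow> bool" where
  "fanin_ok (Conj js) \<longleftrightarrow> distinct js \<and> 2 \<le> length js"
| "fanin_ok (Disj js) \<longleftrightarrow> distinct js \<and> 2 \<le> length js"
| "fanin_ok _ \<longleftrightarrow> True"

definition circuit :: "gate list \<Rightarrow> bool" where
  "circuit C \<longleftrightarrow> C \<noteq> [] \<and>
     (\<forall>i < length C. fanin_ok (C ! i) \<and> (\<forall>j \<in> set (preds (C ! i)). j < i))"

text \<open>Here \<open>b\<close> is the input bit of the gate and \<open>vs\<close> lists the values of the preceding gates.\<close>

fun gate_value :: "bool \<Rightarrow> bool list \<Rightarrow> gate \<Rightarrow> bool" where
  "gate_value b vs Input = b"
| "gate_value b vs (Neg j) = (\<not> vs ! j)"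
| "gate_value b vs (Conj js) = (\<forall>j \<in> set js. vs ! j)"
| "gate_value b vs (Disj js) = (\<exists>j \<in> set js. vs ! j)"

definition circuit_values :: "(nat \<Rightarrow> bool) \<Rightarrow> gate list \<Rightarrow> bool list" where
  "circuit_values a C = foldl (\<lambda>vs g. vs @ [gate_value (a (length vs)) vs g]) [] C"

definition satisfies :: "(nat \<Rightarrow> bool) \<Rightarrow> gate list \<Rightarrow> bool" where
  "satisfies a C \<longleftrightarrow> last (circuit_values a C)"

definition weight :: "(nat \<Rightarrow> bool) \<Rightarrow> gate list \<Rightarrow> nat" where
  "weight a C = card {i. i < length C \<and> C ! i = Input \<and> a i}"

definition input_output_path :: "gate list \<Rightarrow> nat list \<Rightarrow> bool" where
  "input_output_path C P \<longleftrightarrow> P \<noteq> [] \<and> set P \<subseteq> {..<length C} \<and>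
     C ! hd P = Input \<and> last P = length C - 1 \<and>
     (\<forall>i. Suc i < length P \<longrightarrow> P ! i \<in> set (preds (C ! (P ! Suc i))))"

definition depth_at_most :: "nat \<Rightarrow> gate list \<Rightarrow> bool" where
  "depth_at_most d C \<longleftrightarrow> (\<forall>P. input_output_path C P \<longrightarrow> length P - 1 \<le> d)"

definition weft_at_most :: "nat \<Rightarrow> gate list \<Rightarrow> bool" where
  "weft_at_most t C \<longleftrightarrow>
     (\<forall>P. input_output_path C P \<longrightarrow> length (filter (\<lambda>i. 2 < length (preds (C ! i))) P) \<le> t)"

fun code_gate :: "gate \<Rightarrow> bool list" where
  "code_gate Input = code_nat 0"
| "code_gate (Neg j) = code_nat 1 @ code_nat j"
| "code_gate (Conj js) = code_nat 2 @ code_list code_nat js"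
| "code_gate (Disj js) = code_nat 3 @ code_list code_nat js"

definition code_wcs :: "gate list \<times> nat \<Rightarrow> bool list" where
  "code_wcs = (\<lambda>(C, k). code_nat k @ code_list code_gate C)"

lemma inj_code_wcs: "inj code_wcs"
proof -
  have l: "code_list code_nat js @ xs = code_list code_nat js' @ ys \<longleftrightarrow> js = js' \<and> xs = ys"
    for js js' xs ys
    by (rule code_list_prefix_free[where A = UNIV]) auto
  have g: "code_gate g @ xs = code_gate h @ ys \<longleftrightarrow> g = h \<and> xs = ys" for g h xs ys
    by (cases g; cases h)
      (auto simp: l simp del: code_nat.simps One_nat_def)
  have "code_list code_gate C @ xs = code_list code_gate D @ ys \<longleftrightarrow> C = D \<and> xs = ys" for C D xs ys
    by (rule code_list_prefix_free[where A = UNIV]) (auto simp: g)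
  from this[where xs = "[]" and ys = "[]"] show ?thesis
    by (auto simp: inj_def code_wcs_def)
qed

text \<open>
  Weighted satisfiability for circuits of weft at most \<open>t\<close> and depth at most \<open>d\<close>, parameterized by
  the weight.
\<close>

definition wcs :: "nat \<Rightarrow> nat \<Rightarrow> pproblem" where
  "wcs t d = encoded_problem code_wcs
     (\<lambda>(C, k). circuit C \<and> weft_at_most t C \<and> depth_at_most d C)
     (\<lambda>(C, k). \<exists>a. weight a C = k \<and> satisfies a C)
     (\<lambda>(C, k). k)"

definition W :: "nat \<Rightarrow> pproblem set" where
  "W t = {A. \<exists>d. A \<le>\<^sub>f\<^sub>p\<^sub>t wcs t d}"

definition W_hard :: "nat \<Rightarrow> pproblem \<Rightarrow> bool" where
  "W_hard t B \<longleftrightarrow> (\<forall>A \<in> W t. A \<le>\<^sub>f\<^sub>p\<^sub>t B)"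


section \<open>Graphs and distance to a graph class\<close>

text \<open>A graph is a pair of a vertex set and a set of two-element edges.\<close>

type_synonym 'a graph = "'a set \<times> 'a set set"

definition simple_graph :: "'a graph \<Rightarrow> bool" where
  "simple_graph G \<longleftrightarrow> finite (fst G) \<and> (\<forall>e \<in> snd G. e \<subseteq> fst G \<and> card e = 2)"

definition delete_vertices :: "'a graph \<Rightarrow> 'a set \<Rightarrow> 'a graph" where
  "delete_vertices G X = (fst G - X, {e \<in> snd G. e \<inter> X = {}})"

definition distance_to :: "('a graph \<Rightarrow> bool) \<Rightarrow> 'a graph \<Rightarrow> nat" where
  "distance_to \<G> G = (LEAST d. \<exists>X \<subseteq> fst G. card X = d \<and> \<G> (delete_vertices G X))"

definition is_path :: "nat \<Rightarrow> 'a graph \<Rightarrow> bool" where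
  "is_path n G \<longleftrightarrow> (\<exists>vs. distinct vs \<and> length vs = n \<and> fst G = set vs \<and>
     snd G = {{vs ! i, vs ! Suc i} | i. Suc i < n})"

definition is_cycle :: "nat \<Rightarrow> 'a graph \<Rightarrow> bool" where
  "is_cycle n G \<longleftrightarrow> 3 \<le> n \<and> (\<exists>vs. distinct vs \<and> length vs = n \<and> fst G = set vs \<and>
     snd G = {{vs ! i, vs ! (Suc i mod n)} | i. i < n})"

text \<open>The empty graph is the disjoint union of no graphs.\<close>

definition disjoint_union_of :: "('a graph \<Rightarrow> bool) \<Rightarrow> 'a graph \<Rightarrow> bool" where
  "disjoint_union_of \<P> G \<longleftrightarrow> (\<exists>\<H>. (\<forall>H \<in> \<H>. \<P> H) \<and>
     (\<forall>H \<in> \<H>. \<forall>K \<in> \<H>. H \<noteq> K \<longrightarrow> fst H \<inter> fst K = {}) \<and>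
     fst G = (\<Union>H \<in> \<H>. fst H) \<and> snd G = (\<Union>H \<in> \<H>. snd H))"


section \<open>Maximum Happy Edges\<close>

definition happy_edges :: "'a graph \<Rightarrow> ('a \<Rightarrow> nat) \<Rightarrow> 'a set set" where
  "happy_edges G c = {{u, v} | u v. {u, v} \<in> snd G \<and> c u = c v}"

text \<open>
  Instances have vertices \<open>0, \<dots>, n - 1\<close>.  The number \<open>\<ell>\<close> of colors is part of the
  instance.
\<close>

record mhe_instance =
  graph :: "nat graph"
  colors :: nat
  precoloring :: "nat \<Rightarrow> nat option"
  target :: int

definition mhe_legal :: "mhe_instance \<Rightarrow> bool" where
  "mhe_legal I \<longleftrightarrow> simple_graph (graph I) \<and> (\<exists>n. fst (graph I) = {0..<n}) \<and>
     dom (precoloring I) \<subseteq> fst (graph I) \<and> ran (precoloring I) \<subseteq> {1..colors I}"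

definition mhe_yes :: "mhe_instance \<Rightarrow> bool" where
  "mhe_yes I \<longleftrightarrow> (\<exists>c. (\<forall>v \<in> fst (graph I). c v \<in> {1..colors I}) \<and>
     (\<forall>v \<in> dom (precoloring I). precoloring I v = Some (c v)) \<and>
     target I \<le> int (card (happy_edges (graph I) c)))"

text \<open>
  Graphs are encoded by their adjacency matrix; in the encoding of the precoloring, 0 stands for
  an uncolored vertex (colors are positive).
\<close>

definition code_mhe :: "mhe_instance \<Rightarrow> bool list" where
  "code_mhe I = (let vs = [0..<card (fst (graph I))] in
     code_nat (length vs) @ code_nat (colors I) @ code_int (target I) @
     map (\<lambda>(u, v). {u, v} \<in> snd (graph I)) (List.product vs vs) @
     concat (map (\<lambda>v. code_nat (case precoloring I v of None \<Rightarrow> 0 | Some i \<Rightarrow> i)) vs))"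

lemma inj_code_mhe: "inj_on code_mhe {I. mhe_legal I}"
proof (rule inj_onI, clarify)
  fix I J assume I: "mhe_legal I" and J: "mhe_legal J" and eq: "code_mhe I = code_mhe J"
  define n where "n = card (fst (graph I))"
  have VI: "fst (graph I) = {0..<n}"
    using I by (auto simp: mhe_legal_def n_def)
  have n': "card (fst (graph J)) = n"
    using eq by (simp add: code_mhe_def Let_def n_def)
  then have VJ: "fst (graph J) = {0..<n}"
    using J by (auto simp: mhe_legal_def)
  let ?p = "\<lambda>I v. case precoloring I v of None \<Rightarrow> 0 | Some i \<Rightarrow> i"
  have col: "colors I = colors J" and tar: "target I = target J"
    and adj: "\<forall>u<n. \<forall>v<n. {u, v} \<in> snd (graph I) \<longleftrightarrow> {u, v} \<in> snd (graph J)"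
    and pre: "concat (map (\<lambda>v. code_nat (?p I v)) [0..<n]) =
      concat (map (\<lambda>v. code_nat (?p J v)) [0..<n])"
    using eq by (auto simp: code_mhe_def Let_def n' n_def[symmetric])
  have "e \<in> snd (graph I) \<longleftrightarrow> e \<in> snd (graph J)" for e
  proof (cases "\<exists>u<n. \<exists>v<n. e = {u, v}")
    case True
    then show ?thesis using adj by blast
  next
    case False
    have "e \<notin> snd (graph K)" if "mhe_legal K" "fst (graph K) = {0..<n}" for K
    proof
      assume "e \<in> snd (graph K)"
      then have "e \<subseteq> {0..<n}" "card e = 2"
        using that by (auto simp: mhe_legal_def simple_graph_def)
      then obtain u v where "e = {u, v}" "u < n" "v < n"
        by (auto simp: card_2_iff)
      then show False using False by blast
    qed
    then show ?thesis using I J VI VJ by blast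
  qed
  then have gr: "graph I = graph J"
    using VI VJ by (auto simp: prod_eq_iff)
  have "concat (map code_nat xs) = concat (map code_nat ys) \<longleftrightarrow> xs = ys"
    if "length xs = length ys" for xs ys
    using that by (induction xs ys rule: list_induct2) auto
  from this[of "map (?p I) [0..<n]" "map (?p J) [0..<n]"]
  have p: "?p I v = ?p J v" if "v < n" for v
    using pre that by (simp add: comp_def)
  have "precoloring I v = precoloring J v" for v
  proof (cases "v < n")
    case True
    have "0 < i" if "mhe_legal K" "precoloring K v = Some i" for K i
      using that by (force simp: mhe_legal_def intro: ranI)
    from this[OF I] this[OF J] show ?thesis
      using p[OF True] by (auto split: option.splits)
  next
    case False
    then have "v \<notin> fst (graph I)" "v \<notin> fst (graph J)"
      by (simp_all add: VI VJ)
    then have "v \<notin> dom (precoloring I)" "v \<notin> dom (precoloring J)"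
      using I J unfolding mhe_legal_def by blast+
    then show ?thesis by (auto simp: domIff)
  qed
  then have "precoloring I = precoloring J" ..
  with gr col tar show "I = J" by simp
qed

definition mhe_by_distance_to :: "(nat graph \<Rightarrow> bool) \<Rightarrow> pproblem" where
  "mhe_by_distance_to \<G> =
     encoded_problem code_mhe mhe_legal mhe_yes (\<lambda>I. distance_to \<G> (graph I))"

end

theory Submission
  imports Defs
begin

text \<open>
  Let \<open>s 0 = 0 < s 1 < \<dots> < s k < s (k + 1) = m + 1\<close> list the true inputs (shifted by one) of a circuit with \<open>m\<close>
  gates, framed by sentinels.  An input is true if it equals some \<open>s p\<close> and false if it lies strictly between some
  \<open>s p\<close> and \<open>s (p + 1)\<close>, so two consecutive values decide it.  The output of a circuit of weft 1 and depth \<open>d\<close>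
  depends on at most \<open>2 ^ d\<close> large gates, reached by addresses in a binary tree; for each address guess either the
  default value of the gate (true for a conjunction, false for a disjunction), which all children have to confirm, or
  a child that witnesses the opposite value.  All other gates have at most \<open>2 ^ d\<close> inputs below them, hence
  every error in the list or the guesses is visible in a number of coordinates that depends only on \<open>d\<close>.
  Weighted satisfiability thus becomes a constraint problem with boundedly many variables and constraints of
  bounded arity; taking tuples of coordinates as variables makes it binary.

  A binary constraint problem reduces to Maximum Happy Edges with one uncolored vertex per variable and colors for the
  pairs of a variable and a value.  For a pair of colors \<open>\<alpha>\<close> of \<open>x\<close> and \<open>\<gamma>\<close> of \<open>y\<close> take a path (or triangle)
  \<open>a b c\<close> with \<open>a\<close> of color \<open>\<alpha>\<close> and \<open>c\<close> of color \<open>\<gamma>\<close>.  If \<open>b\<close> is uncolored and adjacent to \<open>x\<close> and \<open>y\<close>, the gadget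
  has at most \<open>1 + [x = \<alpha> \<or> y = \<gamma>]\<close> happy edges; if \<open>b\<close> has color \<open>\<alpha>\<close> and instead \<open>a\<close> is adjacent to \<open>x\<close> and \<open>c\<close> to \<open>y\<close>,
  it has \<open>1 + [x = \<alpha>] + [y = \<gamma>]\<close>.  With the first gadget for the forbidden pairs and the second for
  the others, exactly the choice of a forbidden pair costs one happy edge.
\<close>

section \<open>Polynomial-time functions\<close>

text \<open>Hardness is needed for every problem reducible to weft-1 circuits of some fixed depth,
  so the reduction starts from circuits and has to be an actual program of the machine. Hence
  functions are built from combinators that preserve polynomial-time evaluation, and recursions
  whose length depends on \<open>d\<close> are unfolded into the program, \<open>d\<close> being a
  constant of the source problem. A binary constraint sees only two tuples of coordinates. This is
  enough because of two facts. Evaluation with a value "unknown" is monotone in what is known,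
  provided the list of true inputs is sound, so partial views of a good assignment raise no alarm.
  And every violation is certified by at most \<open>2 ^ (d + 2)\<close> coordinates, which one
  tuple can hold; the number comes from a binary tree of height \<open>d + 1\<close> whose leaves
  cost at most two coordinates each. The number of variables depends on \<open>k\<close> and
  \<open>d\<close> only, whereas the number of values, and with it the graph, is polynomial in the
  input with an exponent that depends on \<open>d\<close>.\<close>

text \<open>Functions depend on the input string \<open>w\<close> and on an environment \<open>\<rho>\<close> for de Bruijn variables.\<close>

definition sized :: "bool list \<Rightarrow> (nat \<Rightarrow> nat) \<Rightarrow> nat \<Rightarrow> bool" where
  "sized w \<rho> y \<longleftrightarrow> 2 \<le> y \<and> length w \<le> y \<and> (\<forall>n. \<rho> n \<le> y)"

text \<open>A bare power suffices: \<open>sized\<close> forces \<open>y\<close> to be at least 2, so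
  constants and sums are absorbed into the exponent. That \<open>y\<close> also bounds the
  environment lets bounds compose under substitution.\<close>

definition poly_bounded :: "(bool list \<Rightarrow> (nat \<Rightarrow> nat) \<Rightarrow> nat) \<Rightarrow> bool" where
  "poly_bounded F \<longleftrightarrow> (\<exists>D. \<forall>w \<rho> y. sized w \<rho> y \<longrightarrow> F w \<rho> \<le> y ^ D)"

definition reg_env :: "nat list \<Rightarrow> state \<Rightarrow> nat \<Rightarrow> nat" where
  "reg_env rs s n = (if n < length rs then fst s (rs ! n) else 0)"

text \<open>The input is kept in array 2, since the output overwrites array 1. Nothing is said about
  the cells beyond it, so reading needs a range check.\<close>

definition loaded :: "bool list \<Rightarrow> state \<Rightarrow> bool" where
  "loaded w s \<longleftrightarrow> fst s 0 = length w \<and> (\<forall>i < length w. snd s 2 i = cell w i)"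

text \<open>The registers \<open>rs\<close> hold the environment.  Only registers from \<open>J\<close> on may change, so that evaluations can be
  nested like stack frames.\<close>

definition evaluates ::
    "com \<Rightarrow> nat list \<Rightarrow> nat \<Rightarrow> (bool list \<Rightarrow> (nat \<Rightarrow> nat) \<Rightarrow> nat) \<Rightarrow> nat \<Rightarrow> bool" where
  "evaluates c rs J F D \<longleftrightarrow>
     (\<forall>w s y. loaded w s \<longrightarrow> sized w (reg_env rs s) y \<longrightarrow>
        (\<exists>t s'. exec c s t s' \<and> t \<le> y ^ D \<and> fst s' J = F w (reg_env rs s) \<and>
           (\<forall>r < J. fst s' r = fst s r) \<and> snd s' = snd s))"

text \<open>All placements \<open>rs\<close>, \<open>J\<close> of the stack frame are allowed, so
  that programs can be nested; \<open>0 < J\<close> protects register 0, which holds the input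
  length. The bound on the value is included because it bounds the environment of any function
  applied to the result.\<close>

definition feas :: "(bool list \<Rightarrow> (nat \<Rightarrow> nat) \<Rightarrow> nat) \<Rightarrow> bool" where
  "feas F \<longleftrightarrow> poly_bounded F \<and>
     (\<forall>rs J. 0 < J \<longrightarrow> (\<forall>r \<in> set rs. r < J) \<longrightarrow> (\<exists>c D. evaluates c rs J F D))"

lemma add_le_power:
  fixes y :: nat
  assumes "2 \<le> y" "a \<le> y ^ D" "b \<le> y ^ D'"
  shows "a + b \<le> y ^ (D + D' + 1)"
proof -
  have "y ^ D \<le> y ^ (D + D')" "y ^ D' \<le> y ^ (D + D')"
    using assms(1) by (auto intro: power_increasing)
  then have "a + b \<le> 2 * y ^ (D + D')" using assms by linarith
  also have "\<dots> \<le> y * y ^ (D + D')" using assms(1) by simp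
  finally show ?thesis by simp
qed

lemma const_le_power:
  fixes y :: nat
  assumes "2 \<le> y"
  shows "n \<le> y ^ n"
proof -
  have "n \<le> 2 ^ n" by (simp add: less_imp_le)
  also have "\<dots> \<le> y ^ n" using assms by (simp add: power_mono)
  finally show ?thesis .
qed

lemma mult_le_power:
  fixes y :: nat
  assumes "a \<le> y ^ D" "b \<le> y ^ D'"
  shows "a * b \<le> y ^ (D + D')"
  using mult_le_mono[OF assms] by (simp add: power_add)

lemma poly_boundedI: "(\<And>w \<rho> y. sized w \<rho> y \<Longrightarrow> F w \<rho> \<le> y ^ D) \<Longrightarrow> poly_bounded F"
  unfolding poly_bounded_def by blast

lemma poly_boundedE:
  assumes "poly_bounded F"
  obtains D where "\<And>w \<rho> y. sized w \<rho> y \<Longrightarrow> F w \<rho> \<le> y ^ D"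
  using assms unfolding poly_bounded_def by blast

lemma poly_bounded_mono:
  "poly_bounded G \<Longrightarrow> (\<And>w \<rho>. F w \<rho> \<le> G w \<rho>) \<Longrightarrow> poly_bounded F"
  unfolding poly_bounded_def by (meson le_trans)

lemma poly_bounded_const: "poly_bounded (\<lambda>w \<rho>. n)"
  by (rule poly_boundedI[where D = n]) (simp add: sized_def const_le_power)

lemma poly_bounded_var: "poly_bounded (\<lambda>w \<rho>. \<rho> n)"
  by (rule poly_boundedI[where D = 1]) (simp add: sized_def)

lemma poly_bounded_length: "poly_bounded (\<lambda>w \<rho>. length w)"
  by (rule poly_boundedI[where D = 1]) (simp add: sized_def)

lemma poly_bounded_add:
  assumes "poly_bounded F" "poly_bounded G"
  shows "poly_bounded (\<lambda>w \<rho>. F w \<rho> + G w \<rho>)"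
proof -
  obtain D where D: "\<And>w \<rho> y. sized w \<rho> y \<Longrightarrow> F w \<rho> \<le> y ^ D" 
    using poly_boundedE[OF assms(1)] by metis
  obtain D' where D': "\<And>w \<rho> y. sized w \<rho> y \<Longrightarrow> G w \<rho> \<le> y ^ D'" 
    using poly_boundedE[OF assms(2)] by metis
  show ?thesis
    by (rule poly_boundedI[where D = "D + D' + 1"], rule add_le_power) (use D D' in \<open>auto simp: sized_def\<close>)
qed

lemma poly_bounded_mult:
  assumes "poly_bounded F" "poly_bounded G"
  shows "poly_bounded (\<lambda>w \<rho>. F w \<rho> * G w \<rho>)"
proof -
  obtain D where D: "\<And>w \<rho> y. sized w \<rho> y \<Longrightarrow> F w \<rho> \<le> y ^ D" 
    using poly_boundedE[OF assms(1)] by metis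
  obtain D' where D': "\<And>w \<rho> y. sized w \<rho> y \<Longrightarrow> G w \<rho> \<le> y ^ D'" 
    using poly_boundedE[OF assms(2)] by metis
  show ?thesis
    by (rule poly_boundedI[where D = "D + D'"], rule mult_le_power) (use D D' in auto)
qed

lemma sized_power: "sized w \<rho> y \<Longrightarrow> sized w \<rho> (y ^ Suc D)"
proof -
  assume s: "sized w \<rho> y"
  then have "y \<le> y ^ Suc D" by (simp add: sized_def)
  then show ?thesis using s unfolding sized_def by (meson le_trans)
qed

lemma feas_bounded: "feas F \<Longrightarrow> poly_bounded F"
  by (simp add: feas_def)

lemma feas_evaluates:
  assumes "feas F" "0 < J" "\<forall>r \<in> set rs. r < J"
  obtains c D where "evaluates c rs J F D"
  using assms unfolding feas_def by blast

lemma evaluatesE: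
  assumes "evaluates c rs J F D" "loaded w s" "sized w (reg_env rs s) y"
  obtains t s' where "exec c s t s'" "t \<le> y ^ D" "fst s' J = F w (reg_env rs s)"
    "\<forall>r < J. fst s' r = fst s r" "snd s' = snd s"
  using assms unfolding evaluates_def by blast

lemma evaluates_mono:
  assumes "evaluates c rs J F D" "D \<le> D'"
  shows "evaluates c rs J F D'"
  unfolding evaluates_def
proof (intro allI impI)
  fix w s y
  assume "loaded w s" and y: "sized w (reg_env rs s) y"
  with assms(1) obtain t s' where *: "exec c s t s'" "t \<le> y ^ D" "fst s' J = F w (reg_env rs s)"
    "\<forall>r < J. fst s' r = fst s r" "snd s' = snd s"
    by (rule evaluatesE)
  have "y ^ D \<le> y ^ D'" using y assms(2) by (auto simp: sized_def intro: power_increasing)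
  with * show "\<exists>t s'. exec c s t s' \<and> t \<le> y ^ D' \<and> fst s' J = F w (reg_env rs s) \<and>
           (\<forall>r < J. fst s' r = fst s r) \<and> snd s' = snd s"
    by (meson le_trans)
qed

lemma reg_env_cong: "(\<And>r. r \<in> set rs \<Longrightarrow> fst s r = fst s' r) \<Longrightarrow> reg_env rs s = reg_env rs s'"
  by (auto simp: reg_env_def fun_eq_iff)

section \<open>Closure under arithmetic, substitution, branching and bounded recursion\<close>

lemma feas_expr:
  assumes b: "poly_bounded F"
    and e: "\<And>rs J. 0 < J \<Longrightarrow> (\<forall>r \<in> set rs. r < J) \<Longrightarrow>
      \<exists>e. \<forall>w s. loaded w s \<longrightarrow> val e s = F w (reg_env rs s)"
  shows "feas F"
  unfolding feas_def
proof (intro conjI b allI impI)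
  fix rs J assume "0 < (J::nat)" "\<forall>r \<in> set rs. r < J"
  then obtain e where e: "\<And>w s. loaded w s \<Longrightarrow> val e s = F w (reg_env rs s)"
    using e by metis
  have "evaluates (Assign J e) rs J F 0"
    unfolding evaluates_def
    by (intro allI impI, rule exI[of _ 1], rule exI, intro conjI, rule exec.Assign) (auto simp: e)
  then show "\<exists>c D. evaluates c rs J F D" by blast
qed

lemma feas_const: "feas (\<lambda>w \<rho>. n)"
  by (rule feas_expr[OF poly_bounded_const]) (rule exI[of _ "Num n"], simp)

lemma feas_var: "feas (\<lambda>w \<rho>. \<rho> n)"
proof (rule feas_expr[OF poly_bounded_var])
  fix rs J
  show "\<exists>e. \<forall>w s. loaded w s \<longrightarrow> val e s = reg_env rs s n"
    by (rule exI[of _ "if n < length rs then Reg (rs ! n) else Num 0"]) (auto simp: reg_env_def)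
qed

lemma feas_length: "feas (\<lambda>w \<rho>. length w)"
  by (rule feas_expr[OF poly_bounded_length]) (rule exI[of _ "Reg 0"], simp add: loaded_def)

lemma feas_binop:
  fixes op :: "nat \<Rightarrow> nat \<Rightarrow> nat"
  assumes F: "feas F" and G: "feas G"
    and ex: "\<And>J. \<exists>e. \<forall>s. val e s = op (fst s J) (fst s (Suc J))"
    and le: "\<And>a b. op a b \<le> a + b"
  shows "feas (\<lambda>w \<rho>. op (F w \<rho>) (G w \<rho>))"
  unfolding feas_def
proof (intro conjI allI impI)
  show "poly_bounded (\<lambda>w \<rho>. op (F w \<rho>) (G w \<rho>))"
    using poly_bounded_add[OF feas_bounded[OF F] feas_bounded[OF G]] le by (rule poly_bounded_mono)
  fix rs J assume J: "0 < (J::nat)" and rs: "\<forall>r \<in> set rs. r < J"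
  obtain c1 D1 where 1: "evaluates c1 rs J F D1" using F J rs by (rule feas_evaluates)
  obtain c2 D2 where 2: "evaluates c2 rs (Suc J) G D2"
    by (rule feas_evaluates[OF G, of "Suc J" rs]) (use rs in auto)
  obtain e where e: "\<And>s. val e s = op (fst s J) (fst s (Suc J))" using ex by metis
  have "evaluates (Seq c1 (Seq c2 (Assign J e))) rs J (\<lambda>w \<rho>. op (F w \<rho>) (G w \<rho>)) (D1 + (D2 + 1 + 1) + 1)"
    unfolding evaluates_def
  proof (intro allI impI)
    fix w s y assume l: "loaded w s" and y: "sized w (reg_env rs s) y"
    obtain t1 s1 where s1: "exec c1 s t1 s1" "t1 \<le> y ^ D1" "fst s1 J = F w (reg_env rs s)"
      "\<forall>r < J. fst s1 r = fst s r" "snd s1 = snd s" using 1 l y by (rule evaluatesE)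
    have env: "reg_env rs s1 = reg_env rs s" using s1 rs by (auto intro: reg_env_cong)
    have l1: "loaded w s1" using l s1 J by (simp add: loaded_def)
    obtain t2 s2 where s2: "exec c2 s1 t2 s2" "t2 \<le> y ^ D2" "fst s2 (Suc J) = G w (reg_env rs s)"
      "\<forall>r < Suc J. fst s2 r = fst s1 r" "snd s2 = snd s1"
      using evaluatesE[OF 2 l1, of y] y env by metis
    have "exec (Seq c1 (Seq c2 (Assign J e))) s (t1 + (t2 + 1)) ((fst s2)(J := val e s2), snd s2)"
      by (rule exec.Seq[OF s1(1) exec.Seq[OF s2(1) exec.Assign]])
    moreover have "t1 + (t2 + 1) \<le> y ^ (D1 + (D2 + 1 + 1) + 1)"
      using y s1(2) s2(2) by (intro add_le_power) (auto simp: sized_def)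
    ultimately show "\<exists>t s'. exec (Seq c1 (Seq c2 (Assign J e))) s t s' \<and> t \<le> y ^ (D1 + (D2 + 1 + 1) + 1) \<and>
        fst s' J = op (F w (reg_env rs s)) (G w (reg_env rs s)) \<and>
        (\<forall>r < J. fst s' r = fst s r) \<and> snd s' = snd s"
      using s1 s2
      by (intro exI[of _ "t1 + (t2 + 1)"] exI[of _ "((fst s2)(J := val e s2), snd s2)"] conjI) (simp_all add: e)
  qed
  then show "\<exists>c D. evaluates c rs J (\<lambda>w \<rho>. op (F w \<rho>) (G w \<rho>)) D" by blast
qed

lemma feas_add: "feas F \<Longrightarrow> feas G \<Longrightarrow> feas (\<lambda>w \<rho>. F w \<rho> + G w \<rho>)"
  by (rule feas_binop[where op = "(+)"]) (auto intro: exI[of _ "Plus (Reg _) (Reg _)"])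

lemma feas_diff: "feas F \<Longrightarrow> feas G \<Longrightarrow> feas (\<lambda>w \<rho>. F w \<rho> - G w \<rho>)"
  by (rule feas_binop[where op = "(-)"]) (auto intro: exI[of _ "Minus (Reg _) (Reg _)"])

lemma feas_half: "feas F \<Longrightarrow> feas (\<lambda>w \<rho>. F w \<rho> div 2)"
  by (rule feas_binop[where op = "\<lambda>a b. a div 2" and G = F]) (auto intro: exI[of _ "Half (Reg _)"])

text \<open>Call by value: \<open>A\<close> is evaluated into register \<open>J\<close>, which
  becomes variable 0 of \<open>F\<close>. The new environment is bounded by
  \<open>y ^ Suc DA\<close>, where \<open>Suc\<close> makes this power at least \<open>y\<close> as
  well; exponents multiply.\<close>

lemma feas_subst:
  assumes F: "feas F" and A: "feas A"
  shows "feas (\<lambda>w \<rho>. F w (case_nat (A w \<rho>) \<rho>))"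
  unfolding feas_def
proof (intro conjI allI impI)
  obtain DA where DA: "\<And>w \<rho> y. sized w \<rho> y \<Longrightarrow> A w \<rho> \<le> y ^ DA"
    
    using poly_boundedE[OF feas_bounded[OF A]] by metis
  obtain DF where DF: "\<And>w \<rho> y. sized w \<rho> y \<Longrightarrow> F w \<rho> \<le> y ^ DF"
    
    using poly_boundedE[OF feas_bounded[OF F]] by metis
  have sz: "sized w (case_nat (A w \<rho>) \<rho>) (y ^ Suc DA)" if y: "sized w \<rho> y" for w \<rho> y
  proof -
    have "y ^ DA \<le> y ^ Suc DA" using y by (simp add: sized_def)
    then have "A w \<rho> \<le> y ^ Suc DA" using DA[OF y] by linarith
    then show ?thesis using sized_power[OF y, of DA] by (auto simp: sized_def split: nat.split)
  qed
  show "poly_bounded (\<lambda>w \<rho>. F w (case_nat (A w \<rho>) \<rho>))"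
    by (rule poly_boundedI[where D = "Suc DA * DF"]) (metis DF sz power_mult)
  fix rs J assume J: "0 < (J::nat)" and rs: "\<forall>r \<in> set rs. r < J"
  obtain c1 D1 where 1: "evaluates c1 rs J A D1" using A J rs by (rule feas_evaluates)
  obtain c2 D2 where 2: "evaluates c2 (J # rs) (Suc J) F D2"
    by (rule feas_evaluates[OF F, of "Suc J" "J # rs"]) (use rs in auto)
  let ?c = "Seq c1 (Seq c2 (Assign J (Reg (Suc J))))"
  let ?D = "D1 + (Suc DA * D2 + 1 + 1) + 1"
  have "evaluates ?c rs J (\<lambda>w \<rho>. F w (case_nat (A w \<rho>) \<rho>)) ?D"
    unfolding evaluates_def
  proof (intro allI impI)
    fix w s y assume l: "loaded w s" and y: "sized w (reg_env rs s) y"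
    obtain t1 s1 where s1: "exec c1 s t1 s1" "t1 \<le> y ^ D1" "fst s1 J = A w (reg_env rs s)"
      "\<forall>r < J. fst s1 r = fst s r" "snd s1 = snd s" using 1 l y by (rule evaluatesE)
    have env: "reg_env rs s1 = reg_env rs s" using s1 rs by (auto intro: reg_env_cong)
    have env': "reg_env (J # rs) s1 = case_nat (A w (reg_env rs s)) (reg_env rs s)"
    proof
      fix n
      show "reg_env (J # rs) s1 n = case_nat (A w (reg_env rs s)) (reg_env rs s) n"
        using fun_cong[OF env, of "n - 1"] s1(3) by (cases n) (auto simp: reg_env_def)
    qed
    have l1: "loaded w s1" using l s1 J by (simp add: loaded_def)
    obtain t2 s2 where s2: "exec c2 s1 t2 s2" "t2 \<le> (y ^ Suc DA) ^ D2"
      "fst s2 (Suc J) = F w (case_nat (A w (reg_env rs s)) (reg_env rs s))"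
      "\<forall>r < Suc J. fst s2 r = fst s1 r" "snd s2 = snd s1"
      using evaluatesE[OF 2 l1, of "y ^ Suc DA"] sz[OF y] env' by metis
    have "exec ?c s (t1 + (t2 + 1)) ((fst s2)(J := val (Reg (Suc J)) s2), snd s2)"
      by (rule exec.Seq[OF s1(1) exec.Seq[OF s2(1) exec.Assign]])
    moreover have "t2 \<le> y ^ (Suc DA * D2)" using s2(2) by (simp only: power_mult)
    then have "t1 + (t2 + 1) \<le> y ^ ?D"
      using y s1(2) by (intro add_le_power) (auto simp: sized_def)
    ultimately show "\<exists>t s'. exec ?c s t s' \<and> t \<le> y ^ ?D \<and>
        fst s' J = F w (case_nat (A w (reg_env rs s)) (reg_env rs s)) \<and>
        (\<forall>r < J. fst s' r = fst s r) \<and> snd s' = snd s"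
      using s1 s2
      by (intro exI[of _ "t1 + (t2 + 1)"] exI[of _ "((fst s2)(J := val (Reg (Suc J)) s2), snd s2)"] conjI) simp_all
  qed
  then show "\<exists>c D. evaluates c rs J (\<lambda>w \<rho>. F w (case_nat (A w \<rho>) \<rho>)) D" by blast
qed

text \<open>Weakening below \<open>m\<close> binders. Removing one register from \<open>rs\<close>
  renumbers the variables, so the program for \<open>F\<close> is reused with another register
  list.\<close>

lemma feas_skip:
  assumes F: "feas F"
  shows "feas (\<lambda>w \<rho>. F w (\<lambda>n. if n < m then \<rho> n else \<rho> (Suc n)))"
  unfolding feas_def
proof (intro conjI allI impI)
  obtain DF where DF: "\<And>w \<rho> y. sized w \<rho> y \<Longrightarrow> F w \<rho> \<le> y ^ DF"
    using poly_boundedE[OF feas_bounded[OF F]] by metis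
  show "poly_bounded (\<lambda>w \<rho>. F w (\<lambda>n. if n < m then \<rho> n else \<rho> (Suc n)))"
    by (rule poly_boundedI[OF DF]) (simp add: sized_def)
  fix rs J assume J: "0 < (J::nat)" and rs: "\<forall>r \<in> set rs. r < J"
  let ?rs = "take m rs @ drop (Suc m) rs"
  obtain c D where 1: "evaluates c ?rs J F D"
    by (rule feas_evaluates[OF F J, of ?rs]) (use rs in \<open>auto dest: in_set_takeD in_set_dropD\<close>)
  have env: "reg_env ?rs s = (\<lambda>n. if n < m then reg_env rs s n else reg_env rs s (Suc n))" for s
    by (auto simp: reg_env_def fun_eq_iff nth_append min_def)
  have "evaluates c rs J (\<lambda>w \<rho>. F w (\<lambda>n. if n < m then \<rho> n else \<rho> (Suc n))) D"
    unfolding evaluates_def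
  proof (intro allI impI)
    fix w s y assume l: "loaded w s" and y: "sized w (reg_env rs s) y"
    from y have "sized w (reg_env ?rs s) y" unfolding env by (simp add: sized_def)
    from 1 l this obtain t s' where "exec c s t s'" "t \<le> y ^ D" "fst s' J = F w (reg_env ?rs s)"
      "\<forall>r < J. fst s' r = fst s r" "snd s' = snd s" by (rule evaluatesE)
    then show "\<exists>t s'. exec c s t s' \<and> t \<le> y ^ D \<and>
        fst s' J = F w (\<lambda>n. if n < m then reg_env rs s n else reg_env rs s (Suc n)) \<and>
        (\<forall>r < J. fst s' r = fst s r) \<and> snd s' = snd s"
      unfolding env by blast
  qed
  then show "\<exists>c D. evaluates c rs J (\<lambda>w \<rho>. F w (\<lambda>n. if n < m then \<rho> n else \<rho> (Suc n))) D" by blast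
qed

lemma feas_shift: "feas F \<Longrightarrow> feas (\<lambda>w \<rho>. F w (\<lambda>n. \<rho> (Suc n)))"
  using feas_skip[of F 0] by simp

lemma feas_cell:
  assumes F: "feas F"
  shows "feas (\<lambda>w \<rho>. cell w (F w \<rho>))"
  unfolding feas_def
proof (intro conjI allI impI)
  show "poly_bounded (\<lambda>w \<rho>. cell w (F w \<rho>))"
    by (rule poly_bounded_mono[OF poly_bounded_const[of 2]]) (simp add: cell_def)
  fix rs J assume J: "0 < (J::nat)" and rs: "\<forall>r \<in> set rs. r < J"
  obtain c D where 1: "evaluates c rs J F D" using F J rs by (rule feas_evaluates)
  let ?c = "Seq c (Cond (Minus (Reg 0) (Reg J)) (Assign J (Get 2 (Reg J))) (Assign J (Num 0)))"
  have "evaluates ?c rs J (\<lambda>w \<rho>. cell w (F w \<rho>)) (D + 2 + 1)"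
    unfolding evaluates_def
  proof (intro allI impI)
    fix w s y assume l: "loaded w s" and y: "sized w (reg_env rs s) y"
    obtain t s1 where s1: "exec c s t s1" "t \<le> y ^ D" "fst s1 J = F w (reg_env rs s)"
      "\<forall>r < J. fst s1 r = fst s r" "snd s1 = snd s" using 1 l y by (rule evaluatesE)
    have l1: "fst s1 0 = length w" "\<forall>i < length w. snd s1 2 i = cell w i"
      using l s1 J by (simp_all add: loaded_def)
    have "exec (Cond (Minus (Reg 0) (Reg J)) (Assign J (Get 2 (Reg J))) (Assign J (Num 0))) s1 (1 + 1)
      ((fst s1)(J := cell w (F w (reg_env rs s))), snd s1)"
    proof (cases "F w (reg_env rs s) < length w")
      case True
      then have "val (Get 2 (Reg J)) s1 = cell w (F w (reg_env rs s))" using s1(3) l1(2) by simp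
      then have "exec (Assign J (Get 2 (Reg J))) s1 1 ((fst s1)(J := cell w (F w (reg_env rs s))), snd s1)"
        by (metis exec.Assign)
      then show ?thesis by (rule exec.CondTrue[rotated]) (use True s1(3) l1(1) in simp)
    next
      case False
      then have "val (Num 0) s1 = cell w (F w (reg_env rs s))" by (simp add: cell_def)
      then have "exec (Assign J (Num 0)) s1 1 ((fst s1)(J := cell w (F w (reg_env rs s))), snd s1)"
        by (metis exec.Assign)
      then show ?thesis by (rule exec.CondFalse[rotated]) (use False s1(3) l1(1) in simp)
    qed
    then have "exec ?c s (t + (1 + 1)) ((fst s1)(J := cell w (F w (reg_env rs s))), snd s1)"
      by (rule exec.Seq[OF s1(1)])
    moreover have "t + (1 + 1) \<le> y ^ (D + 2 + 1)"
      using s1(2) y const_le_power[of y 2] unfolding one_add_one by (intro add_le_power) (simp_all add: sized_def)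
    ultimately show "\<exists>t s'. exec ?c s t s' \<and> t \<le> y ^ (D + 2 + 1) \<and>
        fst s' J = cell w (F w (reg_env rs s)) \<and> (\<forall>r < J. fst s' r = fst s r) \<and> snd s' = snd s"
      using s1
      by (intro exI[of _ "t + (1 + 1)"] exI[of _ "((fst s1)(J := cell w (F w (reg_env rs s))), snd s1)"] conjI)
        simp_all
  qed
  then show "\<exists>c D. evaluates c rs J (\<lambda>w \<rho>. cell w (F w \<rho>)) D" by blast
qed

lemma feas_if_nonzero:
  assumes C: "feas C" and F: "feas F" and G: "feas G"
  shows "feas (\<lambda>w \<rho>. if C w \<rho> \<noteq> 0 then F w \<rho> else G w \<rho>)" (is "feas ?H")
  unfolding feas_def
proof (intro conjI allI impI)
  show "poly_bounded ?H"
    by (rule poly_bounded_mono[OF poly_bounded_add[OF feas_bounded[OF F] feas_bounded[OF G]]]) simp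
  fix rs J assume J: "0 < (J::nat)" and rs: "\<forall>r \<in> set rs. r < J"
  obtain c D where c: "evaluates c rs J C D" using C J rs by (rule feas_evaluates)
  obtain f D1 where f: "evaluates f rs J F D1" using F J rs by (rule feas_evaluates)
  obtain g D2 where g: "evaluates g rs J G D2" using G J rs by (rule feas_evaluates)
  let ?c = "Seq c (Cond (Reg J) f g)"
  let ?D = "D + (0 + (D1 + D2) + 1) + 1"
  have "evaluates ?c rs J ?H ?D"
    unfolding evaluates_def
  proof (intro allI impI)
    fix w s y assume l: "loaded w s" and y: "sized w (reg_env rs s) y"
    obtain t s1 where s1: "exec c s t s1" "t \<le> y ^ D" "fst s1 J = C w (reg_env rs s)"
      "\<forall>r < J. fst s1 r = fst s r" "snd s1 = snd s" using c l y by (rule evaluatesE)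
    have env: "reg_env rs s1 = reg_env rs s" using s1 rs by (auto intro: reg_env_cong)
    have l1: "loaded w s1" using l s1 J by (simp add: loaded_def)
    have y1: "sized w (reg_env rs s1) y" using y env by simp
    have "\<exists>t' s'. exec (Cond (Reg J) f g) s1 (1 + t') s' \<and> t' \<le> y ^ (D1 + D2) \<and>
        fst s' J = ?H w (reg_env rs s) \<and> (\<forall>r < J. fst s' r = fst s1 r) \<and> snd s' = snd s1"
    proof (cases "C w (reg_env rs s) = 0")
      case True
      from evaluates_mono[OF g] have "evaluates g rs J G (D1 + D2)" by simp
      from this l1 y1 obtain t' s' where *: "exec g s1 t' s'" "t' \<le> y ^ (D1 + D2)"
        "fst s' J = G w (reg_env rs s1)" "\<forall>r < J. fst s' r = fst s1 r" "snd s' = snd s1"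
        by (rule evaluatesE)
      have "exec (Cond (Reg J) f g) s1 (1 + t') s'"
        using *(1) by (rule exec.CondFalse[rotated]) (use True s1(3) in simp)
      with * True env show ?thesis by (intro exI[of _ t'] exI[of _ s'] conjI) simp_all
    next
      case False
      from evaluates_mono[OF f] have "evaluates f rs J F (D1 + D2)" by simp
      from this l1 y1 obtain t' s' where *: "exec f s1 t' s'" "t' \<le> y ^ (D1 + D2)"
        "fst s' J = F w (reg_env rs s1)" "\<forall>r < J. fst s' r = fst s1 r" "snd s' = snd s1"
        by (rule evaluatesE)
      have "exec (Cond (Reg J) f g) s1 (1 + t') s'"
        using *(1) by (rule exec.CondTrue[rotated]) (use False s1(3) in simp)
      with * False env show ?thesis by (intro exI[of _ t'] exI[of _ s'] conjI) simp_all
    qed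
    then obtain t' s' where *: "exec (Cond (Reg J) f g) s1 (1 + t') s'" "t' \<le> y ^ (D1 + D2)"
      "fst s' J = ?H w (reg_env rs s)" "\<forall>r < J. fst s' r = fst s1 r" "snd s' = snd s1" by blast
    have "exec ?c s (t + (1 + t')) s'" using s1(1) *(1) by (rule exec.Seq)
    moreover have "t + (1 + t') \<le> y ^ ?D"
      using s1(2) *(2) y by (intro add_le_power) (auto simp: sized_def)
    ultimately show "\<exists>t s'. exec ?c s t s' \<and> t \<le> y ^ ?D \<and>
        fst s' J = ?H w (reg_env rs s) \<and> (\<forall>r < J. fst s' r = fst s r) \<and> snd s' = snd s"
      using s1 * by (intro exI[of _ "t + (1 + t')"] exI[of _ s'] conjI) simp_all
  qed
  then show "\<exists>c D. evaluates c rs J ?H D" by blast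
qed

lemma loop_exec:
  assumes body: "\<And>i s. i < n \<Longrightarrow> Inv i s \<Longrightarrow> \<exists>t s'. exec c s t s' \<and> t \<le> T \<and> Inv (Suc i) s'"
    and test: "\<And>i s. Inv i s \<Longrightarrow> i \<le> n \<Longrightarrow> val e s \<noteq> 0 \<longleftrightarrow> i < n"
    and start: "Inv 0 s"
  shows "\<exists>t s'. exec (While e c) s t s' \<and> t \<le> n * (T + 1) + 1 \<and> Inv n s'"
proof -
  have "Inv (n - m) s \<Longrightarrow> m \<le> n \<Longrightarrow>
      \<exists>t s'. exec (While e c) s t s' \<and> t \<le> m * (T + 1) + 1 \<and> Inv n s'" for m s
  proof (induction m arbitrary: s)
    case 0
    then have "val e s = 0" using test[of n s] by simp
    then show ?case using 0 exec.WhileFalse[of e s c] by fastforce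
  next
    case (Suc m)
    then have v: "val e s \<noteq> 0" using test[of "n - Suc m" s] by simp
    obtain t s' where 1: "exec c s t s'" "t \<le> T" "Inv (Suc (n - Suc m)) s'"
      using body[of "n - Suc m" s] Suc.prems by auto
    have "Suc (n - Suc m) = n - m" using Suc.prems by simp
    then obtain t' s'' where 2: "exec (While e c) s' t' s''" "t' \<le> m * (T + 1) + 1" "Inv n s''"
      using Suc.IH[of s'] 1 Suc.prems by auto
    have "exec (While e c) s (1 + t + t') s''" using v 1(1) 2(1) by (rule exec.WhileTrue)
    then show ?case using 1 2 by (intro exI conjI) auto
  qed
  from this[of n s] start show ?thesis by simp
qed

lemma reg_env_Cons: "reg_env (r # rs) s = case_nat (fst s r) (reg_env rs s)"
  by (auto simp: reg_env_def fun_eq_iff split: nat.split)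

text \<open>Iterating a feasible step can outgrow every polynomial, for example by repeated
  doubling, so a bound \<open>B\<close> on all intermediate values is required. Registers
  \<open>J\<close>, \<open>J + 1\<close> and \<open>J + 2\<close> hold the accumulator, the counter
  and the number of rounds; the step is evaluated from \<open>J + 3\<close> on.\<close>

lemma feas_rec:
  fixes S :: "bool list \<Rightarrow> nat \<Rightarrow> nat \<Rightarrow> (nat \<Rightarrow> nat) \<Rightarrow> nat"
  assumes G: "feas G" and A: "feas A"
    and S: "feas (\<lambda>w \<rho>. S w (\<rho> 0) (\<rho> 1) (\<lambda>n. \<rho> (Suc (Suc n))))"
    and bound: "poly_bounded B"
    and le: "\<And>w \<rho> i. i \<le> G w \<rho> \<Longrightarrow> rec_nat (A w \<rho>) (\<lambda>i acc. S w acc i \<rho>) i \<le> B w \<rho>"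
  shows "feas (\<lambda>w \<rho>. rec_nat (A w \<rho>) (\<lambda>i acc. S w acc i \<rho>) (G w \<rho>))" (is "feas ?H")
  unfolding feas_def
proof (intro conjI allI impI)
  show "poly_bounded ?H"
    by (rule poly_bounded_mono[OF bound]) (simp add: le)
  fix rs J assume J: "0 < (J::nat)" and rs: "\<forall>r \<in> set rs. r < J"
  let ?S = "\<lambda>w \<rho>. S w (\<rho> 0) (\<rho> 1) (\<lambda>n. \<rho> (Suc (Suc n)))"
  obtain cA DA where cA: "evaluates cA rs J A DA" using A J rs by (rule feas_evaluates)
  obtain cG DG where cG: "evaluates cG rs (J + 2) G DG"
    by (rule feas_evaluates[OF G, of "J + 2" rs]) (use rs in auto)
  obtain cS DS where cS: "evaluates cS (J # Suc J # rs) (J + 3) ?S DS"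
    by (rule feas_evaluates[OF S, of "J + 3" "J # Suc J # rs"]) (use rs in auto)
  obtain X where X: "\<And>w \<rho> y. sized w \<rho> y \<Longrightarrow> G w \<rho> + B w \<rho> \<le> y ^ X"
    using poly_boundedE[OF poly_bounded_add[OF feas_bounded[OF G] bound]] by metis
  let ?body = "Seq cS (Seq (Assign J (Reg (J + 3))) (Assign (Suc J) (Plus (Reg (Suc J)) (Num 1))))"
  let ?e = "Minus (Reg (J + 2)) (Reg (Suc J))"
  let ?c = "Seq cA (Seq cG (Seq (Assign (Suc J) (Num 0)) (While ?e ?body)))"
  let ?T = "Suc X * DS + 2 + 1"
  let ?D = "DA + (DG + (0 + (X + (?T + 0 + 1) + 0 + 1) + 1) + 1) + 1"
  have "evaluates ?c rs J ?H ?D"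
    unfolding evaluates_def
  proof (intro allI impI)
    fix w s y assume l: "loaded w s" and y: "sized w (reg_env rs s) y"
    let ?\<rho> = "reg_env rs s"
    let ?r = "rec_nat (A w ?\<rho>) (\<lambda>i acc. S w acc i ?\<rho>)"
    have y2: "2 \<le> y" using y by (simp add: sized_def)
    obtain t1 s1 where s1: "exec cA s t1 s1" "t1 \<le> y ^ DA" "fst s1 J = A w ?\<rho>"
      "\<forall>r < J. fst s1 r = fst s r" "snd s1 = snd s" using cA l y by (rule evaluatesE)
    have env1: "reg_env rs s1 = ?\<rho>" using s1 rs by (auto intro: reg_env_cong)
    have l1: "loaded w s1" using l s1 J by (simp add: loaded_def)
    obtain t2 s2 where s2: "exec cG s1 t2 s2" "t2 \<le> y ^ DG" "fst s2 (J + 2) = G w ?\<rho>"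
      "\<forall>r < J + 2. fst s2 r = fst s1 r" "snd s2 = snd s1"
      using evaluatesE[OF cG l1, of y] y env1 by metis
    let ?s3 = "((fst s2)(Suc J := val (Num 0) s2), snd s2)"
    define Inv where "Inv i z \<longleftrightarrow> fst z J = ?r i \<and> fst z (Suc J) = i \<and> fst z (J + 2) = G w ?\<rho> \<and>
      (\<forall>r < J. fst z r = fst s r) \<and> snd z = snd s" for i z
    have I0: "Inv 0 ?s3" using s1 s2 by (simp add: Inv_def)
    have "\<exists>t z'. exec ?body z t z' \<and> t \<le> y ^ ?T \<and> Inv (Suc i) z'"
      if i: "i < G w ?\<rho>" and z: "Inv i z" for i z
    proof -
      have env: "reg_env rs z = ?\<rho>" using z rs by (auto intro: reg_env_cong simp: Inv_def)
      have lz: "loaded w z" using z l J by (simp add: loaded_def Inv_def)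
      have envz: "reg_env (J # Suc J # rs) z = case_nat (?r i) (case_nat i ?\<rho>)"
        using z by (simp add: reg_env_Cons env Inv_def)
      have "?r i \<le> B w ?\<rho>" "i \<le> G w ?\<rho>" using i by (auto intro: le)
      then have "?r i \<le> y ^ X" "i \<le> y ^ X" using X[OF y] by linarith+
      moreover have "y ^ X \<le> y ^ Suc X" using y2 by simp
      ultimately have "?r i \<le> y ^ Suc X" "i \<le> y ^ Suc X" by (meson le_trans)+
      then have "sized w (reg_env (J # Suc J # rs) z) (y ^ Suc X)"
        unfolding envz using sized_power[OF y, of X] by (simp add: sized_def split: nat.split del: power_Suc)
      with cS lz obtain t z1 where z1: "exec cS z t z1" "t \<le> (y ^ Suc X) ^ DS"
        "fst z1 (J + 3) = ?S w (reg_env (J # Suc J # rs) z)"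
        "\<forall>r < J + 3. fst z1 r = fst z r" "snd z1 = snd z" by (rule evaluatesE)
      let ?z2 = "((fst z1)(J := val (Reg (J + 3)) z1), snd z1)"
      let ?z3 = "((fst ?z2)(Suc J := val (Plus (Reg (Suc J)) (Num 1)) ?z2), snd ?z2)"
      have "exec ?body z (t + (1 + 1)) ?z3"
        by (rule exec.Seq[OF z1(1) exec.Seq[OF exec.Assign exec.Assign]])
      moreover have "t + (1 + 1) \<le> y ^ ?T"
        unfolding one_add_one
        by (rule add_le_power[OF y2 _ const_le_power[OF y2]]) (use z1(2) in \<open>simp only: power_mult\<close>)
      moreover have "Inv (Suc i) ?z3"
        using z z1 by (simp add: Inv_def envz)
      ultimately show ?thesis by blast
    qed
    moreover have "val ?e z \<noteq> 0 \<longleftrightarrow> i < G w ?\<rho>" if "Inv i z" for i z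
      using that by (auto simp: Inv_def)
    ultimately have "\<exists>t z. exec (While ?e ?body) ?s3 t z \<and> t \<le> G w ?\<rho> * (y ^ ?T + 1) + 1 \<and> Inv (G w ?\<rho>) z"
      using I0 by (intro loop_exec[where Inv = Inv and e = ?e and c = ?body]) blast+
    then obtain t4 s4 where s4: "exec (While ?e ?body) ?s3 t4 s4"
      "t4 \<le> G w ?\<rho> * (y ^ ?T + 1) + 1" "Inv (G w ?\<rho>) s4" by blast
    have "exec ?c s (t1 + (t2 + (1 + t4))) s4"
      by (rule exec.Seq[OF s1(1) exec.Seq[OF s2(1) exec.Seq[OF exec.Assign s4(1)]]])
    moreover have "G w ?\<rho> * (y ^ ?T + 1) + 1 \<le> y ^ (X + (?T + 0 + 1) + 0 + 1)"
      using X[OF y] y2 by (intro add_le_power mult_le_power) auto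
    then have "t1 + (t2 + (1 + t4)) \<le> y ^ ?D"
      using s1(2) s2(2) s4(2) y2 by (intro add_le_power) auto
    ultimately show "\<exists>t s'. exec ?c s t s' \<and> t \<le> y ^ ?D \<and>
        fst s' J = ?H w ?\<rho> \<and> (\<forall>r < J. fst s' r = fst s r) \<and> snd s' = snd s"
      using s4(3) unfolding Inv_def by blast
  qed
  then show "\<exists>c D. evaluates c rs J ?H D" by blast
qed

text \<open>Partial sums are bounded by the whole sum, so the bound that \<open>feas_rec\<close>
  asks for comes for free. Bounded quantifiers, multiplication and division are all obtained from
  sums.\<close>

lemma feas_sum:
  assumes G: "feas G" and B: "feas (\<lambda>w \<rho>. B w (\<lambda>n. \<rho> (Suc n)) (\<rho> 0))"
  shows "feas (\<lambda>w \<rho>. \<Sum>i<G w \<rho>. B w \<rho> i)"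
proof -
  have rec: "rec_nat 0 (\<lambda>i acc. acc + f i) n = (\<Sum>i<n. f i)" for f :: "nat \<Rightarrow> nat" and n
    by (induction n) simp_all
  have "feas (\<lambda>w \<rho>. \<rho> 0 + B w (\<lambda>n. \<rho> (Suc (Suc n))) (\<rho> 1))"
    using feas_add[OF feas_var[of 0] feas_shift[OF B]] by simp
  moreover have "poly_bounded (\<lambda>w \<rho>. \<Sum>i<G w \<rho>. B w \<rho> i)"
  proof -
    obtain X where X: "\<And>w \<rho> y. sized w \<rho> y \<Longrightarrow> G w \<rho> \<le> y ^ X"
      using poly_boundedE[OF feas_bounded[OF G]] by metis
    obtain Z where Z: "\<And>w \<rho> y. sized w \<rho> y \<Longrightarrow> B w (\<lambda>n. \<rho> (Suc n)) (\<rho> 0) \<le> y ^ Z"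
      using poly_boundedE[OF feas_bounded[OF B]] by metis
    show ?thesis
    proof (rule poly_boundedI[where D = "X + Suc X * Z"])
      fix w \<rho> y assume y: "sized w \<rho> (y::nat)"
      have "y ^ X \<le> y ^ Suc X" using y by (simp add: sized_def)
      then have "sized w (case_nat i \<rho>) (y ^ Suc X)" if "i < G w \<rho>" for i
        using sized_power[OF y, of X] that X[OF y]
        by (simp add: sized_def split: nat.split del: power_Suc)
      from Z[OF this] have "B w \<rho> i \<le> y ^ (Suc X * Z)" if "i < G w \<rho>" for i
        using that by (simp only: power_mult nat.case)
      then have "(\<Sum>i<G w \<rho>. B w \<rho> i) \<le> G w \<rho> * y ^ (Suc X * Z)"
        using sum_bounded_above[of "{..<G w \<rho>}" "B w \<rho>" "y ^ (Suc X * Z)"] by simp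
      also have "\<dots> \<le> y ^ (X + Suc X * Z)"
        by (rule mult_le_power[OF X[OF y]]) simp
      finally show "(\<Sum>i<G w \<rho>. B w \<rho> i) \<le> y ^ (X + Suc X * Z)" .
    qed
  qed
  ultimately have "feas (\<lambda>w \<rho>. rec_nat 0 (\<lambda>i acc. acc + B w \<rho> i) (G w \<rho>))"
    by (intro feas_rec[OF G feas_const[of 0], of "\<lambda>w acc i \<rho>. acc + B w \<rho> i" "\<lambda>w \<rho>. \<Sum>i<G w \<rho>. B w \<rho> i"])
      (auto simp: rec intro: sum_mono2)
  then show ?thesis by (simp add: rec)
qed

section \<open>Feasible predicates and derived arithmetic\<close>

definition feasb :: "(bool list \<Rightarrow> (nat \<Rightarrow> nat) \<Rightarrow> bool) \<Rightarrow> bool" where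
  "feasb P \<longleftrightarrow> feas (\<lambda>w \<rho>. of_bool (P w \<rho>))"

lemma feas_if: "feasb P \<Longrightarrow> feas F \<Longrightarrow> feas G \<Longrightarrow> feas (\<lambda>w \<rho>. if P w \<rho> then F w \<rho> else G w \<rho>)"
  unfolding feasb_def by (drule (2) feas_if_nonzero) (simp add: if_distrib)

lemma feas_of_bool: "feasb P \<Longrightarrow> feas (\<lambda>w \<rho>. of_bool (P w \<rho>))"
  by (simp add: feasb_def)

lemma feasbI:
  assumes "feas F" "\<And>w \<rho>. F w \<rho> \<noteq> 0 \<longleftrightarrow> P w \<rho>"
  shows "feasb P"
  using feas_if_nonzero[OF assms(1) feas_const[of 1] feas_const[of 0]] assms(2)
  by (simp add: feasb_def of_bool_def if_distrib cong: if_cong)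

lemma feasb_less: "feas F \<Longrightarrow> feas G \<Longrightarrow> feasb (\<lambda>w \<rho>. F w \<rho> < G w \<rho>)"
  by (rule feasbI[of "\<lambda>w \<rho>. G w \<rho> - F w \<rho>"]) (auto intro: feas_diff)

lemma feasb_not: "feasb P \<Longrightarrow> feasb (\<lambda>w \<rho>. \<not> P w \<rho>)"
  by (rule feasbI[of "\<lambda>w \<rho>. 1 - of_bool (P w \<rho>)"]) (auto intro!: feas_diff feas_const feas_of_bool)

lemma feasb_disj: "feasb P \<Longrightarrow> feasb Q \<Longrightarrow> feasb (\<lambda>w \<rho>. P w \<rho> \<or> Q w \<rho>)"
  by (rule feasbI[of "\<lambda>w \<rho>. of_bool (P w \<rho>) + of_bool (Q w \<rho>)"]) (auto intro!: feas_add feas_of_bool)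

lemma feasb_conj: "feasb P \<Longrightarrow> feasb Q \<Longrightarrow> feasb (\<lambda>w \<rho>. P w \<rho> \<and> Q w \<rho>)"
  by (rule feasbI[of "\<lambda>w \<rho>. if P w \<rho> then of_bool (Q w \<rho>) else 0"]) (auto intro!: feas_if feas_of_bool feas_const)

lemma feasb_imp: "feasb P \<Longrightarrow> feasb Q \<Longrightarrow> feasb (\<lambda>w \<rho>. P w \<rho> \<longrightarrow> Q w \<rho>)"
  by (rule feasbI[of "\<lambda>w \<rho>. if P w \<rho> then of_bool (Q w \<rho>) else 1"]) (auto intro!: feas_if feas_of_bool feas_const)

lemma feasb_le: "feas F \<Longrightarrow> feas G \<Longrightarrow> feasb (\<lambda>w \<rho>. F w \<rho> \<le> G w \<rho>)"
  using feasb_not[OF feasb_less[of G F]] by (simp add: not_less)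

lemma feasb_eq: "feas F \<Longrightarrow> feas G \<Longrightarrow> feasb (\<lambda>w \<rho>. F w \<rho> = G w \<rho>)"
  using feasb_conj[OF feasb_le[of F G] feasb_le[of G F]] by (simp add: eq_iff)

lemma feasb_const: "feasb (\<lambda>w \<rho>. b)"
  by (simp add: feasb_def feas_const)

lemma feasb_ex_less:
  assumes "feas G" "feasb (\<lambda>w \<rho>. P w (\<lambda>n. \<rho> (Suc n)) (\<rho> 0))"
  shows "feasb (\<lambda>w \<rho>. \<exists>i < G w \<rho>. P w \<rho> i)"
  by (rule feasbI[OF feas_sum[OF assms(1) assms(2)[unfolded feasb_def]]]) (auto simp: Bex_def)

lemma feasb_all_less:
  assumes "feas G" "feasb (\<lambda>w \<rho>. P w (\<lambda>n. \<rho> (Suc n)) (\<rho> 0))"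
  shows "feasb (\<lambda>w \<rho>. \<forall>i < G w \<rho>. P w \<rho> i)"
  using feasb_not[OF feasb_ex_less[OF assms(1) feasb_not[OF assms(2)]]] by simp

lemma feas_mult: "feas F \<Longrightarrow> feas G \<Longrightarrow> feas (\<lambda>w \<rho>. F w \<rho> * G w \<rho>)"
  using feas_sum[of F "\<lambda>w \<rho> i. G w \<rho>"] feas_shift[of G] by simp

lemma feas_power: "feas F \<Longrightarrow> feas (\<lambda>w \<rho>. F w \<rho> ^ n)"
  by (induction n) (simp_all add: feas_const feas_mult)

text \<open>The machine can only halve. The quotient is the number of \<open>i\<close> below
  \<open>a\<close> such that \<open>Suc i\<close> copies of \<open>b\<close> fit into
  \<open>a\<close>, which is a bounded sum of tests.\<close>

lemma div_eq_sum: "a div b = (if b = 0 then 0 else \<Sum>i<a. of_bool (Suc i * b \<le> a))" for a b :: nat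
proof (cases "b = 0")
  case False
  then have "Suc i * b \<le> a \<longleftrightarrow> i < a div b" for i
    by (metis Suc_le_eq less_eq_div_iff_mult_less_eq neq0_conv)
  then have "(\<Sum>i<a. of_bool (Suc i * b \<le> a)) = (\<Sum>i<a. of_bool (i < a div b) :: nat)" by simp
  also have "\<dots> = card ({..<a} \<inter> {i. i < a div b})"
    by (subst sum_of_bool_eq) (simp_all add: Int_def)
  also have "{..<a} \<inter> {i. i < a div b} = {..<a div b}"
    by (auto intro: less_le_trans)
  finally show ?thesis using False by simp
qed simp

lemma feas_Suc: "feas F \<Longrightarrow> feas (\<lambda>w \<rho>. Suc (F w \<rho>))"
  using feas_add[OF _ feas_const[of 1]] by simp

lemma feas_div:
  assumes "feas F" "feas G"
  shows "feas (\<lambda>w \<rho>. F w \<rho> div G w \<rho>)"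
proof -
  have "feas (\<lambda>w \<rho>. if G w \<rho> = 0 then 0 else \<Sum>i<F w \<rho>. of_bool (Suc i * G w \<rho> \<le> F w \<rho>))"
    by (intro feas_if feasb_eq feas_const feas_sum feas_of_bool feasb_le feas_mult feas_Suc feas_var
        feas_shift[OF assms(1)] feas_shift[OF assms(2)] assms)
  then show ?thesis by (simp only: div_eq_sum[symmetric])
qed

lemma feas_mod: "feas F \<Longrightarrow> feas G \<Longrightarrow> feas (\<lambda>w \<rho>. F w \<rho> mod G w \<rho>)"
  unfolding minus_div_mult_eq_mod[symmetric] by (intro feas_diff feas_mult feas_div)

lemma feasb_odd: "feas F \<Longrightarrow> feasb (\<lambda>w \<rho>. odd (F w \<rho>))"
  by (rule feasbI[of "\<lambda>w \<rho>. F w \<rho> mod 2"]) (auto intro: feas_mod feas_const simp: odd_iff_mod_2_eq_one)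

lemma feas_comp1:
  assumes "feas (\<lambda>w \<rho>. f w (\<rho> 0))" "feas A"
  shows "feas (\<lambda>w \<rho>. f w (A w \<rho>))"
  using feas_subst[OF assms] by simp

lemma feas_comp2:
  assumes "feas (\<lambda>w \<rho>. f w (\<rho> 0) (\<rho> 1))" "feas A" "feas B"
  shows "feas (\<lambda>w \<rho>. f w (A w \<rho>) (B w \<rho>))"
proof -
  have "feas (\<lambda>w \<rho>. f w (A w (\<lambda>n. \<rho> (Suc n))) (\<rho> 0))"
    using feas_subst[OF assms(1) feas_shift[OF assms(2)]] by simp
  from feas_subst[OF this assms(3)] show ?thesis by simp
qed

lemma feas_shift_add: "feas F \<Longrightarrow> feas (\<lambda>w \<rho>. F w (\<lambda>n. \<rho> (n + m)))"
proof (induction m)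
  case (Suc m)
  from feas_shift[OF Suc.IH[OF Suc.prems]] show ?case by simp
qed simp

text \<open>A string is presented by its length and a function that recomputes any cell on demand,
  with the position as new variable 0. Strings can thus be concatenated and nested without storage;
  only the final program writes an array.\<close>

definition feas_string :: "(bool list \<Rightarrow> (nat \<Rightarrow> nat) \<Rightarrow> bool list) \<Rightarrow> bool" where
  "feas_string S \<longleftrightarrow> feas (\<lambda>w \<rho>. length (S w \<rho>)) \<and>
     feas (\<lambda>w \<rho>. cell (S w (\<lambda>n. \<rho> (Suc n))) (\<rho> 0))"

lemma feas_string_length: "feas_string S \<Longrightarrow> feas (\<lambda>w \<rho>. length (S w \<rho>))"
  by (simp add: feas_string_def)

lemma feas_string_cell: "feas_string S \<Longrightarrow> feas A \<Longrightarrow> feas (\<lambda>w \<rho>. cell (S w \<rho>) (A w \<rho>))"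
  unfolding feas_string_def
  using feas_subst[of "\<lambda>w \<rho>. cell (S w (\<lambda>n. \<rho> (Suc n))) (\<rho> 0)" A] by simp

lemma feas_string_skip:
  assumes "feas_string S"
  shows "feas_string (\<lambda>w \<rho>. S w (\<lambda>n. if n < m then \<rho> n else \<rho> (Suc n)))"
proof -
  have "feas (\<lambda>w \<rho>. length (S w \<rho>))" "feas (\<lambda>w \<rho>. cell (S w (\<lambda>n. \<rho> (Suc n))) (\<rho> 0))"
    using assms by (simp_all add: feas_string_def)
  from feas_skip[OF this(1), of m] feas_skip[OF this(2), of "Suc m"]
  show ?thesis by (simp add: feas_string_def if_distrib[of "\<lambda>n. _ n"] cong: if_cong)
qed

lemma feas_string_shift: "feas_string S \<Longrightarrow> feas_string (\<lambda>w \<rho>. S w (\<lambda>n. \<rho> (Suc n)))"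
  using feas_string_skip[of S 0] by simp

lemma feas_string_shift1:
  "feas_string (\<lambda>w \<rho>. S w (\<lambda>n. \<rho> (Suc n)) (\<rho> 0)) \<Longrightarrow> feas_string (\<lambda>w \<rho>. S w (\<lambda>n. \<rho> (Suc (Suc n))) (\<rho> 0))"
  using feas_string_skip[of "\<lambda>w \<rho>. S w (\<lambda>n. \<rho> (Suc n)) (\<rho> 0)" 1] by simp

lemma feas_string_bind:
  assumes "feas_string (\<lambda>w \<rho>. S w (\<lambda>n. \<rho> (Suc n)) (\<rho> 0))" "feas A"
  shows "feas_string (\<lambda>w \<rho>. S w \<rho> (A w \<rho>))"
  unfolding feas_string_def
proof
  show "feas (\<lambda>w \<rho>. length (S w \<rho> (A w \<rho>)))"
    using feas_subst[OF feas_string_length[OF assms(1)] assms(2)] by simp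
  have "feas (\<lambda>w \<rho>. cell (S w (\<lambda>n. \<rho> (Suc (Suc n))) (\<rho> 0)) (\<rho> 1))"
    by (rule feas_string_cell[OF feas_string_shift1[OF assms(1)] feas_var])
  from feas_subst[OF this feas_shift[OF assms(2)]]
  show "feas (\<lambda>w \<rho>. cell (S w (\<lambda>n. \<rho> (Suc n)) (A w (\<lambda>n. \<rho> (Suc n)))) (\<rho> 0))" by simp
qed

lemma feas_string_append:
  assumes "feas_string X" "feas_string Y"
  shows "feas_string (\<lambda>w \<rho>. X w \<rho> @ Y w \<rho>)"
proof -
  have "feas (\<lambda>w \<rho>. if \<rho> 0 < length (X w (\<lambda>n. \<rho> (Suc n))) then cell (X w (\<lambda>n. \<rho> (Suc n))) (\<rho> 0)
     else cell (Y w (\<lambda>n. \<rho> (Suc n))) (\<rho> 0 - length (X w (\<lambda>n. \<rho> (Suc n)))))"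
    by (intro feas_if feasb_less feas_string_cell feas_diff feas_var feas_string_shift assms
        feas_string_length[OF feas_string_shift[OF assms(1)]])
  moreover have "cell (xs @ ys) i = (if i < length xs then cell xs i else cell ys (i - length xs))" for xs ys i
    by (auto simp: cell_def nth_append)
  ultimately show ?thesis
    using feas_add[OF assms[THEN feas_string_length]] by (simp add: feas_string_def)
qed

lemma feas_string_if:
  assumes "feasb P" "feas_string X" "feas_string Y"
  shows "feas_string (\<lambda>w \<rho>. if P w \<rho> then X w \<rho> else Y w \<rho>)"
proof -
  have "feas (\<lambda>w \<rho>. if P w \<rho> then length (X w \<rho>) else length (Y w \<rho>))"
    by (intro feas_if feas_string_length assms)
  moreover have "feas (\<lambda>w \<rho>. if P w (\<lambda>n. \<rho> (Suc n)) then cell (X w (\<lambda>n. \<rho> (Suc n))) (\<rho> 0)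
      else cell (Y w (\<lambda>n. \<rho> (Suc n))) (\<rho> 0))"
    using feas_shift[of "\<lambda>w \<rho>. of_bool (P w \<rho>)"] assms
    by (intro feas_if) (simp_all add: feasb_def feas_string_def)
  ultimately show ?thesis by (simp add: feas_string_def if_distrib[of length] if_distrib[of cell] if_distribR cong: if_cong)
qed

lemma feas_string_bit: "feasb P \<Longrightarrow> feas_string (\<lambda>w \<rho>. [P w \<rho>])"
proof -
  assume P: "feasb P"
  have "feas (\<lambda>w \<rho>. if \<rho> 0 = 0 then if P w (\<lambda>n. \<rho> (Suc n)) then 2 else 1 else 0)"
    using feas_shift[OF P[unfolded feasb_def]] by (intro feas_if feasb_eq feas_var feas_const) (simp add: feasb_def)
  moreover have "cell [b] i = (if i = 0 then if b then 2 else 1 else 0)" for b i by (simp add: cell_def)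
  ultimately show ?thesis by (simp add: feas_string_def feas_const)
qed

lemma feas_string_Cons: "feasb P \<Longrightarrow> feas_string X \<Longrightarrow> feas_string (\<lambda>w \<rho>. P w \<rho> # X w \<rho>)"
  using feas_string_append[OF feas_string_bit] by simp

lemma length_concat_upt: "length (concat (map f [0..<n])) = (\<Sum>v<n. length (f v))"
  by (induction n) simp_all

text \<open>\<open>b f n i\<close> counts the blocks that end at or before position
  \<open>i\<close>, which is the index of the block containing \<open>i\<close>; subtracting the
  prefix length \<open>L\<close> gives the offset inside it.\<close>

lemma cell_concat_upt:
  defines "L \<equiv> \<lambda>f v. \<Sum>u<v. length (f u :: bool list)"
  defines "b \<equiv> \<lambda>f n i. \<Sum>v<n. of_bool (L f (Suc v) \<le> i) :: nat"
  shows "cell (concat (map f [0..<n])) i =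
    (if b f n i < n then cell (f (b f n i)) (i - L f (b f n i)) else 0)"
proof (cases "i < L f n")
  case False
  have "L f v \<le> L f n" if "v \<le> n" for v
    unfolding L_def using that by (intro sum_mono2) auto
  then have "b f n i = (\<Sum>v<n. 1)"
    unfolding b_def using False by (intro sum.cong) (auto simp: not_less Suc_le_eq intro: order_trans[rotated])
  then show ?thesis using False by (simp add: cell_def length_concat_upt L_def)
next
  case True
  have mono: "L f v \<le> L f v'" if "v \<le> v'" for v v'
    unfolding L_def using that by (intro sum_mono2) auto
  define v where "v = (LEAST v. i < L f (Suc v))"
  have n: "n \<noteq> 0" using True by (cases n) (auto simp: L_def)
  then have ex: "i < L f (Suc (n - 1))" using True by simp
  then have v: "i < L f (Suc v)" unfolding v_def by (rule LeastI)
  have vn: "v < n" using Least_le[of "\<lambda>v. i < L f (Suc v)", OF ex] n by (simp add: v_def)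
  have vi: "L f v \<le> i"
  proof (cases v)
    case (Suc u)
    then have "\<not> i < L f (Suc u)" using not_less_Least[of u "\<lambda>v. i < L f (Suc v)"] by (simp add: v_def)
    then show ?thesis using Suc by simp
  qed (simp add: L_def)
  have iff: "L f (Suc u) \<le> i \<longleftrightarrow> u < v" for u
    using mono[of "Suc u" v] mono[of "Suc v" "Suc u"] v vi by (cases "u < v") auto
  have "b f n i = (\<Sum>u<n. of_bool (u < v))" unfolding b_def iff ..
  also have "\<dots> = card ({..<n} \<inter> {u. u < v})" by (subst sum_of_bool_eq) (simp_all add: Int_def)
  also have "{..<n} \<inter> {u. u < v} = {..<v}" using vn by auto
  finally have b: "b f n i = v" by simp
  have "[0..<n] = [0..<v] @ v # [Suc v..<n]"
    using upt_add_eq_append[of 0 v "n - v"] upt_conv_Cons[OF vn] vn by simp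
  then have "concat (map f [0..<n]) = concat (map f [0..<v]) @ f v @ concat (map f [Suc v..<n])" by simp
  moreover have "length (concat (map f [0..<v])) = L f v" by (simp add: L_def length_concat_upt)
  moreover have "i - L f v < length (f v)" using v vi by (simp add: L_def)
  ultimately show ?thesis using vi vn b by (simp add: cell_def nth_append)
qed

lemma feas_string_concat_upt:
  assumes N: "feas N" and S: "feas_string (\<lambda>w \<rho>. S w (\<lambda>n. \<rho> (Suc n)) (\<rho> 0))"
  shows "feas_string (\<lambda>w \<rho>. concat (map (S w \<rho>) [0..<N w \<rho>]))"
proof -
  have S1: "feas_string (\<lambda>w \<rho>. S w (\<lambda>n. \<rho> (Suc (Suc n))) (\<rho> 0))"
    using feas_string_shift1[OF S] .
  have L1: "feas (\<lambda>w \<rho>. \<Sum>u<Suc (A w \<rho>). length (S w (\<lambda>n. \<rho> (Suc n)) u))" if "feas A" for A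
    by (intro feas_sum feas_Suc that feas_string_length[OF S1])
  have L0: "feas (\<lambda>w \<rho>. \<Sum>u<A w \<rho>. length (S w (\<lambda>n. \<rho> (Suc n)) u))" if "feas A" for A
    by (intro feas_sum feas_Suc that feas_string_length[OF S1])
  have L2: "feas (\<lambda>w \<rho>. \<Sum>u<Suc (\<rho> 0). length (S w (\<lambda>n. \<rho> (Suc (Suc n))) u))"
    using feas_string_skip[OF S1, of 1] by (intro feas_sum feas_Suc feas_var feas_string_length) simp
  let ?b = "\<lambda>w \<rho>. \<Sum>v<N w (\<lambda>n. \<rho> (Suc n)). of_bool ((\<Sum>u<Suc v. length (S w (\<lambda>n. \<rho> (Suc n)) u)) \<le> \<rho> 0)"
  have b: "feas ?b"
    by (intro feas_sum feas_of_bool feasb_le L2 feas_var feas_shift N)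
  have Sb: "feas_string (\<lambda>w \<rho>. S w (\<lambda>n. \<rho> (Suc n)) (?b w \<rho>))"
    by (rule feas_string_bind[OF S1 b])
  have "feas (\<lambda>w \<rho>. cell (S w (\<lambda>n. \<rho> (Suc n)) (?b w \<rho>))
      (\<rho> 0 - (\<Sum>u<?b w \<rho>. length (S w (\<lambda>n. \<rho> (Suc n)) u))))"
    by (rule feas_string_cell[OF Sb feas_diff[OF feas_var L0[OF b]]])
  then have "feas (\<lambda>w \<rho>. if ?b w \<rho> < N w (\<lambda>n. \<rho> (Suc n)) then
      cell (S w (\<lambda>n. \<rho> (Suc n)) (?b w \<rho>)) (\<rho> 0 - (\<Sum>u<?b w \<rho>. length (S w (\<lambda>n. \<rho> (Suc n)) u))) else 0)"
    by (intro feas_if[OF feasb_less[OF b feas_shift[OF N]] _ feas_const])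
  then show ?thesis
    unfolding feas_string_def length_concat_upt cell_concat_upt
    using feas_sum[OF N feas_string_length[OF S]] by simp
qed

lemma feas_string_map_upt:
  assumes "feas N" "feasb (\<lambda>w \<rho>. P w (\<lambda>n. \<rho> (Suc n)) (\<rho> 0))"
  shows "feas_string (\<lambda>w \<rho>. map (P w \<rho>) [0..<N w \<rho>])"
proof -
  have "map f xs = concat (map (\<lambda>x. [f x]) xs)" for f :: "nat \<Rightarrow> bool" and xs
    by (induction xs) simp_all
  then show ?thesis
    using feas_string_concat_upt[OF assms(1) feas_string_bit[OF assms(2)]] by simp
qed

section \<open>Programs for feasible strings and their composition with fpt-reductions\<close>

lemma exec_writes:
  "exec c s t s' \<Longrightarrow> finite {i. snd s' a i \<noteq> snd s a i} \<and> card {i. snd s' a i \<noteq> snd s a i} \<le> t"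
proof (induction rule: exec.induct)
  case (Put b i e s)
  have "{j. snd (fst s, (snd s)(b := (snd s b)(val i s := val e s))) a j \<noteq> snd s a j} \<subseteq> {val i s}" by auto
  from card_mono[OF _ this] finite_subset[OF this] show ?case by simp
next
  case (Seq c1 s1 t1 s2 c2 t2 s3)
  have "{i. snd s3 a i \<noteq> snd s1 a i} \<subseteq> {i. snd s2 a i \<noteq> snd s1 a i} \<union> {i. snd s3 a i \<noteq> snd s2 a i}" by auto
  with Seq.IH show ?case by (meson add_le_mono card_mono card_Un_le finite_UnI finite_subset le_trans)
next
  case (WhileTrue e s1 c t1 s2 t2 s3)
  have "{i. snd s3 a i \<noteq> snd s1 a i} \<subseteq> {i. snd s2 a i \<noteq> snd s1 a i} \<union> {i. snd s3 a i \<noteq> snd s2 a i}" by auto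
  with WhileTrue.IH have "finite {i. snd s3 a i \<noteq> snd s1 a i} \<and> card {i. snd s3 a i \<noteq> snd s1 a i} \<le> t1 + t2"
    by (meson add_le_mono card_mono card_Un_le finite_UnI finite_subset le_trans)
  then show ?case by simp
qed auto

text \<open>A step writes at most one cell, and array 1 starts with zeros while bits are stored as 1
  and 2. In a composition this bounds the intermediate string, hence the time of the second program,
  by the time of the first.\<close>

lemma output_length_le:
  assumes "exec c (input_state w) t s" "outputs s v"
  shows "length v \<le> t"
proof -
  have "{..<length v} \<subseteq> {i. snd s 1 i \<noteq> snd (input_state w) 1 i}"
    using assms(2) by (auto simp: outputs_def input_state_def cell_def)
  with exec_writes[OF assms(1), of 1] show ?thesis
    by (metis card_lessThan card_mono le_trans)
qed

text \<open>The program is to run after another one, hence nothing is assumed about registers and arrays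
  other than array 1.\<close>

lemma feas_string_program:
  assumes R: "feas_string (\<lambda>w \<rho>. R w)"
  shows "\<exists>c D. \<forall>w s. (\<forall>i \<le> length w. snd s 1 i = cell w i) \<longrightarrow>
    (\<exists>t s'. exec c s t s' \<and> t \<le> (length w + 2) ^ D \<and> outputs s' (R w))"
proof -
  have R': "feas (\<lambda>w \<rho>. length (R w))" "feas (\<lambda>w \<rho>. cell (R w) (\<rho> 0))"
    using R by (simp_all add: feas_string_def)
  obtain cL DL where cL: "evaluates cL [] 1 (\<lambda>w \<rho>. length (R w)) DL"
    by (rule feas_evaluates[OF R'(1), of 1 "[]"]) auto
  obtain cC DC where cC: "evaluates cC [2] 3 (\<lambda>w \<rho>. cell (R w) (\<rho> 0)) DC"
    by (rule feas_evaluates[OF R'(2), of 3 "[2]"]) auto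
  obtain X where X: "\<And>w \<rho> y. sized w \<rho> y \<Longrightarrow> length (R w) \<le> y ^ X"
    using poly_boundedE[OF feas_bounded[OF R'(1)]] by metis
  let ?inc = "\<lambda>r. Assign r (Plus (Reg r) (Num 1))"
  let ?copy = "Seq (Put 2 (Reg 0) (Get 1 (Reg 0))) (?inc 0)"
  let ?body = "Seq cC (Seq (Put 1 (Reg 2) (Reg 3)) (?inc 2))"
  \<comment> \<open>One round more than the output has bits: the last one writes the end mark 0,
    because array 1 still holds the input string, which may be longer.\<close>
  let ?e = "Minus (Plus (Reg 1) (Num 1)) (Reg 2)"
  let ?c = "Seq (Assign 0 (Num 0)) (Seq (While (Get 1 (Reg 0)) ?copy)
    (Seq cL (Seq (Assign 2 (Num 0)) (While ?e ?body))))"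
  let ?T = "Suc X * DC + 2 + 1"
  let ?D = "0 + ((1 + (2 + 0 + 1) + 0 + 1) + (DL + (0 + ((X + 0 + 1) + (?T + 0 + 1) + 0 + 1) + 1) + 1) + 1) + 1"
  have "\<exists>t s'. exec ?c s t s' \<and> t \<le> (length w + 2) ^ ?D \<and> outputs s' (R w)"
    if inp: "\<forall>i \<le> length w. snd s 1 i = cell w i" for w s
  proof -
    define y where "y = length w + 2"
    have y2: "2 \<le> y" by (simp add: y_def)
    have y0: "sized w (\<lambda>_. 0) y" by (simp add: y_def sized_def)
    define Inv where "Inv i z \<longleftrightarrow> fst z 0 = i \<and> (\<forall>j \<le> length w. snd z 1 j = cell w j) \<and> (\<forall>j < i. snd z 2 j = cell w j)"
      for i and z :: state
    have step: "\<exists>t z'. exec ?copy z t z' \<and> t \<le> 2 \<and> Inv (Suc i) z'" if "i < length w" "Inv i z" for i z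
    proof -
      have "exec ?copy z (1 + 1) ((fst z)(0 := Suc i), (snd z)(2 := (snd z 2)(i := cell w i)))"
        using exec.Seq[OF exec.Put[of 2 "Reg 0" "Get 1 (Reg 0)" z] exec.Assign[of 0 "Plus (Reg 0) (Num 1)"]] that
        by (simp add: Inv_def)
      moreover have "Inv (Suc i) ((fst z)(0 := Suc i), (snd z)(2 := (snd z 2)(i := cell w i)))"
        using that by (auto simp: Inv_def less_Suc_eq)
      ultimately show ?thesis unfolding one_add_one by blast
    qed
    let ?s0 = "((fst s)(0 := val (Num 0) s), snd s)"
    have "\<exists>t z'. exec (While (Get 1 (Reg 0)) ?copy) ?s0 t z' \<and> t \<le> length w * (2 + 1) + 1 \<and> Inv (length w) z'"
    proof (rule loop_exec[where Inv = Inv])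
      show "Inv 0 ?s0" using inp by (simp add: Inv_def)
      show "val (Get 1 (Reg 0)) z \<noteq> 0 \<longleftrightarrow> i < length w" if "Inv i z" "i \<le> length w" for i z
        using that by (auto simp: Inv_def cell_def)
    qed (use step in blast)
    then obtain t1 s1 where s1: "exec (While (Get 1 (Reg 0)) ?copy) ?s0 t1 s1"
      "t1 \<le> length w * (2 + 1) + 1" "Inv (length w) s1" by blast
    then have l1: "loaded w s1" by (simp add: Inv_def loaded_def)
    have nil: "reg_env [] z = (\<lambda>_. 0)" for z by (simp add: reg_env_def fun_eq_iff)
    from cL l1 y0[folded nil[of s1]] obtain t2 s2 where s2: "exec cL s1 t2 s2" "t2 \<le> y ^ DL"
      "fst s2 1 = length (R w)" "\<forall>r < 1. fst s2 r = fst s1 r" "snd s2 = snd s1" by (rule evaluatesE)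
    let ?s3 = "((fst s2)(2 := val (Num 0) s2), snd s2)"
    define Jnv where "Jnv i z \<longleftrightarrow> loaded w z \<and> fst z 1 = length (R w) \<and> fst z 2 = i \<and>
      (\<forall>j < i. snd z 1 j = cell (R w) j)" for i z
    have "\<exists>t z'. exec ?body z t z' \<and> t \<le> y ^ ?T \<and> Jnv (Suc i) z'"
      if i: "i < Suc (length (R w))" and z: "Jnv i z" for i z
    proof -
      have env: "reg_env [2] z = case_nat i (\<lambda>_. 0)" using z by (simp add: reg_env_Cons nil Jnv_def)
      have "i \<le> y ^ X" using i X[OF y0] by simp
      moreover have "y ^ X \<le> y ^ Suc X" using y2 by simp
      ultimately have "i \<le> y ^ Suc X" by (rule le_trans)
      then have "sized w (reg_env [2] z) (y ^ Suc X)"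
        unfolding env using sized_power[OF y0, of X] by (simp add: sized_def split: nat.split del: power_Suc)
      moreover have "loaded w z" using z by (simp add: Jnv_def)
      ultimately obtain t z1 where z1: "exec cC z t z1" "t \<le> (y ^ Suc X) ^ DC"
        "fst z1 3 = cell (R w) (reg_env [2] z 0)" "\<forall>r < 3. fst z1 r = fst z r" "snd z1 = snd z"
        using evaluatesE[OF cC] by metis
      let ?z3 = "((fst z1)(2 := Suc i), (snd z1)(1 := (snd z1 1)(i := cell (R w) i)))"
      have "exec ?body z (t + (1 + 1)) ?z3"
        using exec.Seq[OF z1(1) exec.Seq[OF exec.Put[of 1 "Reg 2" "Reg 3" z1] exec.Assign[of 2 "Plus (Reg 2) (Num 1)"]]]
          z z1 by (simp add: Jnv_def env)
      moreover have "t + (1 + 1) \<le> y ^ ?T"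
        unfolding one_add_one
        by (rule add_le_power[OF y2 _ const_le_power[OF y2]]) (use z1(2) in \<open>simp only: power_mult\<close>)
      moreover have "Jnv (Suc i) ?z3"
        using z z1 by (auto simp: Jnv_def loaded_def less_Suc_eq)
      ultimately show ?thesis by blast
    qed
    moreover have "val ?e z \<noteq> 0 \<longleftrightarrow> i < Suc (length (R w))" if "Jnv i z" for i z
      using that by (auto simp: Jnv_def)
    moreover have "Jnv 0 ?s3" using s2 l1 by (simp add: Jnv_def loaded_def)
    ultimately have "\<exists>t z. exec (While ?e ?body) ?s3 t z \<and> t \<le> Suc (length (R w)) * (y ^ ?T + 1) + 1 \<and>
        Jnv (Suc (length (R w))) z"
      by (intro loop_exec[where Inv = Jnv and e = ?e and c = ?body]) blast+
    then obtain t4 s4 where s4: "exec (While ?e ?body) ?s3 t4 s4"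
      "t4 \<le> Suc (length (R w)) * (y ^ ?T + 1) + 1" "Jnv (Suc (length (R w))) s4" by blast
    have ex: "exec ?c s (1 + (t1 + (t2 + (1 + t4)))) s4"
      by (rule exec.Seq[OF exec.Assign exec.Seq[OF s1(1) exec.Seq[OF s2(1) exec.Seq[OF exec.Assign s4(1)]]]])
    have b4: "Suc (length (R w)) * (y ^ ?T + 1) + 1 \<le> y ^ ((X + 0 + 1) + (?T + 0 + 1) + 0 + 1)"
      unfolding Suc_eq_plus1 using X[OF y0] y2 by (intro add_le_power mult_le_power) auto
    have b1: "length w * (2 + 1) + 1 \<le> y ^ (1 + (2 + 0 + 1) + 0 + 1)"
      using y2 const_le_power[OF y2, of 2] by (intro add_le_power mult_le_power) (auto simp: y_def)
    have one: "1 \<le> y ^ 0" by simp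
    have "1 + (t1 + (t2 + (1 + t4))) \<le> y ^ ?D"
      by (rule add_le_power[OF y2 one add_le_power[OF y2 le_trans[OF s1(2) b1] add_le_power[OF y2 s2(2)
        add_le_power[OF y2 one le_trans[OF s4(2) b4]]]]])
    moreover have "outputs s4 (R w)" using s4(3) by (simp add: Jnv_def outputs_def)
    ultimately show ?thesis using ex unfolding y_def by blast
  qed
  then show ?thesis by blast
qed

text \<open>Exponents that are powers of two need only iterated squaring, done here by repeated
  addition, and they dominate all other exponents. There is no time bound to respect.\<close>

lemma computable_power:
  assumes "computable f"
  shows "computable (\<lambda>n. (f n + a) ^ (2 ^ e))"
proof (induction e)
  case 0
  obtain c where c: "\<And>n. \<exists>t s. exec c ((\<lambda>_. 0)(0 := n), (\<lambda>_ _. 0)) t s \<and> fst s 0 = f n"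
    using assms unfolding computable_def by blast
  have "\<exists>t s. exec (Seq c (Assign 0 (Plus (Reg 0) (Num a)))) ((\<lambda>_. 0)(0 := n), (\<lambda>_ _. 0)) t s \<and> fst s 0 = f n + a" for n
  proof -
    obtain t s where s: "exec c ((\<lambda>_. 0)(0 := n), (\<lambda>_ _. 0)) t s" "fst s 0 = f n" using c by blast
    show ?thesis using exec.Seq[OF s(1) exec.Assign[of 0 "Plus (Reg 0) (Num a)"]] s(2) by fastforce
  qed
  then show ?case unfolding computable_def by (simp del: fun_upd_apply) blast
next
  case (Suc e)
  define h where "h n = (f n + a) ^ (2 ^ e)" for n
  obtain c where c: "\<And>n. \<exists>t s. exec c ((\<lambda>_. 0)(0 := n), (\<lambda>_ _. 0)) t s \<and> fst s 0 = h n"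
    using Suc.IH unfolding computable_def h_def by blast
  let ?body = "Seq (Assign 1 (Plus (Reg 1) (Reg 0))) (Assign 2 (Plus (Reg 2) (Num 1)))"
  let ?e = "Minus (Reg 0) (Reg 2)"
  let ?c = "Seq c (Seq (Assign 1 (Num 0)) (Seq (Assign 2 (Num 0)) (Seq (While ?e ?body) (Assign 0 (Reg 1)))))"
  have "\<exists>t s. exec ?c ((\<lambda>_. 0)(0 := n), (\<lambda>_ _. 0)) t s \<and> fst s 0 = h n * h n" for n
  proof -
    obtain t s where s: "exec c ((\<lambda>_. 0)(0 := n), (\<lambda>_ _. 0)) t s" "fst s 0 = h n" using c by blast
    define Inv where "Inv i z \<longleftrightarrow> fst z 0 = h n \<and> fst z 1 = i * h n \<and> fst z 2 = i" for i and z :: state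
    let ?s1 = "((fst s)(1 := val (Num 0) s), snd s)"
    let ?s2 = "((fst ?s1)(2 := val (Num 0) ?s1), snd ?s1)"
    have "\<exists>t s'. exec (While ?e ?body) ?s2 t s' \<and> t \<le> h n * (2 + 1) + 1 \<and> Inv (h n) s'"
    proof (rule loop_exec[where Inv = Inv])
      show "Inv 0 ?s2" using s by (simp add: Inv_def)
      show "val ?e z \<noteq> 0 \<longleftrightarrow> i < h n" if "Inv i z" "i \<le> h n" for i z
        using that by (auto simp: Inv_def)
      show "\<exists>t s'. exec ?body z t s' \<and> t \<le> 2 \<and> Inv (Suc i) s'" if "i < h n" "Inv i z" for i z
      proof -
        let ?z1 = "((fst z)(1 := val (Plus (Reg 1) (Reg 0)) z), snd z)"
        let ?z2 = "((fst ?z1)(2 := val (Plus (Reg 2) (Num 1)) ?z1), snd ?z1)"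
        have "exec ?body z (1 + 1) ?z2" by (rule exec.Seq[OF exec.Assign exec.Assign])
        moreover have "Inv (Suc i) ?z2" using that by (simp add: Inv_def)
        ultimately show ?thesis unfolding one_add_one by blast
      qed
    qed
    then obtain t' s' where s': "exec (While ?e ?body) ?s2 t' s'" "Inv (h n) s'" by blast
    show ?thesis
      using exec.Seq[OF s(1) exec.Seq[OF exec.Assign exec.Seq[OF exec.Assign exec.Seq[OF s'(1) exec.Assign[of 0 "Reg 1"]]]]]
        s'(2) by (fastforce simp: Inv_def)
  qed
  moreover have "h n * h n = (f n + a) ^ (2 ^ Suc e)" for n
    by (simp add: h_def power_mult[symmetric] power2_eq_square[symmetric] mult.commute)
  ultimately show ?case unfolding computable_def by metis
qed

lemma le_power_of_two_power: "1 \<le> x \<Longrightarrow> x ^ n \<le> x ^ (2 ^ n)" for x :: nat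
  by (rule power_increasing) (simp_all add: less_imp_le)

text \<open>The intermediate string is no longer than the time bound of the first program. A power
  of that bound, still a function of the parameter times a polynomial, therefore covers the second
  program too.\<close>

lemma fpt_reducible_feas:
  assumes AB: "A \<le>\<^sub>f\<^sub>p\<^sub>t B"
    and R: "feas_string (\<lambda>w \<rho>. R w)"
    and yes: "\<And>w. w \<in> fst B \<longleftrightarrow> R w \<in> fst B'"
    and par: "\<And>w. snd B' (R w) \<le> (snd B w + a) ^ (2 ^ e)"
  shows "A \<le>\<^sub>f\<^sub>p\<^sub>t B'"
proof -
  obtain F c f g d where f: "computable f" and g: "computable g"
    and F: "\<And>x. x \<in> fst A \<longleftrightarrow> F x \<in> fst B" "\<And>x. snd B (F x) \<le> g (snd A x)"
    and c: "computes_in_time c F (\<lambda>x. f (snd A x) * (length x + 1) ^ d)"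
    using AB unfolding fpt_reducible_def by blast
  obtain c' D where c': "\<And>w s. (\<forall>i \<le> length w. snd s 1 i = cell w i) \<Longrightarrow>
    \<exists>t s'. exec c' s t s' \<and> t \<le> (length w + 2) ^ D \<and> outputs s' (R w)"
    using feas_string_program[OF R] by blast
  let ?D = "Suc (Suc D)"
  let ?f = "\<lambda>n. (f n + 2) ^ (2 ^ ?D)"
  have "computes_in_time (Seq c c') (\<lambda>x. R (F x)) (\<lambda>x. ?f (snd A x) * (length x + 1) ^ (d * ?D))"
    unfolding computes_in_time_def
  proof
    fix x
    let ?T = "f (snd A x) * (length x + 1) ^ d"
    obtain t s where s: "exec c (input_state x) t s" "t \<le> ?T" "outputs s (F x)"
      using c unfolding computes_in_time_def by blast
    obtain t' s' where s': "exec c' s t' s'" "t' \<le> (length (F x) + 2) ^ D" "outputs s' (R (F x))"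
      using c'[of "F x" s] s(3) by (auto simp: outputs_def)
    have len: "length (F x) \<le> ?T" using output_length_le[OF s(1,3)] s(2) by simp
    have t: "t \<le> (?T + 2) ^ 1" using s(2) by simp
    have t': "t' \<le> (?T + 2) ^ D" using s'(2) power_mono[of "length (F x) + 2" "?T + 2" D] len by simp
    have "1 \<le> (length x + 1) ^ d" by simp
    \<comment> \<open>The factor that depends on the length is at least 1, so the summand 2 can be
      moved into the factor that depends on the parameter.\<close>
    then have T: "?T + 2 \<le> (f (snd A x) + 2) * (length x + 1) ^ d"
      unfolding add_mult_distrib by linarith
    have "t + t' \<le> (?T + 2) ^ (1 + D + 1)" by (rule add_le_power[OF _ t t']) simp
    also have "\<dots> \<le> ((f (snd A x) + 2) * (length x + 1) ^ d) ^ ?D"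
      using power_mono[OF T, of ?D] by simp
    also have "\<dots> \<le> ?f (snd A x) * (length x + 1) ^ (d * ?D)"
      unfolding power_mult_distrib power_mult[symmetric]
      by (intro mult_le_mono le_power_of_two_power) auto
    finally show "\<exists>t s. exec (Seq c c') (input_state x) t s \<and> t \<le> ?f (snd A x) * (length x + 1) ^ (d * ?D) \<and>
        outputs s (R (F x))"
      using exec.Seq[OF s(1) s'(1)] s'(3) by blast
  qed
  moreover have "snd B' (R (F x)) \<le> (g (snd A x) + a) ^ (2 ^ e)" for x
    using par[of "F x"] F(2)[of x] by (meson add_le_mono1 le_trans power_mono zero_le)
  ultimately show ?thesis
    unfolding fpt_reducible_def
    using computable_power[OF f, of 2 ?D] computable_power[OF g, of a e] F(1) yes
    by (intro exI[of _ "\<lambda>x. R (F x)"] exI[of _ "Seq c c'"] exI[of _ ?f]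
        exI[of _ "\<lambda>n. (g n + a) ^ (2 ^ e)"] exI[of _ "d * ?D"]) simp
qed

section \<open>The prefix-free number code as a feasible string\<close>

definition digit_step :: "nat \<Rightarrow> nat \<Rightarrow> nat" where
  "digit_step n j = rec_nat n (\<lambda>_ m. (m - 1) div 2) j"

lemma digit_step_Suc_Suc: "digit_step (Suc n) (Suc j) = digit_step (n div 2) j"
  by (induction j) (simp_all add: digit_step_def)

lemma digit_step_le: "digit_step n j \<le> n - j"
  by (induction j) (auto simp: digit_step_def)

lemma feas_digit_step:
  assumes "feas A" "feas B"
  shows "feas (\<lambda>w \<rho>. digit_step (A w \<rho>) (B w \<rho>))"
proof (rule feas_comp2[of "\<lambda>w. digit_step", OF _ assms])
  have "rec_nat (\<rho> 0) (\<lambda>_ m. (m - 1) div 2) i \<le> \<rho> 0" for \<rho> :: "nat \<Rightarrow> nat" and i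
    using digit_step_le[of "\<rho> 0" i] by (simp add: digit_step_def)
  then show "feas (\<lambda>w \<rho>. digit_step (\<rho> 0) (\<rho> 1))"
    unfolding digit_step_def
    by (intro feas_rec[where S = "\<lambda>w acc i \<rho>. (acc - 1) div 2" and B = "\<lambda>w \<rho>. \<rho> 0" and G = "\<lambda>w \<rho>. \<rho> 1"
        and A = "\<lambda>w \<rho>. \<rho> 0"] feas_var feas_half feas_diff feas_const poly_bounded_var)
qed

definition num_digits :: "nat \<Rightarrow> nat" where
  "num_digits n = (\<Sum>j<n. of_bool (digit_step n j \<noteq> 0))"

lemma num_digits_Suc: "num_digits (Suc n) = Suc (num_digits (n div 2))"
proof -
  have "(\<Sum>j<n. of_bool (digit_step (n div 2) j \<noteq> 0)) = (num_digits (n div 2) :: nat)"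
    unfolding num_digits_def
  proof (rule sum.mono_neutral_right)
    show "\<forall>j\<in>{..<n} - {..<n div 2}. of_bool (digit_step (n div 2) j \<noteq> 0) = (0::nat)"
      using digit_step_le[of "n div 2"] by (metis DiffD2 diff_is_0_eq lessThan_iff le_zero_eq not_less of_bool_eq(1))
  qed auto
  then show ?thesis
    unfolding num_digits_def[of "Suc n"]
    by (subst sum.lessThan_Suc_shift) (simp add: digit_step_Suc_Suc, simp add: digit_step_def)
qed

lemma length_code_nat: "length (code_nat n) = 2 * num_digits n + 1"
  by (induction n rule: code_nat.induct) (simp add: num_digits_def, simp add: num_digits_Suc)

lemma length_code_nat_le: "length (code_nat n) \<le> 2 * n + 1"
proof -
  have "num_digits n \<le> (\<Sum>j<n. 1)" unfolding num_digits_def by (rule sum_mono) simp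
  then show ?thesis by (simp add: length_code_nat)
qed

lemma cell_Cons: "cell (b # xs) i = (case i of 0 \<Rightarrow> (if b then 2 else 1) | Suc j \<Rightarrow> cell xs j)"
  by (auto simp: cell_def split: nat.split)

text \<open>\<open>digit_step n j\<close> is what is left of \<open>n\<close> after removing
  \<open>j\<close> bijective digits. Even positions carry the continuation bits; an odd position
  carries a digit, and the bit \<open>odd n\<close> stored for \<open>Suc n\<close> says that
  \<open>Suc n\<close> is even.\<close>

lemma cell_code_nat:
  "cell (code_nat n) i =
    (if i < 2 * num_digits n then if even i \<or> even (digit_step n (i div 2)) then 2 else 1
     else if i = 2 * num_digits n then 1 else 0)"
proof (induction n arbitrary: i rule: code_nat.induct)
  case 1
  then show ?case by (simp add: num_digits_def cell_def)
next
  case (2 n)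
  consider "i = 0" | "i = 1" | j where "i = Suc (Suc j)" by (metis One_nat_def nat.exhaust)
  then show ?case
  proof cases
    case 1
    then show ?thesis by (simp add: cell_Cons num_digits_Suc)
  next
    case 2
    then show ?thesis by (simp add: cell_Cons num_digits_Suc digit_step_def)
  next
    case 3
    have "Suc (j div 2) = i div 2" using 3 by simp
    then have "digit_step (Suc n) (i div 2) = digit_step (n div 2) (j div 2)"
      using digit_step_Suc_Suc[of n "j div 2"] by simp
    then show ?thesis using 3 2 by (auto simp: cell_Cons num_digits_Suc)
  qed
qed

lemma feas_num_digits: "feas A \<Longrightarrow> feas (\<lambda>w \<rho>. num_digits (A w \<rho>))"
  by (rule feas_comp1[of "\<lambda>w. num_digits"])
    (unfold num_digits_def, intro feas_sum feas_var feas_of_bool feasb_not feasb_eq feas_digit_step feas_const)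

lemma feas_string_code_nat:
  assumes "feas A"
  shows "feas_string (\<lambda>w \<rho>. code_nat (A w \<rho>))"
proof -
  have even: "feasb (\<lambda>w \<rho>. even (F w \<rho>))" if "feas F" for F
    using feasb_not[OF feasb_odd[OF that]] by simp
  have "feas_string (\<lambda>w \<rho>. code_nat (\<rho> 0))"
    unfolding feas_string_def length_code_nat cell_code_nat
    by (intro conjI feas_if feasb_eq feasb_less feasb_disj even feas_add feas_mult feas_const feas_num_digits
        feas_var feas_half feas_digit_step)
  then show ?thesis
    using feas_string_bind[of "\<lambda>w \<rho> n. code_nat n", OF _ assms] by simp
qed

section \<open>Decoding\<close>

text \<open>Numbers are decoded by search, which finds at most one code as the code is prefix-free.  Larger numbers
  and strings that are no codes give junk; this is detected later by encoding the result again.\<close>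

definition number_at :: "bool list \<Rightarrow> nat \<Rightarrow> nat" where
  "number_at w p = (\<Sum>n<length w + 4.
     if \<forall>i<length (code_nat n). cell (code_nat n) i = cell w (p + i) then n else 0)"

definition token_pos :: "bool list \<Rightarrow> nat \<Rightarrow> nat" where
  "token_pos w i = rec_nat 0 (\<lambda>_ p. p + length (code_nat (number_at w p))) i"

definition token :: "bool list \<Rightarrow> nat \<Rightarrow> nat" where
  "token w i = number_at w (token_pos w i)"

text \<open>Tokens 0 and 1 are the weight and the number of gates, so gates start at token 2. An
  input takes one token, a negation two, and any other gate its tag, its fan-in and its
  children.\<close>

definition gate_pos :: "bool list \<Rightarrow> nat \<Rightarrow> nat" where
  "gate_pos w i = rec_nat 2
     (\<lambda>_ p. p + (if token w p = 0 then 1 else if token w p = 1 then 2 else 2 + token w (p + 1))) i"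

definition tag :: "bool list \<Rightarrow> nat \<Rightarrow> nat" where
  "tag w i = token w (gate_pos w i)"

definition fanin :: "bool list \<Rightarrow> nat \<Rightarrow> nat" where
  "fanin w i = (if tag w i = 0 then 0 else if tag w i = 1 then 1 else token w (gate_pos w i + 1))"

definition child :: "bool list \<Rightarrow> nat \<Rightarrow> nat \<Rightarrow> nat" where
  "child w i j = (if tag w i = 1 then token w (gate_pos w i + 1) else token w (gate_pos w i + 2 + j))"

definition make_gate :: "nat \<Rightarrow> nat \<Rightarrow> (nat \<Rightarrow> nat) \<Rightarrow> gate" where
  "make_gate t l c = (if t = 0 then Input else if t = 1 then Neg (c 0)
     else if t = 2 then Conj (map c [0..<l]) else Disj (map c [0..<l]))"

definition gates :: "bool list \<Rightarrow> gate list" where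
  "gates w = map (\<lambda>i. make_gate (tag w i) (fanin w i) (child w i)) [0..<token w 1]"

lemma feas_number_at:
  assumes "feas A"
  shows "feas (\<lambda>w \<rho>. number_at w (A w \<rho>))"
proof (rule feas_comp1[of number_at, OF _ assms])
  show "feas (\<lambda>w \<rho>. number_at w (\<rho> 0))"
    unfolding number_at_def
    by (intro feas_sum feas_add feas_length feas_const feas_if feasb_all_less feasb_eq feas_var
        feas_string_length feas_string_code_nat feas_string_cell feas_cell)
qed

lemma number_at_le: "number_at w p \<le> (length w + 4) * (length w + 4)"
proof -
  have "number_at w p \<le> (\<Sum>n<length w + 4. length w + 4)"
    unfolding number_at_def by (rule sum_mono) auto
  then show ?thesis by simp
qed

lemma token_pos_le: "token_pos w i \<le> i * (2 * ((length w + 4) * (length w + 4)) + 1)"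
proof (induction i)
  case (Suc i)
  have "token_pos w (Suc i) = token_pos w i + length (code_nat (number_at w (token_pos w i)))"
    by (simp add: token_pos_def)
  with Suc show ?case
    using number_at_le[of w "token_pos w i"] length_code_nat_le[of "number_at w (token_pos w i)"] by simp
qed (simp add: token_pos_def)

lemma feas_token_pos:
  assumes "feas A"
  shows "feas (\<lambda>w \<rho>. token_pos w (A w \<rho>))"
proof (rule feas_comp1[of token_pos, OF _ assms])
  show "feas (\<lambda>w \<rho>. token_pos w (\<rho> 0))"
    unfolding token_pos_def
  proof (rule feas_rec[where S = "\<lambda>w p i \<rho>. p + length (code_nat (number_at w p))"
        and B = "\<lambda>w \<rho>. \<rho> 0 * (2 * ((length w + 4) * (length w + 4)) + 1)" and G = "\<lambda>w \<rho>. \<rho> 0"])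
    show "rec_nat 0 (\<lambda>i p. p + length (code_nat (number_at w p))) i
        \<le> \<rho> 0 * (2 * ((length w + 4) * (length w + 4)) + 1)" if "i \<le> \<rho> 0" for w and \<rho> :: "nat \<Rightarrow> nat" and i
      using token_pos_le[of w i, unfolded token_pos_def] mult_le_mono1[OF that] by (rule le_trans)
  qed (intro feas_var feas_const feas_add feas_string_length feas_string_code_nat feas_number_at
      poly_bounded_mult poly_bounded_add poly_bounded_var poly_bounded_const poly_bounded_length)+
qed

lemma feas_token: "feas A \<Longrightarrow> feas (\<lambda>w \<rho>. token w (A w \<rho>))"
  unfolding token_def by (intro feas_number_at feas_token_pos)

lemma token_le: "token w i \<le> (length w + 4) * (length w + 4)"
  unfolding token_def by (rule number_at_le)

lemma gate_pos_le: "gate_pos w i \<le> 2 + i * (2 + (length w + 4) * (length w + 4))"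
proof (induction i)
  case (Suc i)
  then show ?case
    using token_le[of w "gate_pos w i + 1"] by (auto simp: gate_pos_def)
qed (simp add: gate_pos_def)

lemma feas_gate_pos:
  assumes "feas A"
  shows "feas (\<lambda>w \<rho>. gate_pos w (A w \<rho>))"
proof (rule feas_comp1[of gate_pos, OF _ assms])
  let ?s = "\<lambda>w p. p + (if token w p = 0 then 1 else if token w p = 1 then 2 else 2 + token w (p + 1))"
  show "feas (\<lambda>w \<rho>. gate_pos w (\<rho> 0))"
    unfolding gate_pos_def
  proof (rule feas_rec[where S = "\<lambda>w p i \<rho>. ?s w p"
        and B = "\<lambda>w \<rho>. 2 + \<rho> 0 * (2 + (length w + 4) * (length w + 4))" and G = "\<lambda>w \<rho>. \<rho> 0"])
    show "rec_nat 2 (\<lambda>i p. ?s w p) i \<le> 2 + \<rho> 0 * (2 + (length w + 4) * (length w + 4))"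
      if "i \<le> \<rho> 0" for w and \<rho> :: "nat \<Rightarrow> nat" and i
      using gate_pos_le[of w i, unfolded gate_pos_def] add_left_mono[OF mult_le_mono1[OF that]]
      by (rule le_trans)
  qed (intro feas_var feas_const feas_add feas_if feasb_eq feas_token
      poly_bounded_mult poly_bounded_add poly_bounded_var poly_bounded_const poly_bounded_length)+
qed

lemma feas_tag: "feas A \<Longrightarrow> feas (\<lambda>w \<rho>. tag w (A w \<rho>))"
  unfolding tag_def by (intro feas_token feas_gate_pos)

lemma feas_fanin: "feas A \<Longrightarrow> feas (\<lambda>w \<rho>. fanin w (A w \<rho>))"
  unfolding fanin_def by (intro feas_if feasb_eq feas_tag feas_const feas_token feas_add feas_gate_pos)

lemma feas_child: "feas A \<Longrightarrow> feas B \<Longrightarrow> feas (\<lambda>w \<rho>. child w (A w \<rho>) (B w \<rho>))"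
  unfolding child_def by (intro feas_if feasb_eq feas_tag feas_const feas_token feas_add feas_gate_pos)

lemma cell_drop: "cell w (p + i) = cell (drop p w) i"
  by (auto simp: cell_def)

text \<open>A code that is a prefix of a string starting with another code coincides with it. Hence
  at most one summand of \<open>number_at\<close> is nonzero.\<close>

lemma code_nat_prefix_iff:
  "(\<forall>i<length (code_nat m). cell (code_nat m) i = cell (code_nat n @ r) i) \<longleftrightarrow> m = n"
proof
  let ?v = "code_nat n @ r"
  assume *: "\<forall>i<length (code_nat m). cell (code_nat m) i = cell ?v i"
  have nth: "i < length ?v \<and> ?v ! i = code_nat m ! i" if "i < length (code_nat m)" for i
    using spec[OF *, of i] that unfolding cell_def by (cases "i < length ?v") (auto split: if_splits)
  have len: "length (code_nat m) \<le> length ?v"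
    using nth[of "length (code_nat m) - 1"] by (simp add: length_code_nat del: length_append)
  have "take (length (code_nat m)) ?v = code_nat m"
  proof (rule nth_equalityI)
    show "length (take (length (code_nat m)) ?v) = length (code_nat m)" using len by simp
    fix i assume "i < length (take (length (code_nat m)) ?v)"
    then have i: "i < length (code_nat m)" by simp
    show "take (length (code_nat m)) ?v ! i = code_nat m ! i"
      using nth[OF i] i by (simp only: nth_take)
  qed
  from append_take_drop_id[of "length (code_nat m)" ?v, unfolded this]
  show "m = n" by (simp only: code_nat_prefix_free)
next
  assume "m = n"
  then show "\<forall>i<length (code_nat m). cell (code_nat m) i = cell (code_nat n @ r) i"
    by (simp add: cell_def nth_append)
qed

lemma number_at_eq:
  assumes w: "drop p w = code_nat n @ r" and n: "n < length w + 4"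
  shows "number_at w p = n"
proof -
  have "number_at w p = (\<Sum>m<length w + 4. if m = n then m else 0)"
    unfolding number_at_def cell_drop w code_nat_prefix_iff ..
  then show ?thesis using n by simp
qed

lemma token_eq:
  assumes w: "w = concat (map code_nat ns)" and small: "\<forall>n \<in> set ns. n < length w + 4"
    and i: "i < length ns"
  shows "token w i = ns ! i"
proof -
  have drop: "drop (length (concat (map code_nat (take i ns)))) w = code_nat (ns ! i) @ concat (map code_nat (drop (Suc i) ns))"
    if "i < length ns" for i
  proof -
    have "ns = take i ns @ ns ! i # drop (Suc i) ns" using that by (rule id_take_nth_drop)
    from arg_cong[OF this, of "\<lambda>ns. concat (map code_nat ns)"]
    have *: "w = concat (map code_nat (take i ns)) @ code_nat (ns ! i) @ concat (map code_nat (drop (Suc i) ns))"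
      unfolding w by simp
    show ?thesis by (subst *) simp
  qed
  have pos: "token_pos w i = length (concat (map code_nat (take i ns)))" if "i \<le> length ns" for i
    using that
  proof (induction i)
    case (Suc i)
    then have "number_at w (token_pos w i) = ns ! i"
      using number_at_eq[OF drop[of i]] small by simp
    with Suc show ?case by (simp add: token_pos_def take_Suc_conv_app_nth)
  qed (simp add: token_pos_def)
  show ?thesis
    unfolding token_def using number_at_eq[OF drop[OF i]] small i pos[of i] by simp
qed

fun gate_tokens :: "gate \<Rightarrow> nat list" where
  "gate_tokens Input = [0]"
| "gate_tokens (Neg j) = [1, j]"
| "gate_tokens (Conj js) = 2 # length js # js"
| "gate_tokens (Disj js) = 3 # length js # js"

lemma code_wcs_tokens:
  "code_wcs (C, k) = concat (map code_nat (k # length C # concat (map gate_tokens C)))"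
proof -
  have "code_gate g = concat (map code_nat (gate_tokens g))" for g
    by (cases g) (simp_all add: code_list_def)
  then have "concat (map code_gate C) = concat (map code_nat (concat (map gate_tokens C)))"
    by (induction C) simp_all
  then show ?thesis by (simp add: code_wcs_def code_list_def)
qed

lemma length_le_length_concat_code_nat: "length ns \<le> length (concat (map code_nat ns))"
  by (induction ns) (auto simp: length_code_nat)

lemma length_le_length_code_wcs: "length C \<le> length (code_wcs (C, k))"
proof -
  have "1 \<le> length (gate_tokens g)" for g by (cases g) auto
  then have "length C \<le> length (concat (map gate_tokens C))"
    by (induction C) (auto intro: order_trans add_mono)
  then show ?thesis
    using length_le_length_concat_code_nat[of "k # length C # concat (map gate_tokens C)"]
    unfolding code_wcs_tokens by simp
qed

text \<open>The search in \<open>number_at\<close> reaches only numbers below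
  \<open>length w + 4\<close>. Everything in the code of a circuit is that small, the 4 leaving room
  for the gate tags, except possibly the weight. Hence the hypothesis on \<open>k\<close>, which
  every yes-instance meets.\<close>

lemma decode_code_wcs:
  assumes C: "circuit C" and w: "w = code_wcs (C, k)" and k: "k \<le> length C"
  shows "gates w = C" and "token w 0 = k"
proof -
  define ns where "ns = k # length C # concat (map gate_tokens C)"
  have w': "w = concat (map code_nat ns)" unfolding w ns_def by (rule code_wcs_tokens)
  have m: "length C \<le> length w" unfolding w by (rule length_le_length_code_wcs)
  have len: "length ns \<le> length w" unfolding w' by (rule length_le_length_concat_code_nat)
  have "n < length w + 4" if g: "g \<in> set C" and "n \<in> set (gate_tokens g)" for g n
  proof -
    obtain i where i: "i < length C" "C ! i = g" using g by (auto simp: in_set_conv_nth)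
    then have p: "\<forall>j \<in> set (preds g). j < i" using C by (auto simp: circuit_def)
    have "length (gate_tokens g) \<le> length ns"
      using g unfolding ns_def
      by (induction C) auto
    then have "length (gate_tokens g) < length w + 4" using len by simp
    then show ?thesis using that(2) p i m by (cases g) (auto dest!: bspec)
  qed
  then have small: "\<forall>n \<in> set ns. n < length w + 4" using m k by (auto simp: ns_def)
  have tok: "token w i = ns ! i" if "i < length ns" for i
    using token_eq[OF w' small that] .
  have dropns: "drop (2 + length (concat (map gate_tokens (take i C)))) ns =
      gate_tokens (C ! i) @ concat (map gate_tokens (drop (Suc i) C))" if "i < length C" for i
  proof -
    have "C = take i C @ C ! i # drop (Suc i) C" using that by (rule id_take_nth_drop)
    from arg_cong[OF this, of "\<lambda>C. concat (map gate_tokens C)"]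
    have "concat (map gate_tokens C) = concat (map gate_tokens (take i C)) @
        gate_tokens (C ! i) @ concat (map gate_tokens (drop (Suc i) C))"
      by simp
    then show ?thesis unfolding ns_def by simp
  qed
  have tokg: "token w (2 + length (concat (map gate_tokens (take i C))) + j) = gate_tokens (C ! i) ! j"
    if "i < length C" "j < length (gate_tokens (C ! i))" for i j
  proof -
    let ?p = "2 + length (concat (map gate_tokens (take i C)))"
    have "length (drop ?p ns) \<ge> length (gate_tokens (C ! i))" unfolding dropns[OF that(1)] by simp
    then have lt: "?p + j < length ns" using that(2) by simp
    then have "ns ! (?p + j) = drop ?p ns ! j" by simp
    also have "\<dots> = gate_tokens (C ! i) ! j" unfolding dropns[OF that(1)] using that(2) by (simp add: nth_append)
    finally show ?thesis using tok[OF lt] by simp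
  qed
  have pos: "gate_pos w i = 2 + length (concat (map gate_tokens (take i C)))" if "i \<le> length C" for i
    using that
  proof (induction i)
    case (Suc i)
    have "gate_pos w (Suc i) = gate_pos w i + length (gate_tokens (C ! i))"
      using Suc tokg[of i 0] tokg[of i 1]
      by (cases "C ! i") (simp_all add: gate_pos_def)
    then show ?case using Suc by (simp add: take_Suc_conv_app_nth)
  qed (simp add: gate_pos_def)
  show "token w 0 = k" using tok[of 0] by (simp add: ns_def)
  have tg: "tag w i = gate_tokens (C ! i) ! 0" if "i < length C" for i
    unfolding tag_def using tokg[of i 0] pos[of i] that by (cases "C ! i") auto
  have fan: "fanin w i = length js" if "i < length C" "C ! i = Conj js \<or> C ! i = Disj js" for i js
    unfolding fanin_def using tg[of i] tokg[of i 1] pos[of i] that by auto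
  have chi: "child w i j = js ! j" if "i < length C" "C ! i = Conj js \<or> C ! i = Disj js" "j < length js" for i js j
    unfolding child_def using tg[of i] tokg[of i "Suc (Suc j)"] pos[of i] that by auto
  have "make_gate (tag w i) (fanin w i) (child w i) = C ! i" if i: "i < length C" for i
  proof (cases "C ! i")
    case Input
    then show ?thesis using tg[OF i] by (simp add: make_gate_def)
  next
    case (Neg j)
    then show ?thesis using tg[OF i] tokg[OF i, of 1] pos[of i] i by (simp add: make_gate_def child_def)
  next
    case (Conj js)
    then have "map (child w i) [0..<length js] = js" using chi[OF i] by (intro nth_equalityI) auto
    then show ?thesis using tg[OF i] fan[OF i] Conj by (simp add: make_gate_def)
  next
    case (Disj js)
    then have "map (child w i) [0..<length js] = js" using chi[OF i] by (intro nth_equalityI) auto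
    then show ?thesis using tg[OF i] fan[OF i] Disj by (simp add: make_gate_def)
  qed
  moreover have "token w 1 = length C" using tok[of 1] by (simp add: ns_def)
  ultimately show "gates w = C" unfolding gates_def by (intro nth_equalityI) auto
qed

section \<open>Circuits\<close>

lemma length_circuit_values [simp]: "length (circuit_values a C) = length C"
  unfolding circuit_values_def by (induction C rule: rev_induct) simp_all

lemma circuit_values_snoc:
  "circuit_values a (C @ [g]) = circuit_values a C @ [gate_value (a (length C)) (circuit_values a C) g]"
  using length_circuit_values[of a C] by (simp add: circuit_values_def)

lemma circuit_values_take: "i \<le> length C \<Longrightarrow> circuit_values a (take i C) = take i (circuit_values a C)"
proof (induction C rule: rev_induct)
  case (snoc g C)
  then show ?case by (cases "i \<le> length C") (simp_all add: circuit_values_snoc not_le)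
qed (simp add: circuit_values_def)

lemma circuit_values_nth:
  assumes i: "i < length C" and p: "\<forall>j \<in> set (preds (C ! i)). j < i"
  shows "circuit_values a C ! i = gate_value (a i) (circuit_values a C) (C ! i)"
proof -
  have "take (Suc i) C = take i C @ [C ! i]" using i by (rule take_Suc_conv_app_nth)
  then have "take (Suc i) (circuit_values a C) = circuit_values a (take i C) @ [gate_value (a i) (circuit_values a (take i C)) (C ! i)]"
    using circuit_values_take[of "Suc i" C a] circuit_values_snoc[of a "take i C" "C ! i"] i by simp
  moreover have "take (Suc i) (circuit_values a C) = take i (circuit_values a C) @ [circuit_values a C ! i]"
    using i by (simp add: take_Suc_conv_app_nth)
  ultimately have "circuit_values a C ! i = gate_value (a i) (take i (circuit_values a C)) (C ! i)"
    using circuit_values_take[of i C a] i by simp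
  also have "\<dots> = gate_value (a i) (circuit_values a C) (C ! i)"
    using p by (cases "C ! i") auto
  finally show ?thesis .
qed

text \<open>A circuit is given by the tag (0 input, 1 negation, 2 conjunction, otherwise disjunction), the fan-in and the
  children of each gate.\<close>

locale view =
  fixes tg :: "nat \<Rightarrow> nat" and ln :: "nat \<Rightarrow> nat" and ch :: "nat \<Rightarrow> nat \<Rightarrow> nat"
    and m k B d :: nat
begin

text \<open>Descending walks of exactly \<open>h\<close> edges that may stop at any gate. Such tests
  can be decided by unfolding, in contrast to the quantification over all input-output paths in the
  definitions of depth and weft.\<close>

primrec chain :: "nat \<Rightarrow> nat \<Rightarrow> bool" where
  "chain 0 i = True"
| "chain (Suc h) i = (\<exists>j < ln i. chain h (ch i j))"

primrec large_within :: "nat \<Rightarrow> nat \<Rightarrow> bool" where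
  "large_within 0 i = (2 < ln i)"
| "large_within (Suc h) i = (2 < ln i \<or> (\<exists>j < ln i. large_within h (ch i j)))"

primrec two_large_within :: "nat \<Rightarrow> nat \<Rightarrow> bool" where
  "two_large_within 0 i = False"
| "two_large_within (Suc h) i = (2 < ln i \<and> (\<exists>j < ln i. large_within h (ch i j)) \<or>
     (\<exists>j < ln i. two_large_within h (ch i j)))"

text \<open>The coordinates \<open>0, \<dots>, k + 1\<close> stand for the list of true inputs with its sentinels, and \<open>k + 2 + a\<close> for
  the guess at the large gate with address \<open>a\<close>: 0 is the default and \<open>Suc j\<close> stands for the witness \<open>j\<close>.  A
  relation \<open>K\<close> says which coordinates are known and what their values are.\<close>

definition num_coords :: nat where
  "num_coords = k + 2 + 2 ^ (d + 2)"

definition input_val :: "(nat \<Rightarrow> nat \<Rightarrow> bool) \<Rightarrow> nat \<Rightarrow> nat" where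
  "input_val K i = (if \<exists>p < k. K (Suc p) (Suc i) then 2
     else if \<exists>p < Suc k. \<exists>a < Suc i. K p a \<and> (\<exists>b < B. Suc i < b \<and> K (Suc p) b) then 0 else 1)"

text \<open>Three-valued evaluation (0 false, 1 unknown, 2 true) down to level \<open>h\<close>.  The last argument is the address: the
  children of \<open>a\<close> are \<open>2 * a\<close> and \<open>2 * a + 1\<close>, starting with 1 at the output.  Below a large gate there are no further
  ones, and the addresses have no meaning.\<close>

primrec ev :: "(nat \<Rightarrow> nat \<Rightarrow> bool) \<Rightarrow> nat \<Rightarrow> nat \<Rightarrow> nat \<Rightarrow> nat" where
  "ev K 0 i a = 1"
| "ev K (Suc h) i a =
    (if tg i = 0 then input_val K i
     else if tg i = 1 then 2 - ev K h (ch i 0) (2 * a)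
     else if ln i = 2 then
       (if tg i = 2 then
          (if ev K h (ch i 0) (2 * a) \<le> ev K h (ch i 1) (2 * a + 1) then ev K h (ch i 0) (2 * a)
           else ev K h (ch i 1) (2 * a + 1))
        else (if ev K h (ch i 0) (2 * a) \<le> ev K h (ch i 1) (2 * a + 1) then ev K h (ch i 1) (2 * a + 1)
           else ev K h (ch i 0) (2 * a)))
     else if K (k + 2 + a) 0 then (if tg i = 2 then 2 else 0)
     else if \<exists>j < B. K (k + 2 + a) (Suc j) then (if tg i = 2 then 0 else 2)
     else 1)"

text \<open>Only definite contradictions count: a default is wrong if some child is known to refute
  it, a witness if it is out of range or its child is known not to decide the gate. An unknown child
  is never held against a guess. The 0 passed to \<open>ev\<close> is a dummy address.\<close>

primrec wrong_witness :: "(nat \<Rightarrow> nat \<Rightarrow> bool) \<Rightarrow> nat \<Rightarrow> nat \<Rightarrow> nat \<Rightarrow> bool" where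
  "wrong_witness K 0 i a = False"
| "wrong_witness K (Suc h) i a =
    (if tg i = 0 then False
     else if tg i = 1 then wrong_witness K h (ch i 0) (2 * a)
     else if ln i = 2 then wrong_witness K h (ch i 0) (2 * a) \<or> wrong_witness K h (ch i 1) (2 * a + 1)
     else (K (k + 2 + a) 0 \<and> (\<exists>j < ln i. ev K h (ch i j) 0 = (if tg i = 2 then 0 else 2))) \<or>
       (\<exists>j < B. K (k + 2 + a) (Suc j) \<and> (ln i \<le> j \<or> ev K h (ch i j) 0 = (if tg i = 2 then 2 else 0))))"

definition wrong_selection :: "(nat \<Rightarrow> nat \<Rightarrow> bool) \<Rightarrow> bool" where
  "wrong_selection K \<longleftrightarrow>
     (\<exists>a < B. K 0 a \<and> a \<noteq> 0) \<or> (\<exists>a < B. K (Suc k) a \<and> a \<noteq> Suc m) \<or>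
     (\<exists>p < k. \<exists>a < B. K (Suc p) a \<and> (a = 0 \<or> m < a \<or> tg (a - 1) \<noteq> 0)) \<or>
     (\<exists>p < Suc k. \<exists>a < B. \<exists>b < B. K p a \<and> K (Suc p) b \<and> b \<le> a)"

text \<open>The first disjunct forces different views of one coordinate to agree; it is what glues
  separate tuples to a single assignment.\<close>

definition violated :: "(nat \<Rightarrow> nat \<Rightarrow> bool) \<Rightarrow> bool" where
  "violated K \<longleftrightarrow>
     (\<exists>r < num_coords. \<exists>a < B. \<exists>b < B. K r a \<and> K r b \<and> a \<noteq> b) \<or>
     wrong_selection K \<or> ev K (Suc d) (m - 1) 1 = 0 \<or> wrong_witness K (Suc d) (m - 1) 1"

definition full :: "(nat \<Rightarrow> nat) \<Rightarrow> nat \<Rightarrow> nat \<Rightarrow> bool" where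
  "full \<sigma> r v \<longleftrightarrow> r < num_coords \<and> v = \<sigma> r"

definition assigns :: "(nat \<Rightarrow> nat) \<Rightarrow> bool" where
  "assigns \<sigma> \<longleftrightarrow> (\<forall>r < num_coords. \<sigma> r < B)"

section \<open>Monotonicity of partial evaluation in what is known\<close>

lemma wrong_selection_mono: "(\<And>r v. K r v \<Longrightarrow> K' r v) \<Longrightarrow> wrong_selection K \<Longrightarrow> wrong_selection K'"
  unfolding wrong_selection_def by (elim disjE; blast)

lemma large_within_mono: "large_within h i \<Longrightarrow> h \<le> h' \<Longrightarrow> large_within h' i"
proof (induction h arbitrary: i h')
  case 0
  then show ?case by (cases h') auto
next
  case (Suc h)
  then show ?case by (cases h') auto
qed

lemma two_large_within_mono: "two_large_within h i \<Longrightarrow> h \<le> h' \<Longrightarrow> two_large_within h' i"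
proof (induction h arbitrary: i h')
  case (Suc h)
  then show ?case by (cases h') (auto intro: large_within_mono)
qed simp

lemma full_less: "p \<le> Suc k \<Longrightarrow> full \<sigma> p v \<longleftrightarrow> v = \<sigma> p"
  by (simp add: full_def num_coords_def)

lemma not_wrong_selectionD:
  assumes "assigns \<sigma>" "\<not> wrong_selection (full \<sigma>)"
  shows "\<sigma> 0 = 0" and "\<sigma> (Suc k) = Suc m"
    and "p < k \<Longrightarrow> 0 < \<sigma> (Suc p) \<and> \<sigma> (Suc p) \<le> m \<and> tg (\<sigma> (Suc p) - 1) = 0"
    and "p < Suc k \<Longrightarrow> \<sigma> p < \<sigma> (Suc p)"
proof -
  have s: "\<sigma> p < B" if "p \<le> Suc k" for p
    using assms(1) that by (simp add: assigns_def num_coords_def)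
  note nw = assms(2)[unfolded wrong_selection_def de_Morgan_disj]
  show "\<sigma> 0 = 0" using conjunct1[OF nw] s[of 0] full_less[of 0] by auto
  show "\<sigma> (Suc k) = Suc m" using conjunct1[OF conjunct2[OF nw]] s[of "Suc k"] full_less[of "Suc k"] by auto
  show "0 < \<sigma> (Suc p) \<and> \<sigma> (Suc p) \<le> m \<and> tg (\<sigma> (Suc p) - 1) = 0" if "p < k"
  proof (rule ccontr)
    assume "\<not> (0 < \<sigma> (Suc p) \<and> \<sigma> (Suc p) \<le> m \<and> tg (\<sigma> (Suc p) - 1) = 0)"
    then have "\<exists>p < k. \<exists>a < B. full \<sigma> (Suc p) a \<and> (a = 0 \<or> m < a \<or> tg (a - 1) \<noteq> 0)"
      using that s[of "Suc p"] full_less[of "Suc p"]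
      by (intro exI[of _ p] conjI exI[of _ "\<sigma> (Suc p)"]) auto
    then show False using nw by blast
  qed
  show "\<sigma> p < \<sigma> (Suc p)" if "p < Suc k"
  proof (rule ccontr)
    assume "\<not> \<sigma> p < \<sigma> (Suc p)"
    then have "\<exists>p < Suc k. \<exists>a < B. \<exists>b < B. full \<sigma> p a \<and> full \<sigma> (Suc p) b \<and> b \<le> a"
      using that s[of p] s[of "Suc p"] full_less[of p] full_less[of "Suc p"]
      by (intro exI[of _ p] conjI exI[of _ "\<sigma> p"] exI[of _ "\<sigma> (Suc p)"]) auto
    then show False using nw by blast
  qed
qed

context
  fixes \<sigma>
  assumes \<sigma>: "assigns \<sigma>" "\<not> wrong_selection (full \<sigma>)"
begin

lemma selection_mono: "p < p' \<Longrightarrow> p' \<le> Suc k \<Longrightarrow> \<sigma> p < \<sigma> p'"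
proof (induction p')
  case (Suc p')
  then show ?case
    using not_wrong_selectionD(4)[OF \<sigma>, of p'] by (cases "p = p'") auto
qed simp

text \<open>The gap test is a negative inference: two consecutive entries around
  \<open>Suc i\<close> exclude all other entries only because the list is strictly increasing. This
  is why monotonicity is proved under a correct selection.\<close>

lemma input_val_mono:
  assumes K: "\<forall>r v. K r v \<longrightarrow> full \<sigma> r v" and ne: "input_val K i \<noteq> 1"
  shows "input_val K i = input_val (full \<sigma>) i"
proof (cases "\<exists>p < k. K (Suc p) (Suc i)")
  case True
  then have "\<exists>p < k. full \<sigma> (Suc p) (Suc i)" using K by blast
  with True show ?thesis by (simp add: input_val_def)
next
  case False
  with ne obtain p a b where p: "p < Suc k" "a < Suc i" "K p a" "b < B" "Suc i < b" "K (Suc p) b"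
    by (auto simp: input_val_def split: if_splits)
  then have f: "full \<sigma> p a" "full \<sigma> (Suc p) b" using K by blast+
  then have s: "\<sigma> p < Suc i" "Suc i < \<sigma> (Suc p)" using p by (auto simp: full_def)
  have "\<not> full \<sigma> (Suc p') (Suc i)" if "p' < k" for p'
  proof
    assume "full \<sigma> (Suc p') (Suc i)"
    then have eq: "\<sigma> (Suc p') = Suc i" by (simp add: full_def)
    have "\<sigma> (Suc p') \<le> \<sigma> p" if "p' < p"
      using selection_mono[of "Suc p'" p] that p(1) by (cases "Suc p' = p") auto
    moreover have "\<sigma> (Suc p) \<le> \<sigma> (Suc p')" if "p \<le> p'"
      using selection_mono[of "Suc p" "Suc p'"] that \<open>p' < k\<close> by (cases "p = p'") auto
    ultimately show False using s eq by (cases "p' < p") auto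
  qed
  then have "input_val (full \<sigma>) i = 0" using p f unfolding input_val_def by auto
  moreover have "input_val K i = 0" using False p unfolding input_val_def by auto
  ultimately show ?thesis by simp
qed

lemma input_val_le: "input_val K i \<le> 2"
  by (simp add: input_val_def)

lemma ev_le: "ev K h i a \<le> 2"
  by (induction h arbitrary: i a) (auto simp: input_val_le)

text \<open>These are Kleene's three-valued connectives: minimum, maximum and reflection at 1 keep
  definite values when their arguments are refined. A guess is read from one coordinate, on which
  \<open>K\<close> cannot disagree with \<open>\<sigma>\<close>.\<close>

lemma ev_mono:
  assumes K: "\<forall>r v. K r v \<longrightarrow> full \<sigma> r v"
  shows "ev K h i a \<noteq> 1 \<Longrightarrow> ev K h i a = ev (full \<sigma>) h i a"
proof (induction h arbitrary: i a)
  case (Suc h)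
  have IH: "ev K h i a = 1 \<or> ev K h i a = ev (full \<sigma>) h i a" for i a using Suc.IH by blast
  have le: "ev K h i a \<le> 2" "ev (full \<sigma>) h i a \<le> 2" for i a by (rule ev_le)+
  consider "tg i = 0" | "tg i = 1" | "tg i \<noteq> 0" "tg i \<noteq> 1" "ln i = 2" | "tg i \<noteq> 0" "tg i \<noteq> 1" "ln i \<noteq> 2"
    by blast
  then show ?case
  proof cases
    case 1
    then show ?thesis using Suc.prems input_val_mono[OF K] by simp
  next
    case 2
    then show ?thesis using Suc.prems IH[of "ch i 0" "2 * a"] le[of "ch i 0" "2 * a"] by auto
  next
    case 3
    then show ?thesis
      using Suc.prems IH[of "ch i 0" "2 * a"] le[of "ch i 0" "2 * a"]
        IH[of "ch i 1" "2 * a + 1"] le[of "ch i 1" "2 * a + 1"]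
      by (auto split: if_splits)
  next
    case 4
    have f: "\<not> full \<sigma> r 0" if "full \<sigma> r (Suc j)" for r j using that by (simp add: full_def)
    from 4 show ?thesis using Suc.prems K f by (auto split: if_splits)
  qed
qed simp

lemma wrong_witness_mono:
  assumes K: "\<forall>r v. K r v \<longrightarrow> full \<sigma> r v"
  shows "wrong_witness K h i a \<Longrightarrow> wrong_witness (full \<sigma>) h i a"
proof (induction h arbitrary: i a)
  case (Suc h)
  have e: "ev (full \<sigma>) h i' 0 = (if b then 0 else 2)" if "ev K h i' 0 = (if b then 0 else 2)" for i' b
    using ev_mono[OF K, where h = h and i = i' and a = 0] that by (cases b) simp_all
  have e': "ev (full \<sigma>) h i' 0 = (if b then 2 else 0)" if "ev K h i' 0 = (if b then 2 else 0)" for i' b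
    using e[of i' "\<not> b"] that by (simp split: if_splits)
  consider "tg i = 0" | "tg i = 1" | "tg i \<noteq> 0" "tg i \<noteq> 1" "ln i = 2" | "tg i \<noteq> 0" "tg i \<noteq> 1" "ln i \<noteq> 2"
    by blast
  then show ?case
  proof cases
    case 4
    from Suc.prems 4 show ?thesis
      unfolding wrong_witness.simps by (simp only: if_False) (use K e e' in blast)
  qed (use Suc in auto)
qed simp

text \<open>Contraposed: tuples cut out of an assignment without violation satisfy all constraints.
  Conflicting entries and selection errors cannot occur in a \<open>K\<close> below
  \<open>full \<sigma>\<close>, so only the two parts with a monotonicity lemma remain.\<close>

lemma violated_mono:
  assumes K: "\<forall>r v. K r v \<longrightarrow> full \<sigma> r v" and v: "violated K"
  shows "violated (full \<sigma>)"
proof -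
  have 1: "a = b" if "K r a" "K r b" for r a b
    using K that unfolding full_def by metis
  have 2: "\<not> wrong_selection K"
    using \<sigma>(2) wrong_selection_mono[of K "full \<sigma>"] K by blast
  have "ev K (Suc d) (m - 1) 1 = 0 \<or> wrong_witness K (Suc d) (m - 1) 1"
    using v 1 2 unfolding violated_def by blast
  then have "ev (full \<sigma>) (Suc d) (m - 1) 1 = 0 \<or> wrong_witness (full \<sigma>) (Suc d) (m - 1) 1"
  proof
    assume "ev K (Suc d) (m - 1) 1 = 0"
    then have "ev (full \<sigma>) (Suc d) (m - 1) 1 = 0"
      using ev_mono[OF K, where h = "Suc d" and i = "m - 1" and a = 1] by linarith
    then show ?thesis ..
  qed (rule disjI2, rule wrong_witness_mono[OF K])
  then show ?thesis unfolding violated_def by blast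
qed

text \<open>A sandwich: \<open>P\<close> is to hold for every \<open>K\<close> between the knowledge
  of \<open>D\<close> and all of \<open>\<sigma>\<close>. Later \<open>K\<close> is the union of two
  tuples, which may know more than \<open>D\<close>.\<close>

definition determines :: "nat set \<Rightarrow> ((nat \<Rightarrow> nat \<Rightarrow> bool) \<Rightarrow> bool) \<Rightarrow> bool" where
  "determines D P \<longleftrightarrow> D \<subseteq> {..<num_coords} \<and>
     (\<forall>K. (\<forall>r \<in> D. K r (\<sigma> r)) \<longrightarrow> (\<forall>r v. K r v \<longrightarrow> full \<sigma> r v) \<longrightarrow> P K)"

lemma determinesI:
  assumes "D \<subseteq> {..<num_coords}"
    and "\<And>K. (\<forall>r \<in> D. K r (\<sigma> r)) \<Longrightarrow> (\<forall>r v. K r v \<longrightarrow> full \<sigma> r v) \<Longrightarrow> P K"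
  shows "determines D P"
  using assms by (simp add: determines_def)

lemma determines_weaken: "determines D P \<Longrightarrow> (\<And>K. P K \<Longrightarrow> Q K) \<Longrightarrow> determines D Q"
  by (simp add: determines_def)

lemma determines_full:
  assumes "full \<sigma> r v"
  shows "determines {r} (\<lambda>K. K r v)"
proof (rule determinesI)
  have eq: "r < num_coords" "v = \<sigma> r" using assms by (simp_all add: full_def)
  show "{r} \<subseteq> {..<num_coords}" using eq(1) by simp
  show "K r v" if "\<forall>r' \<in> {r}. K r' (\<sigma> r')" for K using that unfolding eq(2) by blast
qed

lemma determines_Un:
  assumes "determines D P" "determines D' Q"
    and "\<And>K. (\<forall>r \<in> D \<union> D'. K r (\<sigma> r)) \<Longrightarrow> (\<forall>r v. K r v \<longrightarrow> full \<sigma> r v) \<Longrightarrow> P K \<Longrightarrow> Q K \<Longrightarrow> R K"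
  shows "determines (D \<union> D') R"
  using assms(1,2) by (intro determinesI assms(3)) (auto simp: determines_def)

text \<open>One entry shows that an input is selected, two consecutive ones that it is not. An input
  that \<open>\<sigma>\<close> itself leaves undecided is undecided for all smaller \<open>K\<close>
  by \<open>input_val_mono\<close>, at no cost.\<close>

lemma input_val_local:
  "\<exists>D. card D \<le> 2 \<and> determines D (\<lambda>K. input_val K i = input_val (full \<sigma>) i)"
proof -
  have "(\<exists>p < k. full \<sigma> (Suc p) (Suc i)) \<or>
      (\<exists>p < Suc k. \<exists>a < Suc i. full \<sigma> p a \<and> (\<exists>b < B. Suc i < b \<and> full \<sigma> (Suc p) b)) \<or>
      input_val (full \<sigma>) i = 1"
    by (simp add: input_val_def)
  then consider p where "p < k" "full \<sigma> (Suc p) (Suc i)"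
    | p a b where "p < Suc k" "a < Suc i" "full \<sigma> p a" "b < B" "Suc i < b" "full \<sigma> (Suc p) b"
    | "input_val (full \<sigma>) i = 1"
    by blast
  then show ?thesis
  proof cases
    case 1
    have "determines {Suc p} (\<lambda>K. input_val K i = input_val (full \<sigma>) i)"
    proof (rule determinesI)
      show "{Suc p} \<subseteq> {..<num_coords}" using 1 by (simp add: num_coords_def)
      fix K assume "\<forall>r \<in> {Suc p}. K r (\<sigma> r)"
      then have "K (Suc p) (Suc i)" using 1 by (simp add: full_def)
      then show "input_val K i = input_val (full \<sigma>) i" using 1 by (auto simp: input_val_def)
    qed
    then show ?thesis by (intro exI[of _ "{Suc p}"]) simp
  next
    case 2
    have "determines {p, Suc p} (\<lambda>K. input_val K i = input_val (full \<sigma>) i)"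
    proof (rule determinesI)
      show "{p, Suc p} \<subseteq> {..<num_coords}" using 2 by (simp add: num_coords_def)
      fix K assume "\<forall>r \<in> {p, Suc p}. K r (\<sigma> r)" and K: "\<forall>r v. K r v \<longrightarrow> full \<sigma> r v"
      then have "K p a" "K (Suc p) b" using 2(3,6) unfolding full_def by blast+
      then have "input_val K i \<noteq> 1" using 2 by (auto simp: input_val_def)
      then show "input_val K i = input_val (full \<sigma>) i" using input_val_mono K by blast
    qed
    then show ?thesis by (intro exI[of _ "{p, Suc p}"]) (simp add: card_insert_if)
  next
    case 3
    have "determines {} (\<lambda>K. input_val K i = input_val (full \<sigma>) i)"
    proof (rule determinesI)
      fix K assume "\<forall>r v. K r v \<longrightarrow> full \<sigma> r v"
      from input_val_mono[OF this, of i] 3 show "input_val K i = input_val (full \<sigma>) i"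
        by (cases "input_val K i = 1") simp_all
    qed simp
    then show ?thesis by (intro exI[of _ "{}"]) simp
  qed
qed

text \<open>\<open>Suc a * 2 ^ h\<close> exceeds all addresses reached from \<open>a\<close> in at
  most \<open>h\<close> descents and does not grow on the way to the children \<open>2 * a\<close>
  and \<open>2 * a + 1\<close>. As an invariant it keeps the addresses inside the reserved
  \<open>2 ^ (d + 2)\<close> coordinates.\<close>

lemma coord_less: "Suc a * 2 ^ h \<le> 2 ^ (d + 2) \<Longrightarrow> k + 2 + a < num_coords"
proof -
  assume "Suc a * 2 ^ h \<le> 2 ^ (d + 2)"
  moreover have "Suc a * 1 \<le> Suc a * 2 ^ h" by (rule mult_le_mono2) simp
  ultimately have "Suc a * 1 \<le> 2 ^ (d + 2)" by (rule le_trans[rotated])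
  then show ?thesis unfolding num_coords_def by simp
qed

text \<open>The evaluation is a binary tree with \<open>h\<close> levels whose leaves cost at most
  two coordinates each. A large gate is a leaf as well, since \<open>ev\<close> reads only its guess
  and not its many children; this is where guessing pays.\<close>

lemma ev_local:
  "Suc a * 2 ^ h \<le> 2 ^ (d + 2) \<Longrightarrow>
    \<exists>D. card D \<le> 2 * 2 ^ h \<and> determines D (\<lambda>K. ev K h i a = ev (full \<sigma>) h i a)"
proof (induction h arbitrary: i a)
  case 0
  show ?case by (intro exI[of _ "{}"]) (simp add: determines_def)
next
  case (Suc h)
  have a1: "Suc (2 * a) * 2 ^ h \<le> 2 ^ (d + 2)" and a2: "Suc (2 * a + 1) * 2 ^ h \<le> 2 ^ (d + 2)"
    using Suc.prems by (simp_all add: algebra_simps)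
  obtain D1 where D1: "card D1 \<le> 2 * 2 ^ h"
    "determines D1 (\<lambda>K. ev K h (ch i 0) (2 * a) = ev (full \<sigma>) h (ch i 0) (2 * a))"
    using Suc.IH[OF a1] by blast
  obtain D2 where D2: "card D2 \<le> 2 * 2 ^ h"
    "determines D2 (\<lambda>K. ev K h (ch i 1) (2 * a + 1) = ev (full \<sigma>) h (ch i 1) (2 * a + 1))"
    using Suc.IH[OF a2] by blast
  consider "tg i = 0" | "tg i = 1" | "tg i \<noteq> 0" "tg i \<noteq> 1" "ln i = 2" | "tg i \<noteq> 0" "tg i \<noteq> 1" "ln i \<noteq> 2"
    by blast
  then show ?case
  proof cases
    case 1
    obtain D where D: "card D \<le> 2" "determines D (\<lambda>K. input_val K i = input_val (full \<sigma>) i)"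
      using input_val_local by blast
    have "(2::nat) * 1 \<le> 2 * 2 ^ Suc h" by (rule mult_le_mono2) simp
    then have "card D \<le> 2 * 2 ^ Suc h" unfolding mult_1_right by (rule le_trans[OF D(1)])
    moreover have "determines D (\<lambda>K. ev K (Suc h) i a = ev (full \<sigma>) (Suc h) i a)"
      by (rule determines_weaken[OF D(2)]) (simp only: ev.simps 1 simp_thms if_True)
    ultimately show ?thesis by (intro exI[of _ D] conjI)
  next
    case 2
    have "determines D1 (\<lambda>K. ev K (Suc h) i a = ev (full \<sigma>) (Suc h) i a)"
      by (rule determines_weaken[OF D1(2)]) (simp only: ev.simps 2 one_neq_zero if_False if_True simp_thms)
    then show ?thesis using D1(1) by (intro exI[of _ D1]) simp
  next
    case 3
    have "determines (D1 \<union> D2) (\<lambda>K. ev K (Suc h) i a = ev (full \<sigma>) (Suc h) i a)"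
      using D1(2) D2(2) by (rule determines_Un) (simp only: ev.simps 3 if_False if_True simp_thms)
    moreover have "card (D1 \<union> D2) \<le> 2 * 2 ^ Suc h"
      using card_Un_le[of D1 D2] D1(1) D2(1) by simp
    ultimately show ?thesis by blast
  next
    case 4
    have lt: "k + 2 + a < num_coords" using Suc.prems by (rule coord_less)
    have "determines {k + 2 + a} (\<lambda>K. ev K (Suc h) i a = ev (full \<sigma>) (Suc h) i a)"
    proof (rule determinesI)
      show "{k + 2 + a} \<subseteq> {..<num_coords}" using lt by simp
      fix K assume K1: "\<forall>r \<in> {k + 2 + a}. K r (\<sigma> r)" and K: "\<forall>r v. K r v \<longrightarrow> full \<sigma> r v"
      have "K (k + 2 + a) (\<sigma> (k + 2 + a))" using K1 by blast
      then have "K (k + 2 + a) v \<longleftrightarrow> full \<sigma> (k + 2 + a) v" for v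
        using spec[OF spec[OF K, of "k + 2 + a"], of v] lt unfolding full_def by blast
      then show "ev K (Suc h) i a = ev (full \<sigma>) (Suc h) i a" by (simp only: ev.simps 4 if_False)
    qed
    then show ?thesis by (intro exI[of _ "{k + 2 + a}"]) simp
  qed
qed

text \<open>A wrong guess is exposed by the guess itself and at most one offending child, whatever
  the fan-in. This takes \<open>1 + 2 * 2 ^ h\<close> coordinates, which fits under
  \<open>2 * 2 ^ Suc h\<close>.\<close>

lemma wrong_witness_local:
  "Suc a * 2 ^ h \<le> 2 ^ (d + 2) \<Longrightarrow> wrong_witness (full \<sigma>) h i a \<Longrightarrow>
    \<exists>D. card D \<le> 2 * 2 ^ h \<and> determines D (\<lambda>K. wrong_witness K h i a)"
proof (induction h arbitrary: i a)
  case (Suc h)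
  have a1: "Suc (2 * a) * 2 ^ h \<le> 2 ^ (d + 2)" and a2: "Suc (2 * a + 1) * 2 ^ h \<le> 2 ^ (d + 2)"
    and a0: "Suc 0 * 2 ^ h \<le> 2 ^ (d + 2)"
    using Suc.prems(1) by (simp_all add: algebra_simps)
  have w: "if tg i = 0 then False
     else if tg i = 1 then wrong_witness (full \<sigma>) h (ch i 0) (2 * a)
     else if ln i = 2 then wrong_witness (full \<sigma>) h (ch i 0) (2 * a) \<or> wrong_witness (full \<sigma>) h (ch i 1) (2 * a + 1)
     else (full \<sigma> (k + 2 + a) 0 \<and> (\<exists>j < ln i. ev (full \<sigma>) h (ch i j) 0 = (if tg i = 2 then 0 else 2))) \<or>
       (\<exists>j < B. full \<sigma> (k + 2 + a) (Suc j) \<and> (ln i \<le> j \<or> ev (full \<sigma>) h (ch i j) 0 = (if tg i = 2 then 2 else 0)))"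
    using Suc.prems(2) by (simp only: wrong_witness.simps)
  consider "tg i = 1" "wrong_witness (full \<sigma>) h (ch i 0) (2 * a)"
    | "tg i \<noteq> 0" "tg i \<noteq> 1" "ln i = 2" "wrong_witness (full \<sigma>) h (ch i 0) (2 * a)"
    | "tg i \<noteq> 0" "tg i \<noteq> 1" "ln i = 2" "wrong_witness (full \<sigma>) h (ch i 1) (2 * a + 1)"
    | j where "tg i \<noteq> 0" "tg i \<noteq> 1" "ln i \<noteq> 2" "full \<sigma> (k + 2 + a) 0" "j < ln i"
        "ev (full \<sigma>) h (ch i j) 0 = (if tg i = 2 then 0 else 2)"
    | j where "tg i \<noteq> 0" "tg i \<noteq> 1" "ln i \<noteq> 2" "j < B" "full \<sigma> (k + 2 + a) (Suc j)"
        "ln i \<le> j \<or> ev (full \<sigma>) h (ch i j) 0 = (if tg i = 2 then 2 else 0)"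
  proof (cases "tg i = 0 \<or> tg i = 1 \<or> ln i = 2")
    case True
    then show ?thesis using w that(1-3) by (simp split: if_splits) blast+
  next
    case False
    then have "(full \<sigma> (k + 2 + a) 0 \<and> (\<exists>j < ln i. ev (full \<sigma>) h (ch i j) 0 = (if tg i = 2 then 0 else 2))) \<or>
       (\<exists>j < B. full \<sigma> (k + 2 + a) (Suc j) \<and> (ln i \<le> j \<or> ev (full \<sigma>) h (ch i j) 0 = (if tg i = 2 then 2 else 0)))"
      using w by (simp only: de_Morgan_disj if_False)
    then show ?thesis using that(4,5) False by (elim disjE exE conjE) blast+
  qed
  then show ?case
  proof cases
    case 1
    then obtain D where "card D \<le> 2 * 2 ^ h" "determines D (\<lambda>K. wrong_witness K h (ch i 0) (2 * a))"
      using Suc.IH[OF a1] by blast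
    have "determines D (\<lambda>K. wrong_witness K (Suc h) i a)"
      by (rule determines_weaken[OF \<open>determines D _\<close>]) (simp only: wrong_witness.simps 1 one_neq_zero if_False if_True simp_thms)
    with \<open>card D \<le> 2 * 2 ^ h\<close> show ?thesis by (intro exI[of _ D]) simp
  next
    case 2
    then obtain D where "card D \<le> 2 * 2 ^ h" "determines D (\<lambda>K. wrong_witness K h (ch i 0) (2 * a))"
      using Suc.IH[OF a1] by blast
    have "determines D (\<lambda>K. wrong_witness K (Suc h) i a)"
      by (rule determines_weaken[OF \<open>determines D _\<close>]) (simp only: wrong_witness.simps 2 one_neq_zero if_False if_True simp_thms)
    with \<open>card D \<le> 2 * 2 ^ h\<close> show ?thesis by (intro exI[of _ D]) simp
  next
    case 3
    then obtain D where "card D \<le> 2 * 2 ^ h" "determines D (\<lambda>K. wrong_witness K h (ch i 1) (2 * a + 1))"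
      using Suc.IH[OF a2] by blast
    have "determines D (\<lambda>K. wrong_witness K (Suc h) i a)"
      by (rule determines_weaken[OF \<open>determines D _\<close>]) (simp only: wrong_witness.simps 3 one_neq_zero if_False if_True simp_thms)
    with \<open>card D \<le> 2 * 2 ^ h\<close> show ?thesis by (intro exI[of _ D]) simp
  next
    case (4 j)
    obtain D where D: "card D \<le> 2 * 2 ^ h" "determines D (\<lambda>K. ev K h (ch i j) 0 = ev (full \<sigma>) h (ch i j) 0)"
      using ev_local[OF a0] by blast
    have 0: "determines {k + 2 + a} (\<lambda>K. K (k + 2 + a) 0)"
      using 4(4) by (rule determines_full)
    have "determines ({k + 2 + a} \<union> D) (\<lambda>K. wrong_witness K (Suc h) i a)"
      using 0 D(2) by (rule determines_Un) (simp only: wrong_witness.simps 4 if_False, rule disjI1, use 4 in blast)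
    moreover have "card ({k + 2 + a} \<union> D) \<le> 2 * 2 ^ Suc h"
    proof -
      have "1 \<le> (2::nat) ^ h" by simp
      moreover have "card ({k + 2 + a} \<union> D) \<le> 1 + 2 * 2 ^ h"
        using card_Un_le[of "{k + 2 + a}" D] D(1) by simp
      ultimately show ?thesis unfolding power_Suc by linarith
    qed
    ultimately show ?thesis by blast
  next
    case (5 j)
    obtain D where D: "card D \<le> 2 * 2 ^ h" "determines D (\<lambda>K. ev K h (ch i j) 0 = ev (full \<sigma>) h (ch i j) 0)"
      using ev_local[OF a0] by blast
    have 0: "determines {k + 2 + a} (\<lambda>K. K (k + 2 + a) (Suc j))"
      using 5(5) by (rule determines_full)
    have "determines ({k + 2 + a} \<union> D) (\<lambda>K. wrong_witness K (Suc h) i a)"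
      using 0 D(2) by (rule determines_Un) (simp only: wrong_witness.simps 5 if_False, rule disjI2,
          rule exI[of _ j], use 5 in \<open>simp split: if_splits\<close>)
    moreover have "card ({k + 2 + a} \<union> D) \<le> 2 * 2 ^ Suc h"
    proof -
      have "1 \<le> (2::nat) ^ h" by simp
      moreover have "card ({k + 2 + a} \<union> D) \<le> 1 + 2 * 2 ^ h"
        using card_Un_le[of "{k + 2 + a}" D] D(1) by simp
      ultimately show ?thesis unfolding power_Suc by linarith
    qed
    ultimately show ?thesis by blast
  qed
qed simp

end

text \<open>The certificates for \<open>ev\<close> and \<open>wrong_witness\<close> presuppose a
  correct selection, so a faulty list is treated first; there two neighbouring entries show the
  fault.\<close>

lemma violated_local:
  assumes s: "assigns \<sigma>" and v: "violated (full \<sigma>)"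
  shows "\<exists>D \<subseteq> {..<num_coords}. card D \<le> 2 ^ (d + 2) \<and>
    (\<forall>K. (\<forall>r \<in> D. K r (\<sigma> r)) \<longrightarrow> (\<forall>r v. K r v \<longrightarrow> full \<sigma> r v) \<longrightarrow> violated K)"
proof (cases "wrong_selection (full \<sigma>)")
  case True
  have two: "2 \<le> (2::nat) ^ (d + 2)" by simp
  have B: "\<sigma> r < B" if "r < num_coords" for r using s that by (simp add: assigns_def)
  from True consider a where "a < B" "full \<sigma> 0 a" "a \<noteq> 0"
    | a where "a < B" "full \<sigma> (Suc k) a" "a \<noteq> Suc m"
    | p a where "p < k" "a < B" "full \<sigma> (Suc p) a" "a = 0 \<or> m < a \<or> tg (a - 1) \<noteq> 0"
    | p a b where "p < Suc k" "a < B" "b < B" "full \<sigma> p a" "full \<sigma> (Suc p) b" "b \<le> a"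
    unfolding wrong_selection_def by blast
  then have "\<exists>p \<le> k. \<forall>K. K p (\<sigma> p) \<and> K (Suc p) (\<sigma> (Suc p)) \<longrightarrow> wrong_selection K"
  proof cases
    case (1 a)
    then have "a = \<sigma> 0" by (simp add: full_def)
    then show ?thesis unfolding wrong_selection_def using 1 by (intro exI[of _ 0]) blast
  next
    case (2 a)
    then have "a = \<sigma> (Suc k)" by (simp add: full_def)
    then show ?thesis unfolding wrong_selection_def using 2 by (intro exI[of _ k]) blast
  next
    case (3 p a)
    then have "a = \<sigma> (Suc p)" by (simp add: full_def)
    then have "wrong_selection K" if "K (Suc p) (\<sigma> (Suc p))" for K
      unfolding wrong_selection_def using 3 that by blast
    then show ?thesis using 3(1) by (intro exI[of _ p]) simp
  next
    case (4 p a b)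
    then have "a = \<sigma> p" "b = \<sigma> (Suc p)" by (simp_all add: full_def)
    then have "wrong_selection K" if "K p (\<sigma> p)" "K (Suc p) (\<sigma> (Suc p))" for K
      unfolding wrong_selection_def using 4 that by blast
    then show ?thesis using 4(1) by (intro exI[of _ p]) simp
  qed
  then obtain p where p: "p \<le> k"
    and w: "\<forall>K. K p (\<sigma> p) \<and> K (Suc p) (\<sigma> (Suc p)) \<longrightarrow> wrong_selection K"
    by (elim exE conjE)
  have v: "violated K" if "\<forall>r \<in> {p, Suc p}. K r (\<sigma> r)" for K
  proof -
    have "wrong_selection K" using spec[OF w, of K] that by simp
    then show ?thesis unfolding violated_def by (intro disjI2 disjI1)
  qed
  have "card {p, Suc p} = 2" by simp
  then have "card {p, Suc p} \<le> 2 ^ (d + 2)" using two by (simp only:)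
  moreover have "{p, Suc p} \<subseteq> {..<num_coords}" using p by (simp add: num_coords_def)
  ultimately show ?thesis
    by (intro exI[of _ "{p, Suc p}"] conjI allI impI v)
next
  case False
  note s' = s False
  \<comment> \<open>The root has address 1 and is evaluated with \<open>Suc d\<close> levels. The
    address invariant holds with equality, which explains the number of guess coordinates.\<close>
  have r: "Suc 1 * 2 ^ Suc d \<le> (2::nat) ^ (d + 2)" by simp
  have "\<exists>D. card D \<le> 2 * 2 ^ Suc d \<and> determines \<sigma> D violated"
  proof (cases "ev (full \<sigma>) (Suc d) (m - 1) 1 = 0")
    case True
    obtain D where D: "card D \<le> 2 * 2 ^ Suc d"
      "determines \<sigma> D (\<lambda>K. ev K (Suc d) (m - 1) 1 = ev (full \<sigma>) (Suc d) (m - 1) 1)"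
      using ev_local[OF s' r, of "m - 1"] by (elim exE conjE)
    have "determines \<sigma> D violated"
      by (rule determines_weaken[OF s' D(2)]) (simp only: True violated_def simp_thms)
    with D(1) show ?thesis by (intro exI[of _ D] conjI)
  next
    case nz: False
    have "\<not> (full \<sigma> r a \<and> full \<sigma> r b \<and> a \<noteq> b)" for r a b by (auto simp: full_def)
    then have "wrong_witness (full \<sigma>) (Suc d) (m - 1) 1"
      using v False nz unfolding violated_def by blast
    then obtain D where D: "card D \<le> 2 * 2 ^ Suc d"
      "determines \<sigma> D (\<lambda>K. wrong_witness K (Suc d) (m - 1) 1)"
      using wrong_witness_local[OF s' r] by meson
    have "determines \<sigma> D violated"
      by (rule determines_weaken[OF s' D(2)]) (simp only: violated_def simp_thms)
    with D(1) show ?thesis by (intro exI[of _ D] conjI)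
  qed
  then obtain D where "card D \<le> 2 * 2 ^ Suc d" "determines \<sigma> D violated" by (elim exE conjE)
  then show ?thesis unfolding determines_def[OF s'] by (intro exI[of _ D] conjI) simp_all
qed

end

section \<open>Depth and weft through bounded descending walks\<close>

inductive gate_path :: "gate list \<Rightarrow> nat list \<Rightarrow> nat \<Rightarrow> bool" for C where
  start: "i < length C \<Longrightarrow> C ! i = Input \<Longrightarrow> gate_path C [i] i"
| step: "gate_path C P j \<Longrightarrow> i < length C \<Longrightarrow> j \<in> set (preds (C ! i)) \<Longrightarrow> gate_path C (P @ [i]) i"

lemma gate_path_props:
  "gate_path C P i \<Longrightarrow> P \<noteq> [] \<and> set P \<subseteq> {..<length C} \<and> C ! hd P = Input \<and> last P = i \<and>
     (\<forall>l. Suc l < length P \<longrightarrow> P ! l \<in> set (preds (C ! (P ! Suc l))))"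
proof (induction rule: gate_path.induct)
  case (step P j i)
  have "(P @ [i]) ! l \<in> set (preds (C ! ((P @ [i]) ! Suc l)))" if "Suc l < length (P @ [i])" for l
  proof (cases "Suc l < length P")
    case True
    then show ?thesis using step by (simp add: nth_append)
  next
    case False
    then have l: "Suc l = length P" using that by simp
    then have "P ! l = j" using step.IH by (metis diff_Suc_1 last_conv_nth)
    then show ?thesis using l step.hyps(3) by (simp add: nth_append)
  qed
  then show ?case using step by auto
qed simp

lemma gate_pathI:
  assumes "P \<noteq> []" "set P \<subseteq> {..<length C}" "C ! hd P = Input"
    "\<forall>l. Suc l < length P \<longrightarrow> P ! l \<in> set (preds (C ! (P ! Suc l)))"
  shows "gate_path C P (last P)"
  using assms
proof (induction P rule: rev_induct)
  case (snoc i P)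
  show ?case
  proof (cases "P = []")
    case True
    then show ?thesis using snoc.prems by (auto intro: gate_path.start)
  next
    case False
    have "P ! l \<in> set (preds (C ! (P ! Suc l)))" if "Suc l < length P" for l
      using spec[OF snoc.prems(4), of l] that by (simp add: nth_append)
    then have "gate_path C P (last P)" using snoc False by simp
    moreover have "last P \<in> set (preds (C ! i))"
      using spec[OF snoc.prems(4), of "length P - 1"] False by (simp add: nth_append last_conv_nth)
    ultimately show ?thesis using snoc.prems by (auto intro: gate_path.step)
  qed
qed simp

text \<open>Growing a path at its output end matches the way in which \<open>chain\<close> and its
  variants unfold; the definition by positions in a list does not.\<close>

lemma input_output_path_iff: "input_output_path C P \<longleftrightarrow> gate_path C P (length C - 1)"
  unfolding input_output_path_def using gate_path_props[of C P] gate_pathI[of P C] by metis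

locale circuit_view = view +
  fixes C :: "gate list"
  assumes circuit: "circuit C" and m: "m = length C" and B: "Suc m < B"
    and make_gate: "i < m \<Longrightarrow> C ! i = make_gate (tg i) (ln i) (ch i)"
    and ln_Input: "tg i = 0 \<Longrightarrow> ln i = 0" and ln_Neg: "tg i = 1 \<Longrightarrow> ln i = 1"
begin

lemma preds_eq: "i < m \<Longrightarrow> preds (C ! i) = map (ch i) [0..<ln i]"
  using make_gate[of i] ln_Input[of i] ln_Neg[of i] by (auto simp: make_gate_def)

lemma ch_less: "i < m \<Longrightarrow> j < ln i \<Longrightarrow> ch i j < i"
  using circuit preds_eq[of i] m by (auto simp: circuit_def)

lemma ch_less_m: "i < m \<Longrightarrow> j < ln i \<Longrightarrow> ch i j < m"
  using ch_less by (meson less_trans)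

lemma Input_iff: "i < m \<Longrightarrow> C ! i = Input \<longleftrightarrow> tg i = 0"
  using make_gate[of i] by (auto simp: make_gate_def)

lemma m_pos: "0 < m"
  using circuit m by (auto simp: circuit_def)

lemma ln_ge_2: "i < m \<Longrightarrow> tg i \<noteq> 0 \<Longrightarrow> tg i \<noteq> 1 \<Longrightarrow> 2 \<le> ln i"
  using circuit make_gate[of i] m by (auto simp: circuit_def make_gate_def split: if_splits)

text \<open>Children are distinct and precede their gate. This keeps witness numbers, shifted by
  one, below \<open>B\<close>.\<close>

lemma ln_le: "i < m \<Longrightarrow> ln i \<le> m"
proof -
  assume i: "i < m"
  have "distinct (preds (C ! i))"
    using circuit i m unfolding circuit_def by (cases "C ! i") force+
  then have "ln i = card (set (preds (C ! i)))"
    using preds_eq[OF i] by (metis diff_zero distinct_card length_map length_upt)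
  also have "\<dots> \<le> card {..<i}"
    using ch_less[OF i] preds_eq[OF i] by (intro card_mono) auto
  finally show ?thesis using i by simp
qed

text \<open>Every gate other than an input has a child with a smaller index. So a descending walk
  that stops anywhere can be prolonged to an input, which makes the bounded walks agree with
  input-output paths.\<close>

lemma path_exists: "i < m \<Longrightarrow> \<exists>P. gate_path C P i"
proof (induction i rule: less_induct)
  case (less i)
  show ?case
  proof (cases "tg i = 0")
    case True
    then have "gate_path C [i] i" using less.prems m Input_iff by (intro gate_path.start) auto
    then show ?thesis ..
  next
    case False
    then have "0 < ln i" using ln_ge_2[OF less.prems] ln_Neg[of i] by (cases "tg i = 1") auto
    then obtain P where "gate_path C P (ch i 0)"
      using less.IH[OF ch_less[OF less.prems]] ch_less_m[OF less.prems] by blast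
    then have "gate_path C (P @ [i]) i"
      using \<open>0 < ln i\<close> less.prems m preds_eq by (intro gate_path.step) auto
    then show ?thesis ..
  qed
qed

lemma gate_path_step:
  assumes "gate_path C P (ch i j)" "i < m" "j < ln i"
  shows "gate_path C (P @ [i]) i"
  using assms m preds_eq by (intro gate_path.step) auto

lemma chain_path: "chain h i \<Longrightarrow> i < m \<Longrightarrow> \<exists>P. gate_path C P i \<and> h < length P"
proof (induction h arbitrary: i)
  case 0
  then obtain P where "gate_path C P i" using path_exists by blast
  then show ?case using gate_path_props by blast
next
  case (Suc h)
  then obtain j where j: "j < ln i" "chain h (ch i j)" by auto
  then obtain P where "gate_path C P (ch i j)" "h < length P"
    using Suc.IH ch_less_m Suc.prems by blast
  then show ?case using gate_path_step[of P i j] Suc.prems j by (intro exI[of _ "P @ [i]"]) simp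
qed

lemma path_chain: "gate_path C P i \<Longrightarrow> h < length P \<Longrightarrow> chain h i"
proof (induction arbitrary: h rule: gate_path.induct)
  case (step P j i)
  show ?case
  proof (cases h)
    case (Suc h')
    then have "chain h' j" using step by simp
    moreover obtain j' where "j' < ln i" "j = ch i j'" using step.hyps preds_eq[of i] m by auto
    ultimately show ?thesis using Suc by auto
  qed simp
qed simp

lemma depth_iff: "depth_at_most h C \<longleftrightarrow> \<not> chain (Suc h) (m - 1)"
proof
  assume d: "depth_at_most h C"
  show "\<not> chain (Suc h) (m - 1)"
  proof
    assume "chain (Suc h) (m - 1)"
    then obtain P where "gate_path C P (m - 1)" "Suc h < length P"
      using chain_path[of "Suc h" "m - 1"] m_pos by auto
    then show False using d m unfolding depth_at_most_def input_output_path_iff by fastforce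
  qed
next
  assume c: "\<not> chain (Suc h) (m - 1)"
  show "depth_at_most h C"
    unfolding depth_at_most_def input_output_path_iff
  proof (intro allI impI, rule ccontr)
    fix P assume P: "gate_path C P (length C - 1)" and "\<not> length P - 1 \<le> h"
    then have "chain (Suc h) (length C - 1)" by (intro path_chain[OF P]) simp
    then show False using c m by simp
  qed
qed

abbreviation num_large :: "nat list \<Rightarrow> nat" where
  "num_large P \<equiv> length (filter (\<lambda>i. 2 < length (preds (C ! i))) P)"

lemma large_iff: "i < m \<Longrightarrow> 2 < length (preds (C ! i)) \<longleftrightarrow> 2 < ln i"
  using preds_eq by simp

lemma large_path_base:
  assumes l: "2 < ln i" and i: "i < m"
  shows "\<exists>P. gate_path C P i \<and> 1 \<le> num_large P"
proof -
  have 0: "0 < ln i" using l by simp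
  obtain P where "gate_path C P (ch i 0)" using path_exists[OF ch_less_m[OF i 0]] by blast
  from gate_path_step[OF this i 0] show ?thesis using large_iff[OF i] l
    by (intro exI[of _ "P @ [i]"]) simp
qed

lemma large_path: "large_within h i \<Longrightarrow> i < m \<Longrightarrow> \<exists>P. gate_path C P i \<and> 1 \<le> num_large P"
proof (induction h arbitrary: i)
  case 0
  then show ?case using large_path_base by simp
next
  case (Suc h)
  show ?case
  proof (cases "2 < ln i")
    case True
    then show ?thesis using large_path_base Suc.prems by blast
  next
    case False
    then obtain j where j: "j < ln i" "large_within h (ch i j)" using Suc.prems(1) by auto
    then obtain P where P: "gate_path C P (ch i j)" "1 \<le> num_large P"
      using Suc.IH ch_less_m[OF Suc.prems(2)] by blast
    from gate_path_step[OF P(1) Suc.prems(2) j(1)] P(2) show ?thesis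
      by (intro exI[of _ "P @ [i]"]) simp
  qed
qed

lemma two_large_path: "two_large_within h i \<Longrightarrow> i < m \<Longrightarrow> \<exists>P. gate_path C P i \<and> 2 \<le> num_large P"
proof (induction h arbitrary: i)
  case (Suc h)
  consider j where "2 < ln i" "j < ln i" "large_within h (ch i j)"
    | j where "j < ln i" "two_large_within h (ch i j)"
    using Suc.prems(1) by auto
  then show ?case
  proof cases
    case (1 j)
    then obtain P where "gate_path C P (ch i j)" "1 \<le> num_large P"
      using large_path ch_less_m Suc.prems by blast
    then show ?thesis using gate_path_step[of P i j] Suc.prems 1 large_iff
      by (intro exI[of _ "P @ [i]"]) simp
  next
    case (2 j)
    then obtain P where "gate_path C P (ch i j)" "2 \<le> num_large P"
      using Suc.IH ch_less_m Suc.prems by blast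
    then show ?thesis using gate_path_step[of P i j] Suc.prems 2
      by (intro exI[of _ "P @ [i]"]) simp
  qed
qed simp

lemma path_large:
  "gate_path C P i \<Longrightarrow> (1 \<le> num_large P \<longrightarrow> large_within (length P) i) \<and>
     (2 \<le> num_large P \<longrightarrow> two_large_within (length P) i)"
proof (induction rule: gate_path.induct)
  case (start i)
  then show ?case by simp
next
  case (step P j i)
  obtain j' where j': "j' < ln i" "j = ch i j'" using step.hyps preds_eq[of i] m by auto
  then have large: "2 < length (preds (C ! i)) \<longleftrightarrow> 2 < ln i" using step.hyps m by (simp add: large_iff)
  show ?case
  proof (cases "2 < ln i")
    case True
    then show ?thesis using step.IH j' large by auto
  next
    case False
    then show ?thesis using step.IH j' large by auto
  qed
qed

text \<open>The bounded search for two large gates misses nothing once the depth is at most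
  \<open>h\<close>, as paths then have at most \<open>Suc h\<close> gates.\<close>

lemma weft_iff:
  assumes "depth_at_most h C"
  shows "weft_at_most 1 C \<longleftrightarrow> \<not> two_large_within (Suc h) (m - 1)"
proof
  assume w: "weft_at_most 1 C"
  show "\<not> two_large_within (Suc h) (m - 1)"
  proof
    assume "two_large_within (Suc h) (m - 1)"
    then obtain P where "gate_path C P (m - 1)" "2 \<le> num_large P"
      using two_large_path[of "Suc h" "m - 1"] m_pos by auto
    then show False using w m unfolding weft_at_most_def input_output_path_iff by fastforce
  qed
next
  assume c: "\<not> two_large_within (Suc h) (m - 1)"
  show "weft_at_most 1 C"
    unfolding weft_at_most_def input_output_path_iff
  proof (intro allI impI)
    fix P assume P: "gate_path C P (length C - 1)"
    then have "length P - 1 \<le> h"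
      using assms unfolding depth_at_most_def input_output_path_iff by blast
    then have "length P \<le> Suc h" by simp
    then have "\<not> two_large_within (length P) (m - 1)" using c two_large_within_mono by blast
    then show "num_large P \<le> 1" using path_large[OF P] m by (auto simp: not_le)
  qed
qed

section \<open>Evaluation with complete knowledge agrees with the circuit\<close>

definition truth :: "(nat \<Rightarrow> bool) \<Rightarrow> nat \<Rightarrow> bool" where
  "truth a i = circuit_values a C ! i"

lemma truth_eq:
  assumes i: "i < m"
  shows "truth a i = (if tg i = 0 then a i else if tg i = 1 then \<not> truth a (ch i 0)
     else if tg i = 2 then \<forall>j < ln i. truth a (ch i j) else \<exists>j < ln i. truth a (ch i j))"
proof -
  have "\<forall>j \<in> set (preds (C ! i)). j < i" using i circuit m by (simp add: circuit_def)
  then show ?thesis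
    using circuit_values_nth[of i C a] i m make_gate[OF i]
    by (auto simp: truth_def make_gate_def)
qed

lemma satisfies_iff: "satisfies a C \<longleftrightarrow> truth a (m - 1)"
proof -
  have "circuit_values a C \<noteq> []"
    using m m_pos length_circuit_values[of a C] by (metis length_greater_0_conv)
  then show ?thesis unfolding satisfies_def truth_def using m by (simp add: last_conv_nth)
qed

lemma small_iff:
  assumes "i < m" "ln i \<le> 2"
  shows "tg i = 0 \<or> tg i = 1 \<or> ln i = 2"
  using ln_ge_2[OF assms(1)] assms(2) by auto

lemma truth_two:
  assumes "i < m" "tg i \<noteq> 0" "tg i \<noteq> 1" "ln i = 2"
  shows "truth a i \<longleftrightarrow> (if tg i = 2 then truth a (ch i 0) \<and> truth a (ch i 1) else truth a (ch i 0) \<or> truth a (ch i 1))"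
proof -
  have "(\<forall>j < 2. P j) \<longleftrightarrow> P 0 \<and> P 1" "(\<exists>j < 2. P j) \<longleftrightarrow> P 0 \<or> P 1" for P :: "nat \<Rightarrow> bool"
    by (auto simp: less_2_cases_iff)
  then show ?thesis using truth_eq[OF assms(1), of a] assms(2-4) by simp
qed

context
  fixes \<sigma> a
  assumes s: "assigns \<sigma>" "\<not> wrong_selection (full \<sigma>)"
    and a: "\<And>i. i < m \<Longrightarrow> tg i = 0 \<Longrightarrow> a i \<longleftrightarrow> (\<exists>p < k. \<sigma> (Suc p) = Suc i)"
begin

text \<open>Thanks to the sentinels an unselected input has a last entry before it and a next one
  after it, so complete knowledge leaves no input undecided.\<close>

lemma input_val_full:
  assumes i: "i < m" "tg i = 0"
  shows "input_val (full \<sigma>) i = (if a i then 2 else 0)"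
proof (cases "a i")
  case True
  then obtain p where p: "p < k" "\<sigma> (Suc p) = Suc i" using a[OF i] by blast
  then have "full \<sigma> (Suc p) (Suc i)" using full_less[of "Suc p" \<sigma> "Suc i"] by simp
  with p(1) True show ?thesis unfolding input_val_def by auto
next
  case False
  have n: "\<not> (\<exists>p < k. full \<sigma> (Suc p) (Suc i))"
    using False a[OF i] by (auto simp: full_def)
  define p where "p = Max {p. p \<le> k \<and> \<sigma> p \<le> Suc i}"
  have fin: "finite {p. p \<le> k \<and> \<sigma> p \<le> Suc i}" by (rule finite_subset[of _ "{..k}"]) auto
  have "0 \<in> {p. p \<le> k \<and> \<sigma> p \<le> Suc i}" using not_wrong_selectionD(1)[OF s] by simp
  then have "p \<in> {p. p \<le> k \<and> \<sigma> p \<le> Suc i}" unfolding p_def using fin by (intro Max_in) auto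
  then have p: "p \<le> k" "\<sigma> p \<le> Suc i" by auto
  have "\<sigma> p \<noteq> Suc i"
  proof
    assume eq: "\<sigma> p = Suc i"
    then have "p \<noteq> 0" using not_wrong_selectionD(1)[OF s] by (metis nat.distinct(1))
    then obtain p' where "p = Suc p'" using not0_implies_Suc by blast
    with eq p(1) have "p' < k" "full \<sigma> (Suc p') (Suc i)" using full_less[of p] by simp_all
    then show False using n by blast
  qed
  then have lt: "\<sigma> p < Suc i" using p(2) by simp
  have gt: "Suc i < \<sigma> (Suc p)"
  proof (cases "p = k")
    case True
    then show ?thesis using not_wrong_selectionD(2)[OF s] i(1) by simp
  next
    case pk: False
    show ?thesis
    proof (rule ccontr)
      assume "\<not> Suc i < \<sigma> (Suc p)"
      then have "Suc p \<in> {p. p \<le> k \<and> \<sigma> p \<le> Suc i}" using p(1) pk by simp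
      then have "Suc p \<le> p" unfolding p_def using fin by (intro Max_ge)
      then show False by simp
    qed
  qed
  have "full \<sigma> p (\<sigma> p)" "full \<sigma> (Suc p) (\<sigma> (Suc p))" using p(1) full_less[of p] full_less[of "Suc p"] by simp_all
  moreover have "\<sigma> (Suc p) < B" using s(1) p(1) by (simp add: assigns_def num_coords_def)
  ultimately have "\<exists>p < Suc k. \<exists>a < Suc i. full \<sigma> p a \<and> (\<exists>b < B. Suc i < b \<and> full \<sigma> (Suc p) b)"
    using p(1) lt gt by (intro exI[of _ p] exI[of _ "\<sigma> p"] exI[of _ "\<sigma> (Suc p)"] conjI) simp_all
  then show ?thesis using n False unfolding input_val_def by simp
qed

lemma ev_step_small:
  assumes i: "i < m" "tg i = 0 \<or> tg i = 1 \<or> ln i = 2"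
    and e: "\<And>j. j < ln i \<Longrightarrow> ev (full \<sigma>) h (ch i j) (2 * x + j) = (if truth a (ch i j) then 2 else 0)"
  shows "ev (full \<sigma>) (Suc h) i x = (if truth a i then 2 else 0)"
proof -
  consider "tg i = 0" | "tg i = 1" | "tg i \<noteq> 0" "tg i \<noteq> 1" "ln i = 2"
    using i(2) by (cases "tg i = 0"; cases "tg i = 1") auto
  then show ?thesis
  proof cases
    case 1
    then show ?thesis using input_val_full[OF i(1)] truth_eq[OF i(1), of a] by simp
  next
    case 2
    then show ?thesis using e[of 0] ln_Neg[of i] truth_eq[OF i(1), of a] by simp
  next
    case 3
    have e0: "ev (full \<sigma>) h (ch i 0) (2 * x) = (if truth a (ch i 0) then 2 else 0)" using e[of 0] 3 by simp
    have e1: "ev (full \<sigma>) h (ch i 1) (2 * x + 1) = (if truth a (ch i 1) then 2 else 0)" using e[of 1] 3 by simp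
    have "ev (full \<sigma>) (Suc h) i x = (if tg i = 2 then
          (if ev (full \<sigma>) h (ch i 0) (2 * x) \<le> ev (full \<sigma>) h (ch i 1) (2 * x + 1) then ev (full \<sigma>) h (ch i 0) (2 * x)
           else ev (full \<sigma>) h (ch i 1) (2 * x + 1))
        else (if ev (full \<sigma>) h (ch i 0) (2 * x) \<le> ev (full \<sigma>) h (ch i 1) (2 * x + 1) then ev (full \<sigma>) h (ch i 1) (2 * x + 1)
           else ev (full \<sigma>) h (ch i 0) (2 * x)))"
      using 3 by simp
    then show ?thesis unfolding e0 e1 truth_two[OF i(1) 3] by simp
  qed
qed

text \<open>Below a large gate all gates are small, so no guess is read and the address
  \<open>x\<close> is arbitrary. The absence of a chain of length \<open>h\<close> ensures that the
  inputs are reached before the levels run out; for level 0 it is contradictory.\<close>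

lemma ev_bottom:
  "i < m \<Longrightarrow> \<not> chain h i \<Longrightarrow> \<not> large_within h i \<Longrightarrow> ev (full \<sigma>) h i x = (if truth a i then 2 else 0)"
proof (induction h arbitrary: i x)
  case (Suc h)
  have "ln i \<le> 2" using Suc.prems by auto
  then show ?case
  proof (intro ev_step_small[OF Suc.prems(1) small_iff[OF Suc.prems(1)]])
    fix j assume "j < ln i"
    then show "ev (full \<sigma>) h (ch i j) (2 * x + j) = (if truth a (ch i j) then 2 else 0)"
      using Suc.prems by (intro Suc.IH ch_less_m) auto
  qed
qed simp

text \<open>At a large gate \<open>ev\<close> trusts the guess, and the absence of wrong witnesses
  justifies it: the children have exact values by \<open>ev_bottom\<close>, because weft 1 forbids
  large gates below them.\<close>

lemma ev_top:
  "i < m \<Longrightarrow> \<not> chain h i \<Longrightarrow> \<not> two_large_within h i \<Longrightarrow> Suc x * 2 ^ h \<le> 2 ^ (d + 2) \<Longrightarrow>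
    \<not> wrong_witness (full \<sigma>) h i x \<Longrightarrow> ev (full \<sigma>) h i x = (if truth a i then 2 else 0)"
proof (induction h arbitrary: i x)
  case (Suc h)
  show ?case
  proof (cases "ln i \<le> 2")
    case True
    note small = small_iff[OF Suc.prems(1) True]
    show ?thesis
    proof (rule ev_step_small[OF Suc.prems(1) small])
      fix j assume j: "j < ln i"
      have j01: "j = 0 \<or> j = 1" using j True by auto
      have "Suc (2 * x + j) * 2 ^ h \<le> Suc x * 2 ^ Suc h"
        using j01 by (auto simp: algebra_simps)
      then have b: "Suc (2 * x + j) * 2 ^ h \<le> 2 ^ (d + 2)" using Suc.prems(4) by (rule le_trans)
      have "tg i \<noteq> 0" using j ln_Input[of i] by auto
      then have "\<not> wrong_witness (full \<sigma>) h (ch i j) (2 * x + j)"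
        using Suc.prems(5) small j j01 ln_Neg[of i] by (cases "tg i = 1") auto
      then show "ev (full \<sigma>) h (ch i j) (2 * x + j) = (if truth a (ch i j) then 2 else 0)"
        using Suc.prems(2,3) j b by (intro Suc.IH ch_less_m[OF Suc.prems(1)]) auto
    qed
  next
    case False
    then have t: "tg i \<noteq> 0" "tg i \<noteq> 1" "ln i \<noteq> 2" using ln_Input[of i] ln_Neg[of i] by auto
    have c: "ev (full \<sigma>) h (ch i j) 0 = (if truth a (ch i j) then 2 else 0)" if "j < ln i" for j
      using that Suc.prems False by (intro ev_bottom ch_less_m) auto
    have lt: "k + 2 + x < num_coords" using coord_less[OF s Suc.prems(4)] .
    have f: "full \<sigma> (k + 2 + x) v \<longleftrightarrow> v = \<sigma> (k + 2 + x)" for v using lt by (simp add: full_def)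
    have w: "\<not> (\<sigma> (k + 2 + x) = 0 \<and> (\<exists>j < ln i. ev (full \<sigma>) h (ch i j) 0 = (if tg i = 2 then 0 else 2)))"
      "\<not> (\<exists>j < B. Suc j = \<sigma> (k + 2 + x) \<and> (ln i \<le> j \<or> ev (full \<sigma>) h (ch i j) 0 = (if tg i = 2 then 2 else 0)))"
      using Suc.prems(5) t unfolding wrong_witness.simps f by auto
    show ?thesis
    proof (cases "\<sigma> (k + 2 + x)")
      case 0
      then have "ev (full \<sigma>) (Suc h) i x = (if tg i = 2 then 2 else 0)" using t f[of 0] by simp
      moreover have "truth a i \<longleftrightarrow> tg i = 2"
        using w(1) c t 0 unfolding truth_eq[OF Suc.prems(1), of a] by (auto split: if_splits)
      ultimately show ?thesis by simp
    next
      case (Suc j)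
      have "\<sigma> (k + 2 + x) < B" using s(1) lt by (simp add: assigns_def)
      then have j: "j < B" using Suc by simp
      then have "\<not> (ln i \<le> j \<or> ev (full \<sigma>) h (ch i j) 0 = (if tg i = 2 then 2 else 0))" using w(2) Suc by metis
      then have jl: "j < ln i" and tr: "truth a (ch i j) \<longleftrightarrow> tg i \<noteq> 2" using c[of j] by (auto split: if_splits)
      have "\<exists>j < B. full \<sigma> (k + 2 + x) (Suc j)" using j f[of "Suc j"] Suc by auto
      moreover have "\<not> full \<sigma> (k + 2 + x) 0" using f[of 0] Suc by simp
      ultimately have "ev (full \<sigma>) (Suc h) i x = (if tg i = 2 then 0 else 2)" using t by simp
      moreover have "truth a i \<longleftrightarrow> tg i \<noteq> 2"
        using jl tr t unfolding truth_eq[OF Suc.prems(1), of a] by auto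
      ultimately show ?thesis by simp
    qed
  qed
qed simp

end

end

section \<open>Truthful guesses for a satisfying assignment\<close>

context circuit_view
begin

text \<open>Reads the binary digits after the leading 1 as choices of a child. Different addresses
  may lead to the same gate, which is harmless as the truthful guess depends on the gate
  only.\<close>

fun gate_at :: "nat \<Rightarrow> nat" where
  "gate_at n = (if n \<le> 1 then m - 1 else ch (gate_at (n div 2)) (n mod 2))"

declare gate_at.simps [simp del]

lemma gate_at_1: "gate_at 1 = m - 1"
  by (simp add: gate_at.simps)

lemma gate_at_child: "0 < x \<Longrightarrow> j < 2 \<Longrightarrow> gate_at (2 * x + j) = ch (gate_at x) j"
  by (subst gate_at.simps) auto

definition witness :: "(nat \<Rightarrow> bool) \<Rightarrow> nat \<Rightarrow> nat" where
  "witness a i = (if tg i = 2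
     then if \<forall>j < ln i. truth a (ch i j) then 0 else Suc (LEAST j. j < ln i \<and> \<not> truth a (ch i j))
     else if \<exists>j < ln i. truth a (ch i j) then Suc (LEAST j. j < ln i \<and> truth a (ch i j)) else 0)"

lemma witness_0:
  "witness a i = 0 \<Longrightarrow> j < ln i \<Longrightarrow> truth a (ch i j) \<longleftrightarrow> tg i = 2"
  by (auto simp: witness_def split: if_splits)

lemma witness_Suc:
  assumes "witness a i = Suc j"
  shows "j < ln i \<and> (truth a (ch i j) \<longleftrightarrow> tg i \<noteq> 2)"
proof (cases "tg i = 2")
  case True
  then have ex: "\<exists>j. j < ln i \<and> \<not> truth a (ch i j)" and j: "j = (LEAST j. j < ln i \<and> \<not> truth a (ch i j))"
    using assms by (auto simp: witness_def split: if_splits)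
  from LeastI_ex[OF ex] show ?thesis using True unfolding j by blast
next
  case False
  then have ex: "\<exists>j. j < ln i \<and> truth a (ch i j)" and j: "j = (LEAST j. j < ln i \<and> truth a (ch i j))"
    using assms by (auto simp: witness_def split: if_splits)
  from LeastI_ex[OF ex] show ?thesis using False unfolding j by blast
qed

lemma witness_less: "i < m \<Longrightarrow> witness a i < B"
  using witness_Suc[of a i "witness a i - 1"] ln_le[of i] B by (cases "witness a i") auto

text \<open>Truthful guesses are never refuted, since the children of a large gate evaluate exactly
  by \<open>ev_bottom\<close>. The address has to be positive for \<open>gate_at\<close> to follow
  the children.\<close>

lemma no_wrong_witness:
  assumes s: "assigns \<sigma>" "\<not> wrong_selection (full \<sigma>)"
    and a: "\<And>i. i < m \<Longrightarrow> tg i = 0 \<Longrightarrow> a i \<longleftrightarrow> (\<exists>p < k. \<sigma> (Suc p) = Suc i)"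
    and wit: "\<And>x. gate_at x < m \<Longrightarrow> \<sigma> (k + 2 + x) = witness a (gate_at x)"
  shows "gate_at x < m \<Longrightarrow> 0 < x \<Longrightarrow> \<not> chain h (gate_at x) \<Longrightarrow> \<not> two_large_within h (gate_at x) \<Longrightarrow>
    Suc x * 2 ^ h \<le> 2 ^ (d + 2) \<Longrightarrow> \<not> wrong_witness (full \<sigma>) h (gate_at x) x"
proof (induction h arbitrary: x)
  case (Suc h)
  let ?i = "gate_at x"
  show ?case
  proof (cases "ln ?i \<le> 2")
    case True
    note small = small_iff[OF Suc.prems(1) True]
    have w: "\<not> wrong_witness (full \<sigma>) h (ch ?i j) (2 * x + j)" if j: "j < ln ?i" for j
    proof -
      have j2: "j < 2" using j True by simp
      then have b: "Suc (2 * x + j) * 2 ^ h \<le> Suc x * 2 ^ Suc h"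
        using mult_le_mono1[of "Suc (2 * x + j)" "2 * Suc x" "2 ^ h"] by simp
      have eq: "ch ?i j = gate_at (2 * x + j)" using gate_at_child[OF Suc.prems(2) j2] by simp
      show ?thesis
        unfolding eq
      proof (rule Suc.IH)
        show "gate_at (2 * x + j) < m" using ch_less_m[OF Suc.prems(1) j] eq by simp
        show "0 < 2 * x + j" using Suc.prems(2) by simp
        show "\<not> chain h (gate_at (2 * x + j))" using Suc.prems(3) j unfolding eq[symmetric] by auto
        show "\<not> two_large_within h (gate_at (2 * x + j))" using Suc.prems(4) j unfolding eq[symmetric] by auto
        show "Suc (2 * x + j) * 2 ^ h \<le> 2 ^ (d + 2)" using b Suc.prems(5) by (rule le_trans)
      qed
    qed
    consider "tg ?i = 0" | "tg ?i = 1" | "tg ?i \<noteq> 0" "tg ?i \<noteq> 1" "ln ?i = 2"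
      using small by (cases "tg ?i = 0"; cases "tg ?i = 1") auto
    then show ?thesis
    proof cases
      case 1
      then show ?thesis by simp
    next
      case 2
      then show ?thesis using w[of 0] ln_Neg[of ?i] by simp
    next
      case 3
      then show ?thesis using w[of 0] w[of 1] by simp
    qed
  next
    case False
    then have t: "tg ?i \<noteq> 0" "tg ?i \<noteq> 1" "ln ?i \<noteq> 2" using ln_Input[of ?i] ln_Neg[of ?i] by auto
    have c: "ev (full \<sigma>) h (ch ?i j) 0 = (if truth a (ch ?i j) then 2 else 0)" if j: "j < ln ?i" for j
    proof (rule ev_bottom[OF s a])
      show "ch ?i j < m" using ch_less_m[OF Suc.prems(1) j] .
      show "\<not> chain h (ch ?i j)" using Suc.prems(3) j by auto
      show "\<not> large_within h (ch ?i j)" using Suc.prems(4) j False by auto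
    qed
    have f: "full \<sigma> (k + 2 + x) v \<Longrightarrow> v = witness a ?i" for v
      using wit[OF Suc.prems(1)] by (simp add: full_def)
    have 1: "\<not> (full \<sigma> (k + 2 + x) 0 \<and> (\<exists>j < ln ?i. ev (full \<sigma>) h (ch ?i j) 0 = (if tg ?i = 2 then 0 else 2)))"
    proof
      assume "full \<sigma> (k + 2 + x) 0 \<and> (\<exists>j < ln ?i. ev (full \<sigma>) h (ch ?i j) 0 = (if tg ?i = 2 then 0 else 2))"
      then obtain j where "witness a ?i = 0" "j < ln ?i" "ev (full \<sigma>) h (ch ?i j) 0 = (if tg ?i = 2 then 0 else 2)"
        using f[of 0] by auto
      then show False using witness_0[of a ?i j] c[of j] by (auto split: if_splits)
    qed
    have 2: "\<not> (full \<sigma> (k + 2 + x) (Suc j) \<and> (ln ?i \<le> j \<or> ev (full \<sigma>) h (ch ?i j) 0 = (if tg ?i = 2 then 2 else 0)))" for j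
    proof
      assume *: "full \<sigma> (k + 2 + x) (Suc j) \<and> (ln ?i \<le> j \<or> ev (full \<sigma>) h (ch ?i j) 0 = (if tg ?i = 2 then 2 else 0))"
      then have "witness a ?i = Suc j" using f[of "Suc j"] by simp
      from witness_Suc[OF this] show False using * c[of j] by (auto split: if_splits)
    qed
    show ?thesis unfolding wrong_witness.simps using t 1 2 by auto
  qed
qed simp

theorem weighted_sat_iff:
  assumes depth: "\<not> chain (Suc d) (m - 1)" and weft: "\<not> two_large_within (Suc d) (m - 1)"
  shows "(\<exists>a. weight a C = k \<and> satisfies a C) \<longleftrightarrow> (\<exists>\<sigma>. assigns \<sigma> \<and> \<not> violated (full \<sigma>))"
proof
  have m1: "m - 1 < m" using m_pos by simp
  have root: "Suc 1 * 2 ^ Suc d \<le> (2::nat) ^ (d + 2)" by simp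
  {
    assume "\<exists>\<sigma>. assigns \<sigma> \<and> \<not> violated (full \<sigma>)"
    then obtain \<sigma> where \<sigma>: "assigns \<sigma>" "\<not> violated (full \<sigma>)" by blast
    then have nv: "\<not> wrong_selection (full \<sigma>) \<and> ev (full \<sigma>) (Suc d) (m - 1) 1 \<noteq> 0 \<and>
        \<not> wrong_witness (full \<sigma>) (Suc d) (m - 1) 1"
      unfolding violated_def by (simp only: de_Morgan_disj simp_thms)
    note s = \<sigma>(1) conjunct1[OF nv]
    note e = conjunct1[OF conjunct2[OF nv]] and w = conjunct2[OF conjunct2[OF nv]]
    define a where "a i \<longleftrightarrow> (\<exists>p < k. \<sigma> (Suc p) = Suc i)" for i
    have "ev (full \<sigma>) (Suc d) (m - 1) 1 = (if truth a (m - 1) then 2 else 0)"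
      by (rule ev_top[OF s _ m1 depth weft root w]) (simp add: a_def)
    then have "truth a (m - 1)" using e by presburger
    moreover have "weight a C = k"
    proof -
      have sel: "0 < \<sigma> (Suc p) \<and> \<sigma> (Suc p) \<le> m \<and> tg (\<sigma> (Suc p) - 1) = 0" if "p < k" for p
        using not_wrong_selectionD(3)[OF s that] .
      have "{i. i < length C \<and> C ! i = Input \<and> a i} = (\<lambda>p. \<sigma> (Suc p) - 1) ` {..<k}"
      proof (intro set_eqI iffI)
        fix i assume "i \<in> {i. i < length C \<and> C ! i = Input \<and> a i}"
        then obtain p where "p < k" "\<sigma> (Suc p) = Suc i" by (auto simp: a_def)
        then show "i \<in> (\<lambda>p. \<sigma> (Suc p) - 1) ` {..<k}" by force
      next
        fix i assume "i \<in> (\<lambda>p. \<sigma> (Suc p) - 1) ` {..<k}"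
        then obtain p where p: "p < k" "i = \<sigma> (Suc p) - 1" by blast
        then have "\<sigma> (Suc p) = Suc i" "i < m" "tg i = 0" using sel[OF p(1)] by auto
        then show "i \<in> {i. i < length C \<and> C ! i = Input \<and> a i}"
          using p(1) m Input_iff[of i] by (auto simp: a_def)
      qed
      \<comment> \<open>A strictly increasing list names \<open>k\<close> different inputs, so the
        weight is exactly \<open>k\<close>.\<close>
      moreover have "inj_on (\<lambda>p. \<sigma> (Suc p) - 1) {..<k}"
      proof (rule linorder_inj_onI)
        fix p p' assume p: "p < p'" "p \<in> {..<k}" "p' \<in> {..<k}"
        then have "\<sigma> (Suc p) < \<sigma> (Suc p')" by (intro selection_mono[OF s]) auto
        then show "\<sigma> (Suc p) - 1 \<noteq> \<sigma> (Suc p') - 1" using sel[of p] p(2) by auto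
      qed auto
      ultimately show ?thesis unfolding weight_def by (simp add: card_image)
    qed
    ultimately show "\<exists>a. weight a C = k \<and> satisfies a C" using satisfies_iff by blast
  }
  {
    assume "\<exists>a. weight a C = k \<and> satisfies a C"
    then obtain a where a: "weight a C = k" "satisfies a C" by blast
    define S where "S = {i. i < m \<and> C ! i = Input \<and> a i}"
    define xs where "xs = sorted_list_of_set S"
    have fin: "finite S" by (simp add: S_def)
    have len: "length xs = k" using a(1) unfolding xs_def S_def weight_def m by simp
    have set: "set xs = S" using fin by (simp add: xs_def)
    have sorted: "xs ! p < xs ! p'" if "p < p'" "p' < k" for p p'
      using strict_sorted_list_of_set[of S] that len unfolding xs_def
      by (simp add: sorted_wrt_nth_less)
    have xs: "xs ! p < m \<and> C ! (xs ! p) = Input \<and> a (xs ! p)" if "p < k" for p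
      using nth_mem[of p xs] that len set by (simp add: S_def)
    \<comment> \<open>The increasing enumeration of the true inputs, shifted by one and framed by
      the sentinels, then the truthful guesses. Coordinates whose address gives no gate of the
      circuit get 0 as a default.\<close>
    define \<sigma> where "\<sigma> r = (if r = 0 then 0 else if r \<le> k then Suc (xs ! (r - 1)) else if r = Suc k then Suc m
      else if gate_at (r - k - 2) < m then witness a (gate_at (r - k - 2)) else 0)" for r
    have \<sigma>0: "\<sigma> 0 = 0" by (simp add: \<sigma>_def)
    have \<sigma>S: "\<sigma> (Suc p) = Suc (xs ! p)" if "p < k" for p using that by (simp add: \<sigma>_def)
    have \<sigma>k: "\<sigma> (Suc k) = Suc m" by (simp add: \<sigma>_def)
    have \<sigma>w: "\<sigma> (k + 2 + x) = witness a (gate_at x)" if "gate_at x < m" for x using that by (simp add: \<sigma>_def)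
    have s1: "assigns \<sigma>"
      unfolding assigns_def
    proof (intro allI impI)
      fix r
      have "Suc (xs ! (r - 1)) < B" if r: "r \<noteq> 0" "r \<le> k"
      proof -
        have "r - 1 < k" using r by simp
        from xs[OF this] show ?thesis using B by simp
      qed
      then show "\<sigma> r < B"
        using B witness_less[of "gate_at (r - k - 2)" a]
        unfolding \<sigma>_def by simp
    qed
    have s2: "\<not> wrong_selection (full \<sigma>)"
    proof -
      have f: "v = \<sigma> r" if "full \<sigma> r v" for r v using that by (simp add: full_def)
      have 1: "v = 0" if "full \<sigma> 0 v" for v using f[OF that] \<sigma>0 by simp
      have 2: "v = Suc m" if "full \<sigma> (Suc k) v" for v using f[OF that] \<sigma>k by simp
      have 3: "\<not> (v = 0 \<or> m < v \<or> tg (v - 1) \<noteq> 0)" if "p < k" "full \<sigma> (Suc p) v" for p v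
        using f[OF that(2)] \<sigma>S[OF that(1)] xs[OF that(1)] Input_iff[of "xs ! p"] by auto
      have 4: "v < v'" if "p < Suc k" "full \<sigma> p v" "full \<sigma> (Suc p) v'" for p v v'
      proof -
        have v: "v = \<sigma> p" "v' = \<sigma> (Suc p)" using f that by blast+
        have v': "v' = Suc m \<and> p = k \<or> v' = Suc (xs ! p) \<and> p < k"
          using v(2) \<sigma>S[of p] \<sigma>k that(1) by (cases "p = k") auto
        show ?thesis
        proof (cases p)
          case 0
          then show ?thesis using v(1) v' \<sigma>0 by auto
        next
          case (Suc p0)
          then have "v = Suc (xs ! p0)" "p0 < k" using v(1) \<sigma>S[of p0] that(1) by auto
          then show ?thesis using v' xs[of p0] sorted[of p0 p] Suc by auto
        qed
      qed
      show ?thesis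
      proof
        assume "wrong_selection (full \<sigma>)"
        then consider v where "full \<sigma> 0 v" "v \<noteq> 0" | v where "full \<sigma> (Suc k) v" "v \<noteq> Suc m"
          | p v where "p < k" "full \<sigma> (Suc p) v" "v = 0 \<or> m < v \<or> tg (v - 1) \<noteq> 0"
          | p v v' where "p < Suc k" "full \<sigma> p v" "full \<sigma> (Suc p) v'" "v' \<le> v"
          unfolding wrong_selection_def by blast
        then show False
        proof cases
          case c: (1 v)
          from 1[OF c(1)] c(2) show False by simp
        next
          case c: (2 v)
          from 2[OF c(1)] c(2) show False by simp
        next
          case c: (3 p v)
          from 3[OF c(1,2)] c(3) show False by blast
        next
          case c: (4 p v v')
          from 4[OF c(1-3)] c(4) show False by simp
        qed
      qed
    qed
    have asel: "a i \<longleftrightarrow> (\<exists>p < k. \<sigma> (Suc p) = Suc i)" if "i < m" "tg i = 0" for i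
    proof -
      have "a i \<longleftrightarrow> i \<in> set xs" using that Input_iff[of i] set by (simp add: S_def)
      also have "\<dots> \<longleftrightarrow> (\<exists>p < k. xs ! p = i)" using len by (simp add: in_set_conv_nth)
      also have "\<dots> \<longleftrightarrow> (\<exists>p < k. \<sigma> (Suc p) = Suc i)" using \<sigma>S by auto
      finally show ?thesis .
    qed
    have w: "\<not> wrong_witness (full \<sigma>) (Suc d) (m - 1) 1"
      using no_wrong_witness[OF s1 s2 asel \<sigma>w, of 1 "Suc d"] m1 depth weft root
      unfolding gate_at_1 by (simp del: wrong_witness.simps chain.simps two_large_within.simps)
    have "ev (full \<sigma>) (Suc d) (m - 1) 1 = (if truth a (m - 1) then 2 else 0)"
      by (rule ev_top[OF s1 s2 asel m1 depth weft root w])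
    then have "ev (full \<sigma>) (Suc d) (m - 1) 1 \<noteq> 0" using a(2) satisfies_iff by simp
    moreover have "b = b'" if "full \<sigma> r b" "full \<sigma> r b'" for r b b' using that by (simp add: full_def)
    ultimately have "\<not> violated (full \<sigma>)" using s2 w unfolding violated_def by blast
    then show "\<exists>\<sigma>. assigns \<sigma> \<and> \<not> violated (full \<sigma>)" using s1 by blast
  }
qed

end

section \<open>From binary constraints to Maximum Happy Edges\<close>

text \<open>Splits off the last digit in a mixed radix system. Repeated use turns the sum over
  component numbers into a sum over their five digits.\<close>

lemma sum_div_mod:
  fixes f :: "nat \<Rightarrow> nat \<Rightarrow> nat"
  shows "(\<Sum>j<a * b. f (j div b) (j mod b)) = (\<Sum>i<a. \<Sum>k<b. f i k)"
proof -
  have "(\<Sum>k<b. f i k) = (\<Sum>j = i * b..<i * b + b. f (j div b) (j mod b))" for i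
  proof (rule sum.reindex_bij_witness[of _ "\<lambda>j. j - i * b" "\<lambda>k. i * b + k"])
    fix j assume "j \<in> {i * b..<i * b + b}"
    then show "j - i * b \<in> {..<b}" by auto
  qed auto
  then show ?thesis by (simp add: sum.nat_group)
qed

locale gadget =
  fixes tri :: bool and q V :: nat and bad :: "nat \<Rightarrow> nat \<Rightarrow> nat \<Rightarrow> nat \<Rightarrow> bool"
begin

definition Z :: nat where "Z = 2 * V + 1"
definition J :: nat where "J = q * V * q * V * Z"
definition n :: nat where "n = q + 3 * J"

text \<open>The component \<open>j\<close> is a gadget for the value \<open>cv j\<close> of the variable \<open>cx j\<close> and the value \<open>cu j\<close> of \<open>cy j\<close>, with
  the number \<open>cz j < Z\<close> of the copy.\<close>

definition cz :: "nat \<Rightarrow> nat" where "cz j = j mod Z"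
definition cu :: "nat \<Rightarrow> nat" where "cu j = j div Z mod V"
definition cy :: "nat \<Rightarrow> nat" where "cy j = j div Z div V mod q"
definition cv :: "nat \<Rightarrow> nat" where "cv j = j div Z div V div q mod V"
definition cx :: "nat \<Rightarrow> nat" where "cx j = j div Z div V div q div V"

definition active :: "nat \<Rightarrow> bool" where "active j \<longleftrightarrow> cx j < cy j"
text \<open>Only copy 0 of a forbidden pair becomes the punishing gadget, which is enough to lose
  one edge. The other \<open>2 * V\<close> copies keep rewarding colors of the domains, so that
  leaving a domain does not pay.\<close>

definition conflict :: "nat \<Rightarrow> bool" where
  "conflict j \<longleftrightarrow> active j \<and> cz j = 0 \<and> bad (cx j) (cv j) (cy j) (cu j)"

definition left_color :: "nat \<Rightarrow> nat" where "left_color j = Suc (cx j * V + cv j)"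
definition right_color :: "nat \<Rightarrow> nat" where
  "right_color j = (if active j then Suc (cy j * V + cu j) else Suc (q * V))"

text \<open>Color 0 stands for an uncolored vertex.  If \<open>cx j < cy j\<close> fails, the component has no edge to the variables; its
  right vertex gets the spare color \<open>Suc (q * V)\<close> so that exactly one of its edges is happy.\<close>

definition precolor :: "nat \<Rightarrow> nat" where
  "precolor p = (if p < q then 0
     else if (p - q) mod 3 = 0 then left_color ((p - q) div 3)
     else if (p - q) mod 3 = 1 then (if conflict ((p - q) div 3) then 0 else left_color ((p - q) div 3))
     else right_color ((p - q) div 3))"

definition adj :: "nat \<Rightarrow> nat \<Rightarrow> bool" where
  "adj p t \<longleftrightarrow> q \<le> p \<and> t < p \<and>
     (if t < q then
        (if conflict ((p - q) div 3)
         then (p - q) mod 3 = 1 \<and> (t = cx ((p - q) div 3) \<or> t = cy ((p - q) div 3))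
         else active ((p - q) div 3) \<and>
           ((p - q) mod 3 = 0 \<and> t = cx ((p - q) div 3) \<or> (p - q) mod 3 = 2 \<and> t = cy ((p - q) div 3)))
      else (t - q) div 3 = (p - q) div 3 \<and>
        ((p - q) mod 3 = 1 \<and> (t - q) mod 3 = 0 \<or> (p - q) mod 3 = 2 \<and> (t - q) mod 3 = 1 \<or>
         tri \<and> (p - q) mod 3 = 2 \<and> (t - q) mod 3 = 0))"

definition edges :: "nat set set" where
  "edges = {{p, t} | p t. p < n \<and> adj p t}"

text \<open>The most that the components of \<open>x\<close> and \<open>y\<close> can contribute:
  one edge for each of the \<open>V * V * Z\<close> components and, for \<open>x < y\<close>, one
  more for each of the \<open>V * Z\<close> components that match the value of \<open>x\<close>, and
  as many for \<open>y\<close>.\<close>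

definition pair_value :: "nat \<Rightarrow> nat \<Rightarrow> nat" where
  "pair_value x y = V * V * Z + (if x < y then 2 * Z * V else 0)"

definition goal :: nat where
  "goal = (\<Sum>x<q. \<Sum>y<q. pair_value x y)"

definition inst :: "nat \<Rightarrow> mhe_instance" where
  "inst T = \<lparr> graph = ({0..<n}, edges), colors = Suc (q * V),
     precoloring = (\<lambda>p. if p < n \<and> precolor p \<noteq> 0 then Some (precolor p) else None), target = int T \<rparr>"

lemma inst_sel: "graph (inst T) = ({0..<n}, edges)" "target (inst T) = int T"
  by (simp_all add: inst_def)

lemma sum_components:
  fixes f :: "nat \<Rightarrow> nat \<Rightarrow> nat \<Rightarrow> nat \<Rightarrow> nat \<Rightarrow> nat"
  shows "(\<Sum>j<J. f (cx j) (cv j) (cy j) (cu j) (cz j)) =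
    (\<Sum>x<q. \<Sum>y<q. \<Sum>v<V. \<Sum>u<V. \<Sum>z<Z. f x v y u z)"
proof -
  have "(\<Sum>j<J. f (cx j) (cv j) (cy j) (cu j) (cz j)) =
      (\<Sum>x<q. \<Sum>v<V. \<Sum>y<q. \<Sum>u<V. \<Sum>z<Z. f x v y u z)"
    unfolding J_def cx_def cv_def cy_def cu_def cz_def
    by (simp only: sum_div_mod[where f = "\<lambda>i k. f (i div V div q div V) (i div V div q mod V) (i div V mod q) (i mod V) k"]
        sum_div_mod[where f = "\<lambda>i k. \<Sum>z<Z. f (i div q div V) (i div q mod V) (i mod q) k z"]
        sum_div_mod[where f = "\<lambda>i k. \<Sum>u<V. \<Sum>z<Z. f (i div V) (i mod V) k u z"]
        sum_div_mod[where f = "\<lambda>i k. \<Sum>y<q. \<Sum>u<V. \<Sum>z<Z. f i k y u z"])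
  also have "\<dots> = (\<Sum>x<q. \<Sum>y<q. \<Sum>v<V. \<Sum>u<V. \<Sum>z<Z. f x v y u z)"
    by (rule sum.cong[OF refl], rule sum.swap)
  finally show ?thesis .
qed

lemma component_less:
  assumes "j < J"
  shows "cx j < q" "cv j < V" "cy j < q" "cu j < V"
proof -
  have pos: "0 < q" "0 < V" using assms unfolding J_def by (metis gr0I mult_0 mult_0_right not_less_zero)+
  then show "cv j < V" "cy j < q" "cu j < V" by (simp_all add: cv_def cy_def cu_def)
  have "j div Z < q * V * q * V" using assms unfolding J_def by (simp add: less_mult_imp_div_less)
  then have "j div Z div V < q * V * q" by (simp add: less_mult_imp_div_less)
  then have "j div Z div V div q < q * V" by (simp add: less_mult_imp_div_less)
  then show "cx j < q" by (simp add: cx_def less_mult_imp_div_less)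
qed

lemma color_inj:
  assumes "v < V" "u < V" "x * V + v = y * V + u"
  shows "x = y \<and> v = u"
proof -
  have "(x * V + v) div V = x" "(y * V + u) div V = y" "(x * V + v) mod V = v" "(y * V + u) mod V = u"
    using assms(1,2) by simp_all
  then show ?thesis using assms(3) by metis
qed

lemma color_le: "x < q \<Longrightarrow> v < V \<Longrightarrow> x * V + v < q * V"
proof -
  assume "x < q" "v < V"
  then have "x * V + v < Suc x * V" by simp
  also have "\<dots> \<le> q * V" using \<open>x < q\<close> by (intro mult_le_mono1) simp
  finally show ?thesis .
qed

text \<open>Keeps the third edge of a triangle unhappy, so that paths and triangles give equal
  counts, and lets a free middle vertex agree with at most one of its precolored neighbours.\<close>

lemma left_neq_right:
  assumes j: "j < J"
  shows "left_color j \<noteq> right_color j"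
proof (cases "active j")
  case True
  then have "cx j \<noteq> cy j" by (simp add: active_def)
  then show ?thesis
    using color_inj[OF component_less(2,4)[OF j], of "cx j" "cy j"] True
    by (auto simp: left_color_def right_color_def)
next
  case False
  then show ?thesis using color_le[OF component_less(1,2)[OF j]]
    by (simp add: left_color_def right_color_def)
qed

definition va :: "nat \<Rightarrow> nat" where "va j = q + 3 * j"
definition vb :: "nat \<Rightarrow> nat" where "vb j = q + 3 * j + 1"
definition vc :: "nat \<Rightarrow> nat" where "vc j = q + 3 * j + 2"

definition inner_edges :: "nat \<Rightarrow> nat set set" where
  "inner_edges j = {{va j, vb j}, {vb j, vc j}} \<union> (if tri then {{va j, vc j}} else {})"

definition outer_edges :: "nat \<Rightarrow> nat set set" where
  "outer_edges j = (if conflict j then {{vb j, cx j}, {vb j, cy j}}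
     else if active j then {{va j, cx j}, {vc j, cy j}} else {})"

lemma vertex_cases:
  assumes "q \<le> p"
  obtains "p = va ((p - q) div 3)" "(p - q) mod 3 = 0"
    | "p = vb ((p - q) div 3)" "(p - q) mod 3 = 1"
    | "p = vc ((p - q) div 3)" "(p - q) mod 3 = 2"
proof -
  have "3 * ((p - q) div 3) + (p - q) mod 3 = p - q" by simp
  then have p: "p = q + 3 * ((p - q) div 3) + (p - q) mod 3" using assms by linarith
  have "(p - q) mod 3 = 0 \<or> (p - q) mod 3 = 1 \<or> (p - q) mod 3 = 2" by linarith
  then show ?thesis
  proof (elim disjE)
    assume h: "(p - q) mod 3 = 0"
    show ?thesis by (rule that(1)[OF _ h]) (use p h in \<open>simp only: va_def\<close>)
  next
    assume h: "(p - q) mod 3 = 1"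
    show ?thesis by (rule that(2)[OF _ h]) (use p h in \<open>simp only: vb_def\<close>)
  next
    assume h: "(p - q) mod 3 = 2"
    show ?thesis by (rule that(3)[OF _ h]) (use p h in \<open>simp only: vc_def\<close>)
  qed
qed

lemma vertex_simps [simp]:
  "(va j - q) div 3 = j" "(vb j - q) div 3 = j" "(vc j - q) div 3 = j"
  "(va j - q) mod 3 = 0" "(vb j - q) mod 3 = 1" "(vc j - q) mod 3 = 2"
  "q \<le> va j" "q \<le> vb j" "q \<le> vc j"
  "va j < n \<longleftrightarrow> j < J" "vb j < n \<longleftrightarrow> j < J" "vc j < n \<longleftrightarrow> j < J"
  "va j \<noteq> vb j" "va j \<noteq> vc j" "vb j \<noteq> vc j" "vb j \<noteq> va j" "vc j \<noteq> va j" "vc j \<noteq> vb j"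
  "va j < vb j" "va j < vc j" "vb j < vc j"
proof -
  have "(3 * j + 2) mod 3 = (2::nat)" by presburger
  then show "(vc j - q) mod 3 = 2" by (simp add: vc_def)
qed (auto simp: va_def vb_def vc_def n_def)

lemma edges_eq: "edges = (\<Union>j<J. inner_edges j \<union> outer_edges j)"
proof (intro set_eqI iffI)
  fix e assume "e \<in> edges"
  then obtain p t where e: "e = {p, t}" and p: "p < n" and pt: "adj p t" by (auto simp: edges_def)
  define j where "j = (p - q) div 3"
  have qp: "q \<le> p" "t < p" using pt by (simp_all add: adj_def)
  then have j: "j < J" using p unfolding j_def n_def by (intro less_mult_imp_div_less) simp
  have "e \<in> inner_edges j \<union> outer_edges j"
  proof (cases "t < q")
    case True
    have o: "if conflict j then (p - q) mod 3 = 1 \<and> (t = cx j \<or> t = cy j)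
        else active j \<and> ((p - q) mod 3 = 0 \<and> t = cx j \<or> (p - q) mod 3 = 2 \<and> t = cy j)"
      using pt True unfolding adj_def j_def[symmetric] by simp
    show ?thesis
      using qp(1)
    proof (cases rule: vertex_cases)
      case 1
      then show ?thesis using o unfolding e j_def[symmetric] outer_edges_def by (auto split: if_splits)
    next
      case 2
      then show ?thesis using o unfolding e j_def[symmetric] outer_edges_def by (auto split: if_splits)
    next
      case 3
      then show ?thesis using o unfolding e j_def[symmetric] outer_edges_def by (auto split: if_splits)
    qed
  next
    case False
    have i: "(t - q) div 3 = j" "(p - q) mod 3 = 1 \<and> (t - q) mod 3 = 0 \<or> (p - q) mod 3 = 2 \<and> (t - q) mod 3 = 1 \<or>
         tri \<and> (p - q) mod 3 = 2 \<and> (t - q) mod 3 = 0"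
      using pt False unfolding adj_def j_def[symmetric] by simp_all
    have p': "((p - q) mod 3 = 1 \<longrightarrow> p = vb j) \<and> ((p - q) mod 3 = 2 \<longrightarrow> p = vc j)"
      using qp(1) by (cases rule: vertex_cases) (auto simp: j_def)
    have "q \<le> t" using False by simp
    then have t': "((t - q) mod 3 = 0 \<longrightarrow> t = va j) \<and> ((t - q) mod 3 = 1 \<longrightarrow> t = vb j)"
      by (cases rule: vertex_cases) (auto simp: i(1))
    show ?thesis using i(2) p' t' unfolding e inner_edges_def by auto
  qed
  then show "e \<in> (\<Union>j<J. inner_edges j \<union> outer_edges j)" using j by blast
next
  fix e assume "e \<in> (\<Union>j<J. inner_edges j \<union> outer_edges j)"
  then obtain j where j: "j < J" and e: "e \<in> inner_edges j \<or> e \<in> outer_edges j" by blast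
  have c: "cx j < q" "cy j < q" using component_less[OF j] by simp_all
  have lt: "cx j < va j" "cy j < va j" "cx j < vb j" "cy j < vb j" "cx j < vc j" "cy j < vc j"
    using c by (simp_all add: va_def vb_def vc_def)
  have nq: "\<not> va j < q" "\<not> vb j < q" by (simp_all add: va_def vb_def)
  have "\<exists>p t. e = {p, t} \<and> p < n \<and> adj p t"
    using e
  proof
    assume "e \<in> inner_edges j"
    then consider "e = {vb j, va j}" | "e = {vc j, vb j}" | "tri" "e = {vc j, va j}"
      by (auto simp: inner_edges_def split: if_splits)
    then show ?thesis
    proof cases
      case 1
      then show ?thesis using j nq by (intro exI[of _ "vb j"] exI[of _ "va j"]) (simp add: adj_def)
    next
      case 2
      then show ?thesis using j nq by (intro exI[of _ "vc j"] exI[of _ "vb j"]) (simp add: adj_def)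
    next
      case 3
      have "adj (vc j) (va j)"
        unfolding adj_def vertex_simps using nq 3(1) vertex_simps(20)[of j] by simp
      then show ?thesis using 3(2) j by (intro exI[of _ "vc j"] exI[of _ "va j"]) simp
    qed
  next
    assume "e \<in> outer_edges j"
    then consider "conflict j" "e = {vb j, cx j}" | "conflict j" "e = {vb j, cy j}"
      | "\<not> conflict j" "active j" "e = {va j, cx j}" | "\<not> conflict j" "active j" "e = {vc j, cy j}"
      by (auto simp: outer_edges_def split: if_splits)
    then show ?thesis
    proof cases
      case 1
      then show ?thesis using j lt c by (intro exI[of _ "vb j"] exI[of _ "cx j"]) (simp add: adj_def)
    next
      case 2
      then show ?thesis using j lt c by (intro exI[of _ "vb j"] exI[of _ "cy j"]) (simp add: adj_def)
    next
      case 3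
      then show ?thesis using j lt c by (intro exI[of _ "va j"] exI[of _ "cx j"]) (simp add: adj_def)
    next
      case 4
      then show ?thesis using j lt c by (intro exI[of _ "vc j"] exI[of _ "cy j"]) (simp add: adj_def)
    qed
  qed
  then show "e \<in> edges" unfolding edges_def by blast
qed

text \<open>Variables are the smallest vertices, so the largest endpoint of an edge lies in a gadget
  and identifies its component. This makes the edge sets of different components disjoint.\<close>

lemma component_edge_Max:
  assumes j: "j < J" and e: "e \<in> inner_edges j \<union> outer_edges j"
  shows "Max e \<in> {va j, vb j, vc j}"
proof -
  have c: "cx j < q" "cy j < q" using component_less[OF j] by simp_all
  then have "Max {va j, cx j} = va j" "Max {vb j, cx j} = vb j" "Max {vb j, cy j} = vb j" "Max {vc j, cy j} = vc j"
    "Max {va j, vb j} = vb j" "Max {vb j, vc j} = vc j" "Max {va j, vc j} = vc j"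
    by (simp_all add: va_def vb_def vc_def max_def)
  then show ?thesis using e by (auto simp: inner_edges_def outer_edges_def split: if_splits)
qed

lemma component_edges_disjoint:
  assumes "j < J" "j' < J" "j \<noteq> j'"
  shows "(inner_edges j \<union> outer_edges j) \<inter> (inner_edges j' \<union> outer_edges j') = {}"
proof -
  have index: "(p - q) div 3 = i" if "p \<in> {va i, vb i, vc i}" for p i
    using that vertex_simps(1-3)[of i] by blast
  have "False" if "e \<in> inner_edges j \<union> outer_edges j" "e \<in> inner_edges j' \<union> outer_edges j'" for e
    using index[OF component_edge_Max[OF assms(1) that(1)]] index[OF component_edge_Max[OF assms(2) that(2)]]
      assms(3) by simp
  then show ?thesis by blast
qed

section \<open>Counting happy edges component by component\<close>

definition monochromatic :: "(nat \<Rightarrow> nat) \<Rightarrow> nat set \<Rightarrow> bool" where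
  "monochromatic c e \<longleftrightarrow> (\<forall>u \<in> e. \<forall>v \<in> e. c u = c v)"

lemma happy_edges_eq: "happy_edges (S, edges) c = {e \<in> edges. monochromatic c e}"
proof (intro set_eqI iffI)
  fix e assume "e \<in> happy_edges (S, edges) c"
  then obtain u v where "e = {u, v}" "{u, v} \<in> edges" "c u = c v" by (auto simp: happy_edges_def)
  then show "e \<in> {e \<in> edges. monochromatic c e}" by (auto simp: monochromatic_def)
next
  fix e assume e: "e \<in> {e \<in> edges. monochromatic c e}"
  then obtain u v where uv: "e = {u, v}" by (auto simp: edges_def)
  have "{u, v} \<in> snd (S, edges) \<and> c u = c v"
    using e unfolding uv monochromatic_def mem_Collect_eq snd_conv by blast
  then show "e \<in> happy_edges (S, edges) c"
    unfolding happy_edges_def uv mem_Collect_eq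
    by (intro exI[of _ u] exI[of _ v] conjI refl) (elim conjE, assumption)+
qed

definition happy_count :: "(nat \<Rightarrow> nat) \<Rightarrow> nat \<Rightarrow> nat" where
  "happy_count c j = of_bool (c (va j) = c (vb j)) + of_bool (c (vb j) = c (vc j)) +
     of_bool (tri \<and> c (va j) = c (vc j)) +
     (if conflict j then of_bool (c (vb j) = c (cx j)) + of_bool (c (vb j) = c (cy j))
      else if active j then of_bool (c (va j) = c (cx j)) + of_bool (c (vc j) = c (cy j)) else 0)"

lemma card_filter_insert:
  "finite S \<Longrightarrow> e \<notin> S \<Longrightarrow> card {x \<in> insert e S. P x} = of_bool (P e) + card {x \<in> S. P x}"
proof -
  assume "finite S" "e \<notin> S"
  moreover have "{x \<in> insert e S. P x} = (if P e then insert e {x \<in> S. P x} else {x \<in> S. P x})" by auto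
  ultimately show ?thesis by simp
qed

lemma card_filter_2:
  assumes "e \<noteq> e'"
  shows "card {x \<in> {e, e'}. P x} = of_bool (P e) + of_bool (P e')"
  using card_filter_insert[of "{e'}" e P] card_filter_insert[of "{}" e' P] assms
  by (simp only: finite.intros singleton_iff empty_iff not_False_eq_True simp_thms Collect_empty_eq card.empty)
    (simp del: insert_iff)

lemma card_filter_3:
  assumes "e \<noteq> e'" "e \<noteq> e''" "e' \<noteq> e''"
  shows "card {x \<in> {e, e', e''}. P x} = of_bool (P e) + of_bool (P e') + of_bool (P e'')"
proof -
  have n: "e \<notin> {e', e''}" using assms(1,2) by simp
  have "finite {e', e''}" by simp
  from card_filter_insert[OF this n, of P] show ?thesis
    unfolding card_filter_2[OF assms(3)] by (simp only: add.assoc)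
qed

lemma card_mono_component:
  assumes j: "j < J"
  shows "card {e \<in> inner_edges j \<union> outer_edges j. monochromatic c e} = happy_count c j"
proof -
  have c: "cx j < q" "cy j < q" using component_less[OF j] by simp_all
  then have ne: "cx j \<noteq> va j" "cx j \<noteq> vb j" "cx j \<noteq> vc j" "cy j \<noteq> va j" "cy j \<noteq> vb j" "cy j \<noteq> vc j"
    by (simp_all add: va_def vb_def vc_def)
  have act: "cx j \<noteq> cy j" if "active j" using that by (simp add: active_def)
  have act': "active j" if "conflict j" using that by (simp add: conflict_def)
  have m: "monochromatic c {u, v} \<longleftrightarrow> c u = c v" for u v by (auto simp: monochromatic_def)
  have ne3: "{va j, vb j} \<noteq> {vb j, vc j}" "{va j, vb j} \<noteq> {va j, vc j}" "{vb j, vc j} \<noteq> {va j, vc j}"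
    by (simp_all add: doubleton_eq_iff)
  have inner: "card {e \<in> inner_edges j. monochromatic c e} = of_bool (c (va j) = c (vb j)) +
     of_bool (c (vb j) = c (vc j)) + of_bool (tri \<and> c (va j) = c (vc j))"
  proof (cases tri)
    case True
    have "inner_edges j = {{va j, vb j}, {vb j, vc j}, {va j, vc j}}"
      unfolding inner_edges_def if_P[OF True] by blast
    then show ?thesis unfolding card_filter_3[OF ne3, of "monochromatic c", folded \<open>inner_edges j = _\<close>] m
      using True by (simp only: simp_thms)
  next
    case False
    have "inner_edges j = {{va j, vb j}, {vb j, vc j}}"
      unfolding inner_edges_def if_not_P[OF False] by blast
    then show ?thesis unfolding card_filter_2[OF ne3(1), of "monochromatic c", folded \<open>inner_edges j = _\<close>] m
      using False by (simp only: simp_thms of_bool_eq add_0_right)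
  qed
  have outer: "card {e \<in> outer_edges j. monochromatic c e} =
     (if conflict j then of_bool (c (vb j) = c (cx j)) + of_bool (c (vb j) = c (cy j))
      else if active j then of_bool (c (va j) = c (cx j)) + of_bool (c (vc j) = c (cy j)) else 0)"
  proof (cases "conflict j \<or> active j")
    case True
    then have "cx j \<noteq> cy j" using act act' by blast
    then have "{vb j, cx j} \<noteq> {vb j, cy j}" "{va j, cx j} \<noteq> {vc j, cy j}"
      using ne by (simp_all add: doubleton_eq_iff)
    from card_filter_2[OF this(1), of "monochromatic c"] card_filter_2[OF this(2), of "monochromatic c"]
    show ?thesis unfolding outer_edges_def using True by (cases "conflict j") (simp_all only: m if_True if_False simp_thms)
  next
    case False
    then show ?thesis by (simp add: outer_edges_def)
  qed
  have "{e \<in> inner_edges j \<union> outer_edges j. monochromatic c e} = {e \<in> inner_edges j. monochromatic c e} \<union> {e \<in> outer_edges j. monochromatic c e}"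
    by auto
  moreover have "{e \<in> inner_edges j. monochromatic c e} \<inter> {e \<in> outer_edges j. monochromatic c e} = {}"
    using ne unfolding inner_edges_def outer_edges_def by (auto simp: doubleton_eq_iff split: if_splits)
  moreover have "finite {e \<in> inner_edges j. monochromatic c e}" "finite {e \<in> outer_edges j. monochromatic c e}"
    by (simp_all add: inner_edges_def outer_edges_def)
  ultimately have "card {e \<in> inner_edges j \<union> outer_edges j. monochromatic c e} =
      card {e \<in> inner_edges j. monochromatic c e} + card {e \<in> outer_edges j. monochromatic c e}"
    by (simp add: card_Un_disjoint)
  then show ?thesis unfolding inner outer happy_count_def by simp
qed

lemma card_happy_edges: "card (happy_edges (S, edges) c) = (\<Sum>j<J. happy_count c j)"
proof -
  have "happy_edges (S, edges) c = (\<Union>j\<in>{..<J}. {e \<in> inner_edges j \<union> outer_edges j. monochromatic c e})"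
  proof -
    have "{e \<in> (\<Union>j<J. A j). P e} = (\<Union>j\<in>{..<J}. {e \<in> A j. P e})" for A :: "nat \<Rightarrow> nat set set" and P by blast
    from this[of "\<lambda>j. inner_edges j \<union> outer_edges j"] show ?thesis
      unfolding happy_edges_eq edges_eq[symmetric] .
  qed
  moreover have "card \<dots> = (\<Sum>j<J. card {e \<in> inner_edges j \<union> outer_edges j. monochromatic c e})"
  proof (rule card_UN_disjoint)
    show "\<forall>i\<in>{..<J}. finite {e \<in> inner_edges i \<union> outer_edges i. monochromatic c e}"
      by (simp add: inner_edges_def outer_edges_def)
    show "\<forall>i\<in>{..<J}. \<forall>j\<in>{..<J}. i \<noteq> j \<longrightarrow>
        {e \<in> inner_edges i \<union> outer_edges i. monochromatic c e} \<inter> {e \<in> inner_edges j \<union> outer_edges j. monochromatic c e} = {}"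
      using component_edges_disjoint by fast
  qed simp
  ultimately show ?thesis using card_mono_component by simp
qed

lemma color_bound:
  assumes j: "j < J"
  shows "left_color j \<le> q * V \<and> right_color j \<le> Suc (q * V) \<and> 0 < left_color j \<and> 0 < right_color j"
proof -
  have "cx j * V + cv j < q * V" "cy j * V + cu j < q * V"
    using color_le component_less[OF j] by blast+
  then show ?thesis unfolding left_color_def right_color_def by simp
qed

lemma index_less: "p < n \<Longrightarrow> q \<le> p \<Longrightarrow> (p - q) div 3 < J"
  unfolding n_def by (intro less_mult_imp_div_less) simp

lemma precolor_le: "p < n \<Longrightarrow> precolor p \<le> Suc (q * V)"
  using color_bound[OF index_less[of p]] by (auto simp: precolor_def)

lemma edgeE:
  assumes "e \<in> edges"
  obtains p t where "e = {p, t}" "t < p" "p < n" "adj p t"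
  using assms by (auto simp: edges_def adj_def)

lemma mhe_legal_inst: "mhe_legal (inst T)"
proof -
  have "e \<subseteq> {0..<n} \<and> card e = 2" if "e \<in> edges" for e
    using that by (rule edgeE) auto
  then have "simple_graph ({0..<n}, edges)" by (auto simp: simple_graph_def)
  moreover have "ran (precoloring (inst T)) \<subseteq> {1..colors (inst T)}"
    using precolor_le by (auto simp: ran_def inst_def split: if_splits)
  moreover have "dom (precoloring (inst T)) \<subseteq> {0..<n}" by (auto simp: inst_def split: if_splits)
  ultimately show ?thesis unfolding mhe_legal_def by (auto simp: inst_def)
qed

section \<open>Colorings that reach the goal against solutions of the constraints\<close>

definition solves :: "(nat \<Rightarrow> nat) \<Rightarrow> bool" where
  "solves f \<longleftrightarrow> (\<forall>x < q. f x < V) \<and> (\<forall>x < q. \<forall>y < q. x < y \<longrightarrow> \<not> bad x (f x) y (f y))"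

definition extends :: "(nat \<Rightarrow> nat) \<Rightarrow> bool" where
  "extends c \<longleftrightarrow> (\<forall>p < n. precolor p \<noteq> 0 \<longrightarrow> c p = precolor p)"

lemma precolor_vertex:
  "precolor (va j) = left_color j" "precolor (vb j) = (if conflict j then 0 else left_color j)"
  "precolor (vc j) = right_color j"
proof -
  have "\<not> va j < q" "\<not> vb j < q" "\<not> vc j < q" by (simp_all add: va_def vb_def vc_def)
  then show "precolor (va j) = left_color j" "precolor (vb j) = (if conflict j then 0 else left_color j)"
    "precolor (vc j) = right_color j"
    unfolding precolor_def vertex_simps by simp_all
qed

lemma extendsD:
  assumes "extends c" "j < J"
  shows "c (va j) = left_color j" "\<not> conflict j \<Longrightarrow> c (vb j) = left_color j" "c (vc j) = right_color j"
proof -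
  have e: "c p = precolor p" if "p < n" "precolor p \<noteq> 0" for p
    using assms(1) that by (simp add: extends_def)
  note b = color_bound[OF assms(2)]
  show "c (va j) = left_color j" using e[of "va j"] precolor_vertex(1)[of j] assms(2) b by simp
  show "c (vb j) = left_color j" if "\<not> conflict j" using e[of "vb j"] precolor_vertex(2)[of j] assms(2) b that by simp
  show "c (vc j) = right_color j" using e[of "vc j"] precolor_vertex(3)[of j] assms(2) b by simp
qed

lemma happy_count_eq:
  assumes c: "extends c" and j: "j < J"
  shows "happy_count c j = (if conflict j
     then of_bool (c (vb j) = left_color j) + of_bool (c (vb j) = right_color j) +
       of_bool (c (vb j) = c (cx j)) + of_bool (c (vb j) = c (cy j))
     else if active j then 1 + of_bool (c (cx j) = left_color j) + of_bool (c (cy j) = right_color j) else 1)"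
proof -
  note lr = left_neq_right[OF j]
  note r = extendsD[OF c j]
  have t: "of_bool (tri \<and> left_color j = right_color j) = (0::nat)" using lr by simp
  have eqs: "of_bool (left_color j = a) = (of_bool (a = left_color j) :: nat)"
    "of_bool (right_color j = a) = (of_bool (a = right_color j) :: nat)" for a
    by (simp_all add: eq_commute)
  show ?thesis
  proof (cases "conflict j")
    case True
    then show ?thesis unfolding happy_count_def r(1,3) t if_P[OF True] eqs(1)[of "c (vb j)"] by simp
  next
    case False
    have "of_bool (left_color j = right_color j) = (0::nat)" using lr by simp
    then show ?thesis
      unfolding happy_count_def r(1,3) r(2)[OF False] t if_not_P[OF False] eqs[of "c (cx j)"] eqs[of "c (cy j)"]
      by simp
  qed
qed

definition chosen :: "(nat \<Rightarrow> nat) \<Rightarrow> nat \<Rightarrow> nat \<Rightarrow> bool" where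
  "chosen c x v \<longleftrightarrow> c x = Suc (x * V + v)"

definition in_domain :: "(nat \<Rightarrow> nat) \<Rightarrow> nat \<Rightarrow> bool" where
  "in_domain c x \<longleftrightarrow> (\<exists>v < V. chosen c x v)"

lemma chosen_color:
  "c (cx j) = left_color j \<longleftrightarrow> chosen c (cx j) (cv j)"
  "active j \<Longrightarrow> c (cy j) = right_color j \<longleftrightarrow> chosen c (cy j) (cu j)"
  by (simp_all add: chosen_def left_color_def right_color_def)

lemma sum_chosen: "(\<Sum>v<V. of_bool (chosen c x v)) = (of_bool (in_domain c x) :: nat)"
proof (cases "in_domain c x")
  case True
  then obtain v where v: "v < V" "chosen c x v" by (auto simp: in_domain_def)
  have "chosen c x v' \<longleftrightarrow> v' = v" if "v' < V" for v' using v(2) by (auto simp: chosen_def)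
  then have "(\<Sum>v'<V. of_bool (chosen c x v')) = (\<Sum>v'<V. if v' = v then 1 else 0 :: nat)"
    by (intro sum.cong) auto
  then show ?thesis using v True by simp
next
  case False
  then show ?thesis by (simp add: in_domain_def)
qed

text \<open>A color outside the domain of a variable can gain at most 2 in each of the conflict gadgets, of which there are
  at most \<open>V * V\<close> per pair of variables; the \<open>Z = 2 * V + 1\<close> copies of the other gadgets lose more than that.\<close>

definition penalty :: "(nat \<Rightarrow> nat) \<Rightarrow> nat \<Rightarrow> nat \<Rightarrow> nat \<Rightarrow> nat \<Rightarrow> nat \<Rightarrow> nat" where
  "penalty c x v y u z = of_bool (x < y \<and> in_domain c x \<and> in_domain c y \<and> z = 0 \<and>
     bad x v y u \<and> chosen c x v \<and> chosen c y u)"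

definition bonus :: "(nat \<Rightarrow> nat) \<Rightarrow> nat \<Rightarrow> nat \<Rightarrow> nat \<Rightarrow> nat \<Rightarrow> nat \<Rightarrow> nat" where
  "bonus c x v y u z = 1 + (if x < y then of_bool (chosen c x v) + of_bool (chosen c y u) else 0) +
     (if x < y \<and> \<not> (in_domain c x \<and> in_domain c y) \<and> z = 0 then 2 else 0)"

text \<open>In a conflict gadget with both variables in their domains, the only possible
  coincidences are \<open>x\<close> with the left and \<open>y\<close> with the right color, and the
  middle vertex can exploit just one of them. Otherwise at most three edges are happy, as left and
  right color differ, and the extra 2 in \<open>bonus\<close> pays for that.\<close>

lemma happy_count_le:
  assumes c: "extends c" and j: "j < J"
  shows "happy_count c j + penalty c (cx j) (cv j) (cy j) (cu j) (cz j) \<le> bonus c (cx j) (cv j) (cy j) (cu j) (cz j)"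
proof (cases "conflict j")
  case False
  then have "penalty c (cx j) (cv j) (cy j) (cu j) (cz j) = 0"
    by (auto simp: penalty_def conflict_def active_def)
  then show ?thesis
    unfolding happy_count_eq[OF c j] if_not_P[OF False] chosen_color(1) bonus_def active_def[symmetric]
    using chosen_color(2)[of j c] by simp
next
  case True
  then have a: "active j" and z: "cz j = 0" and xy: "cx j < cy j" by (simp_all add: conflict_def active_def)
  note lr = left_neq_right[OF j]
  let ?b = "c (vb j)"
  have h: "happy_count c j = of_bool (?b = left_color j) + of_bool (?b = right_color j) +
       of_bool (?b = c (cx j)) + of_bool (?b = c (cy j))"
    unfolding happy_count_eq[OF c j] if_P[OF True] ..
  have ex1: "of_bool (?b = left_color j) + of_bool (?b = right_color j) \<le> (1::nat)"
    using lr by auto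
  show ?thesis
  proof (cases "in_domain c (cx j) \<and> in_domain c (cy j)")
    case False
    then have "penalty c (cx j) (cv j) (cy j) (cu j) (cz j) = 0" by (auto simp: penalty_def)
    moreover have "3 \<le> bonus c (cx j) (cv j) (cy j) (cu j) (cz j)" using False xy z by (auto simp: bonus_def)
    moreover have "of_bool P \<le> (1::nat)" for P by simp
    from h ex1 this[of "?b = c (cx j)"] this[of "?b = c (cy j)"] have "happy_count c j \<le> 3" by linarith
    ultimately show ?thesis by linarith
  next
    case dom: True
    then obtain v u where v: "v < V" "c (cx j) = Suc (cx j * V + v)" and u: "u < V" "c (cy j) = Suc (cy j * V + u)"
      by (auto simp: in_domain_def chosen_def)
    have ne: "cx j \<noteq> cy j" using xy by simp
    have 1: "c (cx j) \<noteq> c (cy j)" using color_inj[OF v(1) u(1), of "cx j" "cy j"] ne v(2) u(2) by auto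
    have 2: "c (cy j) \<noteq> left_color j"
      using color_inj[OF component_less(2)[OF j] u(1), of "cx j" "cy j"] ne u(2) by (auto simp: left_color_def)
    have 3: "c (cx j) \<noteq> right_color j"
      using color_inj[OF v(1) component_less(4)[OF j], of "cx j" "cy j"] ne v(2) a by (auto simp: right_color_def)
    have "penalty c (cx j) (cv j) (cy j) (cu j) (cz j) \<le> of_bool (c (cx j) = left_color j \<and> c (cy j) = right_color j)"
      unfolding chosen_color(1) chosen_color(2)[OF a] by (simp add: penalty_def)
    moreover have "bonus c (cx j) (cv j) (cy j) (cu j) (cz j) =
        1 + of_bool (c (cx j) = left_color j) + of_bool (c (cy j) = right_color j)"
      unfolding chosen_color(1) chosen_color(2)[OF a] using xy dom by (simp add: bonus_def)
    moreover have "happy_count c j + of_bool (c (cx j) = left_color j \<and> c (cy j) = right_color j) \<le>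
        1 + of_bool (c (cx j) = left_color j) + of_bool (c (cy j) = right_color j)"
      unfolding h using 1 2 3 lr
      by (cases "?b = left_color j"; cases "?b = right_color j"; cases "?b = c (cx j)"; cases "?b = c (cy j)") simp_all
    ultimately show ?thesis by linarith
  qed
qed

lemma Z_pos: "0 < Z"
  by (simp add: Z_def)

lemma sum_three:
  fixes a b :: "nat \<Rightarrow> nat"
  shows "(\<Sum>v<V. \<Sum>u<V. \<Sum>z<Z. 1 + (a v + b u)) = V * V * Z + V * Z * (\<Sum>v<V. a v) + V * Z * (\<Sum>u<V. b u)"
  by (simp add: sum.distrib sum_distrib_left[symmetric] sum_distrib_right[symmetric] algebra_simps)

lemma sum_bonus:
  "(\<Sum>v<V. \<Sum>u<V. \<Sum>z<Z. bonus c x v y u z) = V * V * Z +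
     (if x < y then V * Z * of_bool (in_domain c x) + V * Z * of_bool (in_domain c y) else 0) +
     (if x < y \<and> \<not> (in_domain c x \<and> in_domain c y) then V * V * 2 else 0)"
proof (cases "x < y")
  case False
  then show ?thesis by (simp add: bonus_def)
next
  case True
  have z: "(\<Sum>z<Z. if P \<and> z = 0 then 2 else 0) = (if P then 2 else 0 :: nat)" for P
    using Z_pos by (cases P) simp_all
  have "(\<Sum>v<V. \<Sum>u<V. \<Sum>z<Z. bonus c x v y u z) =
      (\<Sum>v<V. \<Sum>u<V. \<Sum>z<Z. 1 + (of_bool (chosen c x v) + of_bool (chosen c y u))) +
      (\<Sum>v<V. \<Sum>u<V. \<Sum>z<Z. if \<not> (in_domain c x \<and> in_domain c y) \<and> z = 0 then 2 else 0)"
    unfolding sum.distrib[symmetric] using True by (intro sum.cong refl) (simp add: bonus_def)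
  also have "\<dots> = V * V * Z + V * Z * of_bool (in_domain c x) + V * Z * of_bool (in_domain c y) +
      (if \<not> (in_domain c x \<and> in_domain c y) then V * V * 2 else 0)"
    unfolding sum_three sum_chosen z by simp
  finally show ?thesis using True by simp
qed

lemma sum_bonus_le:
  assumes V: "0 < V"
  shows "(\<Sum>v<V. \<Sum>u<V. \<Sum>z<Z. bonus c x v y u z) + of_bool (x < y \<and> \<not> (in_domain c x \<and> in_domain c y)) \<le> pair_value x y"
proof (cases "x < y \<and> \<not> (in_domain c x \<and> in_domain c y)")
  case True
  then have "V * Z * of_bool (in_domain c x) + V * Z * of_bool (in_domain c y) \<le> V * Z" by auto
  \<comment> \<open>The reason for \<open>Z = 2 * V + 1\<close>: one color outside its domain loses
    \<open>V * Z\<close>, that is \<open>2 * V * V + V\<close>, which exceeds the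
    \<open>2 * V * V\<close> granted for conflict gadgets.\<close>
  moreover have "V * V * 2 + 1 \<le> V * Z" using V by (simp add: Z_def algebra_simps)
  moreover have "2 * Z * V = V * Z + V * Z" by simp
  moreover have xy: "x < y" and one: "of_bool (x < y \<and> \<not> (in_domain c x \<and> in_domain c y)) = (1::nat)"
    using True by simp_all
  ultimately show ?thesis unfolding one sum_bonus pair_value_def if_P[OF True] if_P[OF xy] by linarith
next
  case False
  then show ?thesis unfolding sum_bonus pair_value_def by auto
qed

text \<open>The count, the penalties and the number of pairs \<open>x < y\<close> with a color
  outside its domain together are at most \<open>goal\<close>, so a coloring that reaches
  \<open>goal\<close> has neither. With at least two variables each occurs in such a pair, so its
  color is indeed tested.\<close>

lemma solution_of_coloring:
  assumes V: "0 < V" and q: "2 \<le> q" and c: "extends c" and g: "goal \<le> (\<Sum>j<J. happy_count c j)"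
  shows "\<exists>f. solves f"
proof -
  let ?S = "\<lambda>g. \<Sum>x<q. \<Sum>y<q. \<Sum>v<V. \<Sum>u<V. \<Sum>z<Z. g x v y u z :: nat"
  let ?out = "\<Sum>x<q. \<Sum>y<q. of_bool (x < y \<and> \<not> (in_domain c x \<and> in_domain c y)) :: nat"
  have "(\<Sum>j<J. happy_count c j) + ?S (penalty c) \<le> ?S (bonus c)"
    unfolding sum_components[symmetric] sum.distrib[symmetric]
    using happy_count_le[OF c] by (intro sum_mono) simp
  moreover have "?S (bonus c) + ?out \<le> goal"
    unfolding goal_def sum.distrib[symmetric] by (intro sum_mono sum_bonus_le V)
  ultimately have "?S (penalty c) = 0" and out: "?out = 0" using g by linarith+
  then have pen: "penalty c x v y u z = 0" if "x < q" "y < q" "v < V" "u < V" "z < Z" for x v y u z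
    using that by (simp only: sum_eq_0_iff finite_lessThan lessThan_iff Ball_def)
  have dom: "in_domain c x \<and> in_domain c y" if "x < q" "y < q" "x < y" for x y
  proof (rule ccontr)
    assume *: "\<not> (in_domain c x \<and> in_domain c y)"
    have "of_bool (x < y \<and> \<not> (in_domain c x \<and> in_domain c y)) = (0::nat)"
      using out that(1,2) by (simp only: sum_eq_0_iff finite_lessThan lessThan_iff Ball_def)
    then show False using * that by simp
  qed
  have "in_domain c x" if x: "x < q" for x
  proof (cases "x = 0")
    case True
    then show ?thesis using dom[of 0 1] q by simp
  next
    case False
    then show ?thesis using dom[of 0 x] x q by simp
  qed
  then have "\<forall>x. \<exists>v. x < q \<longrightarrow> v < V \<and> chosen c x v" unfolding in_domain_def by blast
  then obtain f where f: "\<And>x. x < q \<Longrightarrow> f x < V \<and> chosen c x (f x)" by metis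
  have "\<not> bad x (f x) y (f y)" if "x < q" "y < q" "x < y" for x y
    using pen[OF that(1,2), of "f x" "f y" 0] f[OF that(1)] f[OF that(2)] dom[OF that] that(3) Z_pos
    by (simp add: penalty_def)
  then have "solves f" using f unfolding solves_def by blast
  then show ?thesis by (rule exI[of solves])
qed

text \<open>A free middle vertex follows the side whose variable matches. For a solution at most one
  side of a forbidden pair does; if neither does, either color gives one happy edge.\<close>

definition coloring :: "(nat \<Rightarrow> nat) \<Rightarrow> nat \<Rightarrow> nat" where
  "coloring f p = (if p < q then Suc (p * V + f p) else if precolor p \<noteq> 0 then precolor p
     else if cv ((p - q) div 3) = f (cx ((p - q) div 3)) then left_color ((p - q) div 3)
     else right_color ((p - q) div 3))"

lemma coloring_of_solution:
  assumes f: "solves f"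
  shows "extends (coloring f) \<and> (\<forall>p < n. coloring f p \<in> {1..Suc (q * V)}) \<and> goal \<le> (\<Sum>j<J. happy_count (coloring f) j)"
proof (intro conjI allI impI)
  let ?c = "coloring f"
  have fV: "f x < V" if "x < q" for x using f that by (simp add: solves_def)
  show r: "extends ?c" by (auto simp: extends_def coloring_def precolor_def)
  show "?c p \<in> {1..Suc (q * V)}" if p: "p < n" for p
  proof (cases "p < q")
    case True
    then show ?thesis using color_le[OF True fV[OF True]] by (simp add: coloring_def)
  next
    case False
    then show ?thesis using precolor_le[OF p] color_bound[OF index_less[OF p]]
      by (auto simp: coloring_def Suc_le_eq)
  qed
  \<comment> \<open>The share of a component in \<open>goal\<close>. Every gadget attains it, a
    forbidden one because its two indicators are never both 1 for a solution.\<close>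
  define lb where "lb x v y u z = (1 :: nat) + ((if x < y then of_bool (v = f x) else 0) + (if x < y then of_bool (u = f y) else 0))"
    for x v y u z :: nat
  have le: "lb (cx j) (cv j) (cy j) (cu j) (cz j) \<le> happy_count ?c j" if j: "j < J" for j
  proof -
    note cl = component_less[OF j]
    have x: "?c (cx j) = left_color j \<longleftrightarrow> cv j = f (cx j)" using cl by (auto simp: coloring_def left_color_def)
    have y: "?c (cy j) = right_color j \<longleftrightarrow> cu j = f (cy j)" if "active j"
      using cl that by (auto simp: coloring_def right_color_def)
    show ?thesis
    proof (cases "conflict j")
      case False
      then show ?thesis
        unfolding happy_count_eq[OF r j] if_not_P[OF False] x lb_def active_def[symmetric] using y by simp
    next
      case True
      then have a: "active j" and b: "bad (cx j) (cv j) (cy j) (cu j)" and xy: "cx j < cy j"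
        by (simp_all add: conflict_def active_def)
      have nb: "\<not> (cv j = f (cx j) \<and> cu j = f (cy j))"
        using f b xy cl unfolding solves_def by auto
      have "\<not> vb j < q" by (simp add: vb_def)
      then have vb: "?c (vb j) = (if cv j = f (cx j) then left_color j else right_color j)"
        unfolding coloring_def precolor_vertex vertex_simps using True by simp
      show ?thesis
        unfolding happy_count_eq[OF r j] if_P[OF True] lb_def vb using x y[OF a] nb xy
        by (cases "cv j = f (cx j)"; cases "cu j = f (cy j)") auto
    qed
  qed
  have one: "(\<Sum>v<V. if P then of_bool (v = f x) else 0) = (if P then 1 else 0 :: nat)" if "x < q" for P x
    using fV[OF that] by (simp add: of_bool_def)
  have "goal = (\<Sum>x<q. \<Sum>y<q. \<Sum>v<V. \<Sum>u<V. \<Sum>z<Z. lb x v y u z)"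
    unfolding goal_def
  proof (intro sum.cong refl)
    fix x y assume "x \<in> {..<q}" "y \<in> {..<q}"
    then have xy: "x < q" "y < q" by simp_all
    show "pair_value x y = (\<Sum>v<V. \<Sum>u<V. \<Sum>z<Z. lb x v y u z)"
      unfolding lb_def sum_three one[OF xy(1)] one[OF xy(2)] pair_value_def by simp
  qed
  also have "\<dots> = (\<Sum>j<J. lb (cx j) (cv j) (cy j) (cu j) (cz j))" by (rule sum_components[symmetric])
  also have "\<dots> \<le> (\<Sum>j<J. happy_count ?c j)" using le by (intro sum_mono) simp
  finally show "goal \<le> (\<Sum>j<J. happy_count ?c j)" .
qed

theorem mhe_yes_inst:
  assumes V: "0 < V" and q: "2 \<le> q"
  shows "mhe_yes (inst goal) \<longleftrightarrow> (\<exists>f. solves f)"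
proof
  assume "mhe_yes (inst goal)"
  then obtain c where d: "\<forall>v \<in> dom (precoloring (inst goal)). precoloring (inst goal) v = Some (c v)"
    and t: "target (inst goal) \<le> int (card (happy_edges (graph (inst goal)) c))"
    unfolding mhe_yes_def by blast
  have "extends c"
    unfolding extends_def
  proof (intro allI impI)
    fix p assume "p < n" "precolor p \<noteq> 0"
    then have *: "precoloring (inst goal) p = Some (precolor p)" by (simp add: inst_def)
    then have "p \<in> dom (precoloring (inst goal))" by (rule domI)
    from bspec[OF d this] show "c p = precolor p" unfolding * by (simp only: option.inject)
  qed
  moreover have "goal \<le> (\<Sum>j<J. happy_count c j)"
    using t unfolding inst_sel card_happy_edges by (simp only: of_nat_le_iff)
  ultimately show "\<exists>f. solves f" by (rule solution_of_coloring[OF V q])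
next
  assume "\<exists>f. solves f"
  then obtain f where "solves f" by (rule exE)
  from coloring_of_solution[OF this] have c: "extends (coloring f)" "\<forall>p < n. coloring f p \<in> {1..Suc (q * V)}"
    "goal \<le> (\<Sum>j<J. happy_count (coloring f) j)" by simp_all
  show "mhe_yes (inst goal)"
    unfolding mhe_yes_def
  proof (intro exI[of _ "coloring f"] conjI)
    show "\<forall>v \<in> fst (graph (inst goal)). coloring f v \<in> {1..colors (inst goal)}"
      using c(2) by (simp add: inst_def)
    show "\<forall>v \<in> dom (precoloring (inst goal)). precoloring (inst goal) v = Some (coloring f v)"
      using c(1) by (auto simp: inst_def extends_def split: if_splits)
    show "target (inst goal) \<le> int (card (happy_edges (graph (inst goal)) (coloring f)))"
      using c(3) unfolding inst_sel card_happy_edges by (simp only: of_nat_le_iff)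
  qed
qed

lemma not_mhe_yes_inst_1:
  assumes q: "q = 0"
  shows "\<not> mhe_yes (inst 1)"
proof
  assume "mhe_yes (inst 1)"
  then obtain c where "target (inst 1) \<le> int (card (happy_edges (graph (inst 1)) c))"
    unfolding mhe_yes_def by blast
  then have "int 1 \<le> int (\<Sum>j<J. happy_count c j)" unfolding inst_sel card_happy_edges .
  moreover have "J = 0" unfolding J_def using q by (simp only: mult_0)
  ultimately show False by (simp only: lessThan_0 sum.empty)
qed

text \<open>Deleting the variables destroys exactly the outer edges. An upper bound suffices, since
  a reduction has to bound the new parameter.\<close>

lemma distance_to_le:
  assumes P: "\<And>j. P ({va j, vb j, vc j}, inner_edges j)"
  shows "distance_to (disjoint_union_of P) (graph (inst T)) \<le> q"
proof -
  let ?H = "\<lambda>j. ({va j, vb j, vc j}, inner_edges j)"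
  let ?G = "delete_vertices ({0..<n}, edges) {0..<q}"
  have V: "fst ?G = (\<Union>j<J. {va j, vb j, vc j})"
  proof (intro set_eqI iffI)
    fix p assume "p \<in> fst ?G"
    then have p: "p < n" "q \<le> p" by (auto simp: delete_vertices_def)
    from p(2) have "p \<in> {va ((p - q) div 3), vb ((p - q) div 3), vc ((p - q) div 3)}"
      by (cases rule: vertex_cases) blast+
    then show "p \<in> (\<Union>j<J. {va j, vb j, vc j})" using index_less[OF p] by blast
  next
    fix p assume "p \<in> (\<Union>j<J. {va j, vb j, vc j})"
    then show "p \<in> fst ?G"
      using vertex_simps(7-12) by (auto simp: delete_vertices_def not_less)
  qed
  have E: "snd ?G = (\<Union>j<J. inner_edges j)"
  proof (intro set_eqI iffI)
    fix e assume e: "e \<in> snd ?G"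
    then obtain j where j: "j < J" "e \<in> inner_edges j \<or> e \<in> outer_edges j" and d: "e \<inter> {0..<q} = {}"
      unfolding delete_vertices_def edges_eq by auto
    have "e \<inter> {0..<q} \<noteq> {}" if "e \<in> outer_edges j"
      using that component_less(1,3)[OF j(1)] by (auto simp: outer_edges_def split: if_splits)
    then show "e \<in> (\<Union>j<J. inner_edges j)" using j d by blast
  next
    fix e assume "e \<in> (\<Union>j<J. inner_edges j)"
    then obtain j where j: "j < J" "e \<in> inner_edges j" by blast
    have "e \<subseteq> {va j, vb j, vc j}" using j(2) by (auto simp: inner_edges_def split: if_splits)
    moreover have "{va j, vb j, vc j} \<inter> {0..<q} = {}" by (auto simp: va_def vb_def vc_def)
    moreover have "e \<in> edges" using j unfolding edges_eq by blast
    ultimately show "e \<in> snd ?G" unfolding delete_vertices_def by auto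
  qed
  have "disjoint_union_of P ?G"
    unfolding disjoint_union_of_def
  proof (intro exI[of _ "?H ` {..<J}"] conjI)
    show "\<forall>H \<in> ?H ` {..<J}. P H" using P by blast
    have index: "(p - q) div 3 = i" if "p \<in> {va i, vb i, vc i}" for p i
      using that vertex_simps(1-3)[of i] by blast
    show "\<forall>H \<in> ?H ` {..<J}. \<forall>K \<in> ?H ` {..<J}. H \<noteq> K \<longrightarrow> fst H \<inter> fst K = {}"
    proof (intro ballI impI)
      fix H K assume "H \<in> ?H ` {..<J}" "K \<in> ?H ` {..<J}" and ne: "H \<noteq> K"
      then obtain i j where ij: "H = ?H i" "K = ?H j" by blast
      have "i = j" if "p \<in> fst H" "p \<in> fst K" for p
        using index[of p i] index[of p j] that ij by simp
      then show "fst H \<inter> fst K = {}" using ne ij by blast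
    qed
    show "fst ?G = (\<Union>H \<in> ?H ` {..<J}. fst H)" unfolding V by simp
    show "snd ?G = (\<Union>H \<in> ?H ` {..<J}. snd H)" unfolding E by simp
  qed
  moreover have "{0..<q} \<subseteq> fst ({0..<n}, edges)" "card {0..<q} = q" by (auto simp: n_def)
  ultimately have "\<exists>X \<subseteq> fst ({0..<n}, edges). card X = q \<and> disjoint_union_of P (delete_vertices ({0..<n}, edges) X)"
    by blast
  then show ?thesis unfolding distance_to_def inst_def by (simp add: Least_le)
qed

lemma is_path_component:
  assumes t: "\<not> tri"
  shows "is_path 3 ({va j, vb j, vc j}, inner_edges j)"
proof -
  let ?vs = "[va j, vb j, vc j]"
  have S: "{i. Suc i < 3} = {0, 1}" by auto
  have "{f i | i. Suc i < 3} = {f 0, f 1}" for f :: "nat \<Rightarrow> nat set"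
    unfolding setcompr_eq_image S by (simp only: image_insert image_empty)
  from this[of "\<lambda>i. {?vs ! i, ?vs ! Suc i}"]
  have "{{?vs ! i, ?vs ! Suc i} | i. Suc i < 3} = {{va j, vb j}, {vb j, vc j}}"
    by (simp only: nth_Cons_0 nth_Cons_Suc One_nat_def)
  then show ?thesis
    unfolding is_path_def inner_edges_def if_not_P[OF t]
    by (intro exI[of _ ?vs] conjI) (simp_all only: fst_conv snd_conv Un_empty_right, simp_all)
qed

lemma is_cycle_component:
  assumes t: "tri"
  shows "is_cycle 3 ({va j, vb j, vc j}, inner_edges j)"
proof -
  let ?vs = "[va j, vb j, vc j]"
  have S: "{i. i < 3} = {0, 1, 2::nat}" by auto
  have "{f i | i. i < 3} = {f 0, f 1, f 2}" for f :: "nat \<Rightarrow> nat set"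
    unfolding setcompr_eq_image S by (simp only: image_insert image_empty)
  from this[of "\<lambda>i. {?vs ! i, ?vs ! (Suc i mod 3)}"]
  have "{{?vs ! i, ?vs ! (Suc i mod 3)} | i. i < 3} = {{va j, vb j}, {vb j, vc j}, {vc j, va j}}"
    by (simp add: numeral_2_eq_2)
  moreover have "{{va j, vb j}, {vb j, vc j}, {vc j, va j}} = {{va j, vb j}, {vb j, vc j}} \<union> {{va j, vc j}}"
    by (simp only: insert_commute[of "vc j" "va j"] Un_insert_left Un_empty_left)
  ultimately show ?thesis
    unfolding is_cycle_def inner_edges_def if_P[OF t]
    by (intro conjI exI[of _ ?vs]) (simp_all only: fst_conv snd_conv, simp_all)
qed

text \<open>Brings the code into the shape of concatenations over \<open>[0..<n]\<close>, under
  which feasible strings are closed. \<open>adj\<close> is oriented towards the smaller vertex,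
  hence the disjunction; the leading \<open>False\<close> is the sign of the target.\<close>

lemma code_mhe_inst:
  "code_mhe (inst T) = code_nat n @ code_nat (Suc (q * V)) @ (False # code_nat T) @
     concat (map (\<lambda>u. map (\<lambda>v. adj u v \<or> adj v u) [0..<n]) [0..<n]) @
     concat (map (\<lambda>v. code_nat (precolor v)) [0..<n])"
proof -
  have mem: "{u, v} \<in> edges \<longleftrightarrow> adj u v \<or> adj v u" if "u < n" "v < n" for u v
  proof
    assume "{u, v} \<in> edges"
    then obtain p t where "{u, v} = {p, t}" "adj p t" by (rule edgeE)
    then show "adj u v \<or> adj v u" by (auto simp: doubleton_eq_iff)
  next
    assume "adj u v \<or> adj v u"
    then show "{u, v} \<in> edges"
    proof
      assume "adj u v"
      then show ?thesis using that(1) unfolding edges_def by blast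
    next
      assume "adj v u"
      then have "{v, u} \<in> edges" using that(2) unfolding edges_def by blast
      then show ?thesis by (simp only: insert_commute)
    qed
  qed
  have "map (\<lambda>(u, v). {u, v} \<in> edges) (List.product [0..<n] [0..<n]) =
      concat (map (\<lambda>u. map (\<lambda>v. {u, v} \<in> edges) [0..<n]) [0..<n])"
    by (simp add: product_concat_map map_concat comp_def)
  also have "\<dots> = concat (map (\<lambda>u. map (\<lambda>v. adj u v \<or> adj v u) [0..<n]) [0..<n])"
    using mem by (intro arg_cong[where f = concat] map_cong refl) auto
  finally have 1: "map (\<lambda>(u, v). {u, v} \<in> edges) (List.product [0..<n] [0..<n]) =
      concat (map (\<lambda>u. map (\<lambda>v. adj u v \<or> adj v u) [0..<n]) [0..<n])" .
  show ?thesis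
    unfolding code_mhe_def Let_def inst_def
    by (simp add: 1 code_int_def del: code_nat.simps) (intro arg_cong[where f = concat] map_cong refl, auto)
qed

end

section \<open>Partial views as binary constraints\<close>

text \<open>The numbers \<open>x\<close> and \<open>v\<close> code a tuple of \<open>E\<close> coordinates in base \<open>M\<close> and their values in base \<open>B\<close>.\<close>

primrec knows :: "nat \<Rightarrow> nat \<Rightarrow> nat \<Rightarrow> nat \<Rightarrow> nat \<Rightarrow> nat \<Rightarrow> nat \<Rightarrow> bool" where
  "knows 0 M B x v r a = False"
| "knows (Suc E) M B x v r a = (x mod M = r \<and> v mod B = a \<or> knows E M B (x div M) (v div B) r a)"

primrec restrict :: "nat \<Rightarrow> nat \<Rightarrow> nat \<Rightarrow> (nat \<Rightarrow> nat) \<Rightarrow> nat \<Rightarrow> nat" where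
  "restrict 0 M B \<sigma> x = 0"
| "restrict (Suc E) M B \<sigma> x = \<sigma> (x mod M) + B * restrict E M B \<sigma> (x div M)"

lemma knows_less: "knows E M B x v r a \<Longrightarrow> 0 < M \<Longrightarrow> 0 < B \<Longrightarrow> r < M \<and> a < B"
  by (induction E arbitrary: x v) auto

lemma knows_restrict:
  assumes "\<forall>r < M. \<sigma> r < B" "0 < M"
  shows "knows E M B x (restrict E M B \<sigma> x) r a \<Longrightarrow> r < M \<and> a = \<sigma> r"
proof (induction E arbitrary: x)
  case (Suc E)
  have B: "\<sigma> (x mod M) < B" using assms by simp
  then have "(\<sigma> (x mod M) + B * s) mod B = \<sigma> (x mod M)" "(\<sigma> (x mod M) + B * s) div B = s" for s by simp_all
  then show ?case using Suc assms(2) by auto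
qed simp

lemma restrict_less:
  assumes "\<forall>r < M. \<sigma> r < B" "0 < M"
  shows "restrict E M B \<sigma> x < B ^ E"
proof (induction E arbitrary: x)
  case (Suc E)
  have "\<sigma> (x mod M) < B" using assms by simp
  moreover have "B * Suc (restrict E M B \<sigma> (x div M)) \<le> B * B ^ E"
    using Suc[of "x div M"] by (intro mult_le_mono2) simp
  ultimately show ?case by simp
qed simp

text \<open>Digits may repeat, so tuples of length \<open>E\<close> can list any set of at most
  \<open>E\<close> coordinates. The value code \<open>v\<close> is arbitrary, as a tuple always
  knows some value for each listed coordinate.\<close>

lemma tuple_exists:
  assumes M: "0 < M"
  shows "finite D \<Longrightarrow> D \<subseteq> {..<M} \<Longrightarrow> card D \<le> E \<Longrightarrow> \<exists>x < M ^ E. \<forall>r \<in> D. \<forall>v. \<exists>a. knows E M B x v r a"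
proof (induction E arbitrary: D)
  case 0
  then show ?case by simp
next
  case (Suc E)
  show ?case
  proof (cases "D = {}")
    case True
    then show ?thesis using M by (intro exI[of _ 0]) simp
  next
    case False
    then obtain r where r: "r \<in> D" by blast
    then have "card (D - {r}) \<le> E" using Suc.prems by simp
    then obtain x where x: "x < M ^ E" "\<forall>r' \<in> D - {r}. \<forall>v. \<exists>a. knows E M B x v r' a"
      using Suc.IH[of "D - {r}"] Suc.prems by blast
    have rM: "r < M" using r Suc.prems(2) by blast
    have "(r + M * x) mod M = r" "(r + M * x) div M = x" using rM by simp_all
    then have "\<forall>r' \<in> D. \<forall>v. \<exists>a. knows (Suc E) M B (r + M * x) v r' a" using x(2) by auto
    moreover have "M * Suc x \<le> M * M ^ E" using x(1) by (intro mult_le_mono2) simp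
    then have "r + M * x < M ^ Suc E" using rM by simp
    ultimately show ?thesis by blast
  qed
qed

context view
begin

definition conflicting :: "nat \<Rightarrow> nat \<Rightarrow> nat \<Rightarrow> nat \<Rightarrow> bool" where
  "conflicting x v y u \<longleftrightarrow> violated (\<lambda>r a.
     knows (2 ^ (d + 2)) num_coords B x v r a \<or> knows (2 ^ (d + 2)) num_coords B y u r a)"

lemma num_coords_ge: "2 \<le> num_coords"
  by (simp add: num_coords_def)

text \<open>A constraint compares two different variables; a lone tuple would never be
  tested.\<close>

lemma num_tuples_ge: "2 \<le> num_coords ^ (2 ^ (d + 2))"
proof -
  have "num_coords ^ 1 \<le> num_coords ^ (2 ^ (d + 2))" using num_coords_ge by (intro power_increasing) auto
  then show ?thesis using num_coords_ge by simp
qed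

text \<open>Tuples cut out of an assignment without violation are compatible by
  \<open>violated_mono\<close>. Conversely, compatible tuples agree on shared coordinates and glue
  to one assignment; by \<open>violated_local\<close> a violation of it would have a certificate
  inside a single tuple, which would then conflict with any other one.\<close>

lemma conflict_free_iff:
  assumes B: "0 < B"
  shows "(\<exists>f. (\<forall>x < num_coords ^ (2 ^ (d + 2)). f x < B ^ (2 ^ (d + 2))) \<and>
      (\<forall>x < num_coords ^ (2 ^ (d + 2)). \<forall>y < num_coords ^ (2 ^ (d + 2)). x < y \<longrightarrow> \<not> conflicting x (f x) y (f y))) \<longleftrightarrow>
    (\<exists>\<sigma>. assigns \<sigma> \<and> \<not> violated (full \<sigma>))"
proof
  let ?E = "2 ^ (d + 2)"
  let ?M = "num_coords"
  have M: "0 < ?M" using num_coords_ge by simp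
  {
    assume "\<exists>\<sigma>. assigns \<sigma> \<and> \<not> violated (full \<sigma>)"
    then obtain \<sigma> where \<sigma>: "assigns \<sigma>" "\<not> violated (full \<sigma>)" by blast
    then have ws: "\<not> wrong_selection (full \<sigma>)" unfolding violated_def by blast
    have \<sigma>B: "\<forall>r < ?M. \<sigma> r < B" using \<sigma>(1) by (simp add: assigns_def)
    let ?f = "restrict ?E ?M B \<sigma>"
    have "\<not> conflicting x (?f x) y (?f y)" for x y
    proof
      assume "conflicting x (?f x) y (?f y)"
      then have v: "violated (\<lambda>r a. knows ?E ?M B x (?f x) r a \<or> knows ?E ?M B y (?f y) r a)"
        by (simp only: conflicting_def)
      have "full \<sigma> r a" if "knows ?E ?M B x (?f x) r a \<or> knows ?E ?M B y (?f y) r a" for r a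
        using that knows_restrict[OF \<sigma>B M, where E = ?E] unfolding full_def by blast
      then have "violated (full \<sigma>)" by (intro violated_mono[OF \<sigma>(1) ws _ v] allI impI)
      then show False using \<sigma>(2) by blast
    qed
    moreover have "?f x < B ^ ?E" for x using \<sigma>B M by (rule restrict_less)
    ultimately show "\<exists>f. (\<forall>x < ?M ^ ?E. f x < B ^ ?E) \<and>
        (\<forall>x < ?M ^ ?E. \<forall>y < ?M ^ ?E. x < y \<longrightarrow> \<not> conflicting x (f x) y (f y))"
      by (intro exI[of _ ?f]) blast
  }
  assume "\<exists>f. (\<forall>x < ?M ^ ?E. f x < B ^ ?E) \<and>
        (\<forall>x < ?M ^ ?E. \<forall>y < ?M ^ ?E. x < y \<longrightarrow> \<not> conflicting x (f x) y (f y))"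
  then obtain f where f: "\<forall>x < ?M ^ ?E. \<forall>y < ?M ^ ?E. x < y \<longrightarrow> \<not> conflicting x (f x) y (f y)" by blast
  define K where "K x r a \<longleftrightarrow> knows ?E ?M B x (f x) r a" for x r a
  have KB: "r < ?M \<and> a < B" if "K x r a" for x r a using knows_less[OF _ M B] that unfolding K_def .
  have nv: "\<not> violated (\<lambda>r a. K x r a \<or> K y r a)" if "x < ?M ^ ?E" "y < ?M ^ ?E" "x \<noteq> y" for x y
  proof (cases "x < y")
    case True
    then show ?thesis using f that unfolding K_def conflicting_def by blast
  next
    case False
    then have "\<not> violated (\<lambda>r a. K y r a \<or> K x r a)" using f that unfolding K_def conflicting_def by force
    moreover have "(\<lambda>r a. K y r a \<or> K x r a) = (\<lambda>r a. K x r a \<or> K y r a)" by (intro ext) blast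
    ultimately show ?thesis by (simp only: not_False_eq_True)
  qed
  have other: "\<exists>z < ?M ^ ?E. z \<noteq> x" for x
  proof -
    have "0 < ?M ^ ?E" "1 < ?M ^ ?E" using num_tuples_ge by linarith+
    then show ?thesis by (cases "x = 0") (blast intro: one_neq_zero)+
  qed
  have consist: "a = b" if x: "x < ?M ^ ?E" and y: "y < ?M ^ ?E" and a: "K x r a" and b: "K y r b" for x y r a b
  proof (rule ccontr)
    assume ab: "a \<noteq> b"
    \<comment> \<open>A tuple may list \<open>r\<close> twice with different values; pairing it with
      any other tuple exposes this.\<close>
    obtain z where z: "z < ?M ^ ?E" "z \<noteq> x" "y \<noteq> x \<longrightarrow> z = y" using other y by (cases "y = x") blast+
    have "K x r b \<or> K z r b" using b z(3) by (cases "y = x") auto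
    then have "\<exists>r < ?M. \<exists>a < B. \<exists>b < B. (K x r a \<or> K z r a) \<and> (K x r b \<or> K z r b) \<and> a \<noteq> b"
      using a ab KB[OF a] KB[OF b] by blast
    then have "violated (\<lambda>r a. K x r a \<or> K z r a)" unfolding violated_def by (intro disjI1)
    then show False using nv[OF x z(1)] z(2) by blast
  qed
  define \<sigma> where "\<sigma> r = (if \<exists>x < ?M ^ ?E. \<exists>a. K x r a then SOME a. \<exists>x < ?M ^ ?E. K x r a else 0)" for r
  have \<sigma>: "\<sigma> r = a" if "x < ?M ^ ?E" "K x r a" for x r a
  proof -
    have "\<exists>a. \<exists>x < ?M ^ ?E. K x r a" using that by blast
    from someI_ex[OF this] have "\<exists>x < ?M ^ ?E. K x r (\<sigma> r)" using that unfolding \<sigma>_def by auto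
    then show ?thesis using consist that by blast
  qed
  have as: "assigns \<sigma>"
    unfolding assigns_def
  proof (intro allI impI)
    fix r
    show "\<sigma> r < B"
    proof (cases "\<exists>x < ?M ^ ?E. \<exists>a. K x r a")
      case True
      then obtain x a where "x < ?M ^ ?E" "K x r a" by blast
      then show ?thesis using \<sigma> KB by metis
    next
      case False
      then have "\<sigma> r = 0" unfolding \<sigma>_def by (rule if_not_P)
      then show ?thesis using B by simp
    qed
  qed
  have "\<not> violated (full \<sigma>)"
  proof
    assume "violated (full \<sigma>)"
    from violated_local[OF as this] obtain D where D: "D \<subseteq> {..<?M}" "card D \<le> ?E"
      and viol: "\<forall>K. (\<forall>r \<in> D. K r (\<sigma> r)) \<longrightarrow> (\<forall>r v. K r v \<longrightarrow> full \<sigma> r v) \<longrightarrow> violated K"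
      by (elim exE conjE)
    have "finite D" using D(1) finite_subset by blast
    from tuple_exists[OF M this D, of B] obtain x where x: "x < ?M ^ ?E"
      and cov: "\<forall>r \<in> D. \<forall>v. \<exists>a. knows ?E ?M B x v r a" by blast
    obtain z where z: "z < ?M ^ ?E" "z \<noteq> x" using other by blast
    have "K x r (\<sigma> r)" if r: "r \<in> D" for r
    proof -
      obtain a where a: "K x r a" using bspec[OF cov r] unfolding K_def by blast
      then show ?thesis using \<sigma>[OF x a] by simp
    qed
    moreover have "full \<sigma> r v" if "K x r v \<or> K z r v" for r v
      using that
    proof
      assume v: "K x r v"
      show ?thesis using \<sigma>[OF x v] KB[OF v] unfolding full_def by simp
    next
      assume v: "K z r v"
      show ?thesis using \<sigma>[OF z(1) v] KB[OF v] unfolding full_def by simp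
    qed
    ultimately have "violated (\<lambda>r v. K x r v \<or> K z r v)"
      using spec[OF viol, of "\<lambda>r v. K x r v \<or> K z r v"] by simp
    then show False using nv[OF x z(1)] z(2) by blast
  qed
  then show "\<exists>\<sigma>. assigns \<sigma> \<and> \<not> violated (full \<sigma>)" using as by (intro exI conjI)
qed

end

section \<open>Feasibility of the constraints\<close>

text \<open>Shifts by \<open>m\<close> are built in because \<open>K\<close> is used below nested
  quantifiers, each of which adds a variable to the environment.\<close>

definition feas_rel :: "(bool list \<Rightarrow> (nat \<Rightarrow> nat) \<Rightarrow> nat \<Rightarrow> nat \<Rightarrow> bool) \<Rightarrow> bool" where
  "feas_rel K \<longleftrightarrow> (\<forall>m R A. feas R \<longrightarrow> feas A \<longrightarrow> feasb (\<lambda>w \<rho>. K w (\<lambda>n. \<rho> (n + m)) (R w \<rho>) (A w \<rho>)))"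

lemma feas_rel_shift: "feas_rel K \<Longrightarrow> feas_rel (\<lambda>w \<rho>. K w (\<lambda>n. \<rho> (Suc n)))"
proof -
  assume K: "feas_rel K"
  show ?thesis
    unfolding feas_rel_def
  proof (intro allI impI)
    fix m :: nat and R A assume "feas R" "feas A"
    then have "feasb (\<lambda>w \<rho>. K w (\<lambda>n. \<rho> (n + Suc m)) (R w \<rho>) (A w \<rho>))"
      using K unfolding feas_rel_def by blast
    then show "feasb (\<lambda>w \<rho>. K w (\<lambda>n. \<rho> (Suc n + m)) (R w \<rho>) (A w \<rho>))" by simp
  qed
qed

lemma feas_relD: "feas_rel K \<Longrightarrow> feas R \<Longrightarrow> feas A \<Longrightarrow> feasb (\<lambda>w \<rho>. K w \<rho> (R w \<rho>) (A w \<rho>))"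
proof -
  assume "feas_rel K" "feas R" "feas A"
  then have "feasb (\<lambda>w \<rho>. K w (\<lambda>n. \<rho> (n + 0)) (R w \<rho>) (A w \<rho>))" unfolding feas_rel_def by blast
  then show ?thesis by simp
qed

lemma feasb_knows:
  assumes "feas M" "feas B" "feas X" "feas V" "feas R" "feas A"
  shows "feasb (\<lambda>w \<rho>. knows E (M w \<rho>) (B w \<rho>) (X w \<rho>) (V w \<rho>) (R w \<rho>) (A w \<rho>))"
  using assms(3,4)
proof (induction E arbitrary: X V)
  case 0
  then show ?case by (simp add: feasb_const)
next
  case (Suc E)
  from Suc.IH[OF feas_div[OF Suc.prems(1) assms(1)] feas_div[OF Suc.prems(2) assms(2)]]
  show ?case unfolding knows.simps
    by (intro feasb_disj feasb_conj feasb_eq feas_mod Suc.prems assms)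
qed

text \<open>The recursion over \<open>h\<close> takes place outside the machine and is unfolded into
  the program, whose size thus depends on \<open>d\<close>. This is legitimate as \<open>d\<close>
  is fixed with the source problem, and the evaluations below are treated alike.\<close>

lemma feasb_chain:
  "feas A \<Longrightarrow> feasb (\<lambda>w \<rho>. view.chain (fanin w) (child w) h (A w \<rho>))"
proof (induction h arbitrary: A)
  case 0
  then show ?case by (simp add: view.chain.simps feasb_const)
next
  case (Suc h)
  have "feasb (\<lambda>w \<rho>. view.chain (fanin w) (child w) h (child w (A w (\<lambda>n. \<rho> (Suc n))) (\<rho> 0)))"
    by (intro Suc.IH feas_child feas_shift Suc.prems feas_var)
  then show ?case unfolding view.chain.simps
    by (intro feasb_ex_less[where P = "\<lambda>w \<rho> j. view.chain (fanin w) (child w) h (child w (A w \<rho>) j)"] feas_fanin Suc.prems)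
qed

lemma feasb_large_within:
  "feas A \<Longrightarrow> feasb (\<lambda>w \<rho>. view.large_within (fanin w) (child w) h (A w \<rho>))"
proof (induction h arbitrary: A)
  case 0
  then show ?case unfolding view.large_within.simps by (intro feasb_less feas_const feas_fanin)
next
  case (Suc h)
  have "feasb (\<lambda>w \<rho>. view.large_within (fanin w) (child w) h (child w (A w (\<lambda>n. \<rho> (Suc n))) (\<rho> 0)))"
    by (intro Suc.IH feas_child feas_shift Suc.prems feas_var)
  then show ?case unfolding view.large_within.simps
    by (intro feasb_disj feasb_less feas_const
        feasb_ex_less[where P = "\<lambda>w \<rho> j. view.large_within (fanin w) (child w) h (child w (A w \<rho>) j)"] feas_fanin Suc.prems)
qed

lemma feasb_two_large_within:
  "feas A \<Longrightarrow> feasb (\<lambda>w \<rho>. view.two_large_within (fanin w) (child w) h (A w \<rho>))"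
proof (induction h arbitrary: A)
  case 0
  then show ?case by (simp add: view.two_large_within.simps feasb_const)
next
  case (Suc h)
  have "feasb (\<lambda>w \<rho>. view.two_large_within (fanin w) (child w) h (child w (A w (\<lambda>n. \<rho> (Suc n))) (\<rho> 0)))"
    "feasb (\<lambda>w \<rho>. view.large_within (fanin w) (child w) h (child w (A w (\<lambda>n. \<rho> (Suc n))) (\<rho> 0)))"
    by (intro Suc.IH feasb_large_within feas_child feas_shift Suc.prems feas_var)+
  then show ?case unfolding view.two_large_within.simps
    by (intro feasb_disj feasb_conj feasb_less feas_const
        feasb_ex_less[where P = "\<lambda>w \<rho> j. view.two_large_within (fanin w) (child w) h (child w (A w \<rho>) j)"]
        feasb_ex_less[where P = "\<lambda>w \<rho> j. view.large_within (fanin w) (child w) h (child w (A w \<rho>) j)"] feas_fanin Suc.prems)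
qed

context
  fixes k B :: "bool list \<Rightarrow> nat"
  assumes kB: "feas (\<lambda>w \<rho>. k w)" "feas (\<lambda>w \<rho>. B w)"
begin

lemma feas_input_val:
  assumes K: "feas_rel K" and A: "feas A"
  shows "feas (\<lambda>w \<rho>. view.input_val (k w) (B w) (K w \<rho>) (A w \<rho>))"
proof -
  note s = feas_rel_shift and r = feas_relD
  note K1 = s[OF K] note K2 = s[OF K1] note K3 = s[OF K2]
  note A1 = feas_shift[OF A] note A2 = feas_shift[OF A1] note A3 = feas_shift[OF A2]
  have 1: "feasb (\<lambda>w \<rho>. \<exists>p < k w. K w \<rho> (Suc p) (Suc (A w \<rho>)))"
    by (rule feasb_ex_less[OF kB(1)], rule r[OF K1]) (intro feas_Suc feas_var A1)+
  have 2: "feasb (\<lambda>w \<rho>. \<exists>p < Suc (k w). \<exists>a < Suc (A w \<rho>). K w \<rho> p a \<and>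
      (\<exists>b < B w. Suc (A w \<rho>) < b \<and> K w \<rho> (Suc p) b))"
    apply (rule feasb_ex_less, rule feas_Suc[OF kB(1)])
    apply (rule feasb_ex_less, rule feas_Suc[OF A1])
    apply (rule feasb_conj, rule r[OF K2], rule feas_var, rule feas_var)
    apply (rule feasb_ex_less[OF kB(2)])
    apply (rule feasb_conj, rule feasb_less, rule feas_Suc[OF A3], rule feas_var)
    apply (rule r[OF K3], rule feas_Suc[OF feas_var], rule feas_var)
    done
  show ?thesis
    unfolding view.input_val_def by (intro feas_if 1 2 feas_const)
qed

lemma feas_ev:
  assumes K: "feas_rel K"
  shows "feas A \<Longrightarrow> feas X \<Longrightarrow>
    feas (\<lambda>w \<rho>. view.ev (tag w) (fanin w) (child w) (k w) (B w) (K w \<rho>) h (A w \<rho>) (X w \<rho>))"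
proof (induction h arbitrary: A X)
  case 0
  then show ?case by (simp add: view.ev.simps feas_const)
next
  case (Suc h)
  note A = Suc.prems(1) and X = Suc.prems(2)
  have e0: "feas (\<lambda>w \<rho>. view.ev (tag w) (fanin w) (child w) (k w) (B w) (K w \<rho>) h (child w (A w \<rho>) 0) (2 * X w \<rho>))"
    by (intro Suc.IH feas_child feas_mult feas_const A X)
  have e1: "feas (\<lambda>w \<rho>. view.ev (tag w) (fanin w) (child w) (k w) (B w) (K w \<rho>) h (child w (A w \<rho>) 1) (2 * X w \<rho> + 1))"
    by (intro Suc.IH feas_child feas_mult feas_add feas_const A X)
  have c: "feas (\<lambda>w \<rho>. k w + 2 + X w \<rho>)" by (intro feas_add kB feas_const X)
  have w0: "feasb (\<lambda>w \<rho>. K w \<rho> (k w + 2 + X w \<rho>) 0)"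
    by (rule feas_relD[OF K c feas_const])
  have w1: "feasb (\<lambda>w \<rho>. \<exists>j < B w. K w \<rho> (k w + 2 + X w \<rho>) (Suc j))"
    by (rule feasb_ex_less[OF kB(2)], rule feas_relD[OF feas_rel_shift[OF K] feas_shift[OF c]])
      (intro feas_Suc feas_var)
  note t = feas_tag[OF A] and l = feas_fanin[OF A] and i = feas_input_val[OF K A]
  show ?case
    unfolding view.ev.simps
    by (intro feas_if feasb_eq feasb_le t l i e0 e1 w0 w1 feas_const feas_diff)
qed

lemma feasb_wrong_witness:
  assumes K: "feas_rel K"
  shows "feas A \<Longrightarrow> feas X \<Longrightarrow>
    feasb (\<lambda>w \<rho>. view.wrong_witness (tag w) (fanin w) (child w) (k w) (B w) (K w \<rho>) h (A w \<rho>) (X w \<rho>))"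
proof (induction h arbitrary: A X)
  case 0
  then show ?case by (simp add: view.wrong_witness.simps feasb_const)
next
  case (Suc h)
  note A = Suc.prems(1) and X = Suc.prems(2)
  let ?W = "\<lambda>w \<rho> i a. view.wrong_witness (tag w) (fanin w) (child w) (k w) (B w) (K w \<rho>) h i a"
  let ?V = "\<lambda>w \<rho> j. view.ev (tag w) (fanin w) (child w) (k w) (B w) (K w \<rho>) h (child w (A w \<rho>) j) 0"
  have iff: "feasb (\<lambda>w \<rho>. if P w \<rho> then Q w \<rho> else R w \<rho>)" if "feasb P" "feasb Q" "feasb R" for P Q R
    using feasb_disj[OF feasb_conj[OF that(1,2)] feasb_conj[OF feasb_not[OF that(1)] that(3)]] by (simp add: if_bool_eq_disj)
  have W0: "feasb (\<lambda>w \<rho>. ?W w \<rho> (child w (A w \<rho>) 0) (2 * X w \<rho>))"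
    by (intro Suc.IH feas_child feas_mult feas_const A X)
  have W1: "feasb (\<lambda>w \<rho>. ?W w \<rho> (child w (A w \<rho>) 1) (2 * X w \<rho> + 1))"
    by (intro Suc.IH feas_child feas_mult feas_add feas_const A X)
  have c: "feas (\<lambda>w \<rho>. k w + 2 + X w \<rho>)" by (intro feas_add kB feas_const X)
  have w0: "feasb (\<lambda>w \<rho>. K w \<rho> (k w + 2 + X w \<rho>) 0)"
    by (rule feas_relD[OF K c feas_const])
  have V: "feas (\<lambda>w \<rho>. ?V w (\<lambda>n. \<rho> (Suc n)) (\<rho> 0))"
    by (rule feas_ev[OF feas_rel_shift[OF K]]) (intro feas_child feas_shift[OF A] feas_var feas_const)+
  have t1: "feas (\<lambda>w \<rho>. tag w (A w (\<lambda>n. \<rho> (Suc n))))" by (intro feas_tag feas_shift[OF A])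
  have f1: "feas (\<lambda>w \<rho>. fanin w (A w (\<lambda>n. \<rho> (Suc n))))" by (intro feas_fanin feas_shift[OF A])
  have e0: "feasb (\<lambda>w \<rho>. \<exists>j < fanin w (A w \<rho>). ?V w \<rho> j = (if tag w (A w \<rho>) = 2 then 0 else 2))"
    by (rule feasb_ex_less[OF feas_fanin[OF A]]) (intro feasb_eq V feas_if t1 feas_const)
  have e1: "feasb (\<lambda>w \<rho>. \<exists>j < B w. K w \<rho> (k w + 2 + X w \<rho>) (Suc j) \<and>
      (fanin w (A w \<rho>) \<le> j \<or> ?V w \<rho> j = (if tag w (A w \<rho>) = 2 then 2 else 0)))"
  proof (rule feasb_ex_less[OF kB(2)], rule feasb_conj)
    show "feasb (\<lambda>w \<rho>. K w (\<lambda>n. \<rho> (Suc n)) (k w + 2 + X w (\<lambda>n. \<rho> (Suc n))) (Suc (\<rho> 0)))"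
      by (rule feas_relD[OF feas_rel_shift[OF K] feas_shift[OF c]]) (intro feas_Suc feas_var)
  qed (intro feasb_disj feasb_le feasb_eq V f1 feas_if t1 feas_const feas_var)
  note t = feas_tag[OF A] and l = feas_fanin[OF A]
  show ?case
    unfolding view.wrong_witness.simps
    by (intro iff feasb_disj feasb_conj feasb_eq t l W0 W1 w0 e0 e1 feas_const feasb_const)
qed

lemma feasb_violated:
  assumes K: "feas_rel K" and m: "feas (\<lambda>w \<rho>. m w)"
  shows "feasb (\<lambda>w \<rho>. view.violated (tag w) (fanin w) (child w) (m w) (k w) (B w) d (K w \<rho>))"
proof -
  note s = feas_rel_shift and r = feas_relD
  note K1 = s[OF K] note K2 = s[OF K1] note K3 = s[OF K2]
  have M: "feas (\<lambda>w \<rho>. view.num_coords (k w) d)"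
    unfolding view.num_coords_def by (intro feas_add kB feas_const)
  have c: "feasb (\<lambda>w \<rho>. \<exists>x < view.num_coords (k w) d. \<exists>a < B w. \<exists>b < B w. K w \<rho> x a \<and> K w \<rho> x b \<and> a \<noteq> b)"
    by (rule feasb_ex_less[OF M], rule feasb_ex_less[OF kB(2)], rule feasb_ex_less[OF kB(2)])
      (intro feasb_conj r[OF K3] feasb_not feasb_eq feas_var)
  have 1: "feasb (\<lambda>w \<rho>. \<exists>a < B w. K w \<rho> 0 a \<and> a \<noteq> 0)"
    by (rule feasb_ex_less[OF kB(2)]) (intro feasb_conj r[OF K1] feasb_not feasb_eq feas_var feas_const)
  have 2: "feasb (\<lambda>w \<rho>. \<exists>a < B w. K w \<rho> (Suc (k w)) a \<and> a \<noteq> Suc (m w))"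
    by (rule feasb_ex_less[OF kB(2)]) (intro feasb_conj r[OF K1] feasb_not feasb_eq feas_var feas_Suc kB m)
  have 3: "feasb (\<lambda>w \<rho>. \<exists>p < k w. \<exists>a < B w. K w \<rho> (Suc p) a \<and> (a = 0 \<or> m w < a \<or> tag w (a - 1) \<noteq> 0))"
    by (rule feasb_ex_less[OF kB(1)], rule feasb_ex_less[OF kB(2)])
      (intro feasb_conj feasb_disj r[OF K2] feasb_not feasb_eq feasb_less feas_tag feas_diff feas_var feas_Suc feas_const m)
  have 4: "feasb (\<lambda>w \<rho>. \<exists>p < Suc (k w). \<exists>a < B w. \<exists>b < B w. K w \<rho> p a \<and> K w \<rho> (Suc p) b \<and> b \<le> a)"
    by (rule feasb_ex_less[OF feas_Suc[OF kB(1)]], rule feasb_ex_less[OF kB(2)], rule feasb_ex_less[OF kB(2)])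
      (intro feasb_conj r[OF K3] feasb_le feas_var feas_Suc)
  show ?thesis
    unfolding view.violated_def view.wrong_selection_def
    by (intro feasb_disj c 1 2 3 4 feasb_eq feas_ev[OF K] feasb_wrong_witness[OF K] feas_diff m feas_const)
qed

lemma feasb_conflicting:
  assumes m: "feas (\<lambda>w \<rho>. m w)" and "feas X" "feas V" "feas Y" "feas U"
  shows "feasb (\<lambda>w \<rho>. view.conflicting (tag w) (fanin w) (child w) (m w) (k w) (B w) d
    (X w \<rho>) (V w \<rho>) (Y w \<rho>) (U w \<rho>))"
proof -
  have M: "feas (\<lambda>w \<rho>. view.num_coords (k w) d)"
    unfolding view.num_coords_def by (intro feas_add kB feas_const)
  have "feas_rel (\<lambda>w \<rho> r a. knows (2 ^ (d + 2)) (view.num_coords (k w) d) (B w) (X w \<rho>) (V w \<rho>) r a \<or>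
      knows (2 ^ (d + 2)) (view.num_coords (k w) d) (B w) (Y w \<rho>) (U w \<rho>) r a)"
    unfolding feas_rel_def
    by (intro allI impI feasb_disj feasb_knows M kB feas_shift_add assms)
  from feasb_violated[OF this m] show ?thesis
    unfolding view.conflicting_def .
qed

end

section \<open>Feasibility of the gadget graph\<close>

lemma feasb_if: "feasb P \<Longrightarrow> feasb Q \<Longrightarrow> feasb R \<Longrightarrow> feasb (\<lambda>w \<rho>. if P w \<rho> then Q w \<rho> else R w \<rho>)"
  using feasb_disj[OF feasb_conj[of P Q] feasb_conj[OF feasb_not[of P], of R]] by (simp add: if_bool_eq_disj)

context
  fixes q V :: "bool list \<Rightarrow> nat"
  assumes q: "feas (\<lambda>w \<rho>. q w)" and V: "feas (\<lambda>w \<rho>. V w)"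
begin

lemma feas_Z: "feas (\<lambda>w \<rho>. gadget.Z (V w))"
  unfolding gadget.Z_def by (intro feas_add feas_mult feas_const V)

lemma feas_n: "feas (\<lambda>w \<rho>. gadget.n (q w) (V w))"
  unfolding gadget.n_def gadget.J_def by (intro feas_add feas_mult feas_const q V feas_Z)

lemma feas_component:
  assumes "feas A"
  shows "feas (\<lambda>w \<rho>. gadget.cz (V w) (A w \<rho>))" "feas (\<lambda>w \<rho>. gadget.cu (V w) (A w \<rho>))"
    "feas (\<lambda>w \<rho>. gadget.cy (q w) (V w) (A w \<rho>))" "feas (\<lambda>w \<rho>. gadget.cv (q w) (V w) (A w \<rho>))"
    "feas (\<lambda>w \<rho>. gadget.cx (q w) (V w) (A w \<rho>))"
  unfolding gadget.cz_def gadget.cu_def gadget.cy_def gadget.cv_def gadget.cx_def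
  by (intro feas_div feas_mod feas_Z q V assms)+

lemma feasb_active: "feas A \<Longrightarrow> feasb (\<lambda>w \<rho>. gadget.active (q w) (V w) (A w \<rho>))"
  unfolding gadget.active_def by (intro feasb_less feas_component)

lemma feas_goal: "feas (\<lambda>w \<rho>. gadget.goal (q w) (V w))"
  unfolding gadget.goal_def gadget.pair_value_def
  by (rule feas_sum[OF q], rule feas_sum[OF q])
    (intro feas_add feas_mult feas_if feasb_less feas_const feas_var V feas_Z)

context
  fixes tri :: bool and bad :: "bool list \<Rightarrow> nat \<Rightarrow> nat \<Rightarrow> nat \<Rightarrow> nat \<Rightarrow> bool"
  assumes bad: "\<And>X A Y U. feas X \<Longrightarrow> feas A \<Longrightarrow> feas Y \<Longrightarrow> feas U \<Longrightarrow>
      feasb (\<lambda>w \<rho>. bad w (X w \<rho>) (A w \<rho>) (Y w \<rho>) (U w \<rho>))"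
begin

lemma feasb_conflict: "feas A \<Longrightarrow> feasb (\<lambda>w \<rho>. gadget.conflict (q w) (V w) (bad w) (A w \<rho>))"
  unfolding gadget.conflict_def by (intro feasb_conj feasb_eq bad feasb_active feas_component feas_const)

lemma feas_precolor: "feas A \<Longrightarrow> feas (\<lambda>w \<rho>. gadget.precolor (q w) (V w) (bad w) (A w \<rho>))"
  unfolding gadget.precolor_def gadget.left_color_def gadget.right_color_def
  by (intro feas_if feasb_less feasb_eq feasb_conflict feasb_active feas_Suc feas_add feas_mult feas_div feas_mod
      feas_diff feas_component feas_const q V)

lemma feasb_adj:
  "feas A \<Longrightarrow> feas T \<Longrightarrow> feasb (\<lambda>w \<rho>. gadget.adj tri (q w) (V w) (bad w) (A w \<rho>) (T w \<rho>))"
  unfolding gadget.adj_def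
  by (intro feasb_if feasb_conj feasb_disj feasb_less feasb_le feasb_eq feasb_conflict feasb_active feasb_const
      feas_div feas_mod feas_diff feas_component feas_const q)

lemma feas_string_code_mhe:
  assumes T: "feas (\<lambda>w \<rho>. T w)"
  shows "feas_string (\<lambda>w \<rho>. code_mhe (gadget.inst tri (q w) (V w) (bad w) (T w)))"
proof -
  let ?n = "\<lambda>w. gadget.n (q w) (V w)"
  let ?adj = "\<lambda>w. gadget.adj tri (q w) (V w) (bad w)"
  have row: "feas_string (\<lambda>w \<rho>. map (\<lambda>v. ?adj w (\<rho> 0) v \<or> ?adj w v (\<rho> 0)) [0..<?n w])"
    by (rule feas_string_map_upt[OF feas_n]) (intro feasb_disj feasb_adj feas_var)
  have mat: "feas_string (\<lambda>w \<rho>. concat (map (\<lambda>u. map (\<lambda>v. ?adj w u v \<or> ?adj w v u) [0..<?n w]) [0..<?n w]))"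
    by (rule feas_string_concat_upt[OF feas_n row])
  have pre: "feas_string (\<lambda>w \<rho>. concat (map (\<lambda>v. code_nat (gadget.precolor (q w) (V w) (bad w) v)) [0..<?n w]))"
    by (rule feas_string_concat_upt[OF feas_n]) (intro feas_string_code_nat feas_precolor feas_var)
  show ?thesis
    unfolding gadget.code_mhe_inst
    by (intro feas_string_append feas_string_Cons feas_string_code_nat feasb_const feas_Suc feas_mult
        feas_n q V T mat pre)
qed

end

end

section \<open>The reduction\<close>

text \<open>Serves the legality test: comparing the input with the code of its own decoding exposes
  all malformed strings at once.\<close>

lemma feas_string_code_wcs: "feas_string (\<lambda>w \<rho>. code_wcs (gates w, token w 0))"
proof -
  have g: "code_gate (make_gate t l c) = (if t = 0 then code_nat 0 else if t = 1 then code_nat 1 @ code_nat (c 0)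
      else code_nat (if t = 2 then 2 else 3) @ code_nat l @ concat (map (\<lambda>j. code_nat (c j)) [0..<l]))" for t l c
    by (auto simp: make_gate_def code_list_def comp_def simp del: code_nat.simps)
  have eq: "code_wcs (gates w, token w 0) = code_nat (token w 0) @ code_nat (token w 1) @
      concat (map (\<lambda>i. code_gate (make_gate (tag w i) (fanin w i) (child w i))) [0..<token w 1])" for w
    by (simp add: code_wcs_def code_list_def gates_def comp_def del: One_nat_def)
  have children: "feas_string (\<lambda>w \<rho>. concat (map (\<lambda>j. code_nat (child w (\<rho> 0) j)) [0..<fanin w (\<rho> 0)]))"
    by (rule feas_string_concat_upt) (intro feas_string_code_nat feas_child feas_fanin feas_var)+
  have "feas_string (\<lambda>w \<rho>. code_gate (make_gate (tag w (\<rho> 0)) (fanin w (\<rho> 0)) (child w (\<rho> 0))))"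
    unfolding g
    by (intro feas_string_if feas_string_append feas_string_code_nat feas_if feasb_eq feas_tag feas_fanin feas_child
        feas_var feas_const children)
  from feas_string_concat_upt[OF feas_token[OF feas_const] this]
  show ?thesis
    unfolding eq by (intro feas_string_append feas_string_code_nat feas_token feas_const)
qed

lemma eq_iff_cells: "v = w \<longleftrightarrow> length v = length w \<and> (\<forall>i < length w. cell v i = cell w i)"
proof
  assume *: "length v = length w \<and> (\<forall>i < length w. cell v i = cell w i)"
  have "v ! i = w ! i" if "i < length v" for i
  proof -
    have "cell v i = cell w i" and "i < length w" using * that by simp_all
    then show ?thesis using that by (simp add: cell_def split: if_splits)
  qed
  then show "v = w" using * by (intro nth_equalityI) auto
qed simp

definition circuit_ok :: "bool list \<Rightarrow> bool" where
  "circuit_ok w \<longleftrightarrow> 0 < token w 1 \<and> (\<forall>i < token w 1. (\<forall>j < fanin w i. child w i j < i) \<and>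
     (tag w i = 0 \<or> tag w i = 1 \<or> 2 \<le> fanin w i \<and>
       (\<forall>j < fanin w i. \<forall>j' < fanin w i. child w i j = child w i j' \<longrightarrow> j = j')))"

lemma circuit_ok_iff: "circuit_ok w \<longleftrightarrow> circuit (gates w)"
proof -
  have len: "length (gates w) = token w 1" by (simp add: gates_def)
  have gate: "gates w ! i = make_gate (tag w i) (fanin w i) (child w i)" if "i < token w 1" for i
    using that by (simp add: gates_def)
  have preds: "set (preds (make_gate (tag w i) (fanin w i) (child w i))) = child w i ` {..<fanin w i}" for i
    by (auto simp: make_gate_def fanin_def lessThan_Suc)
  have dist: "distinct (map f [0..<n]) \<longleftrightarrow> (\<forall>j < n. \<forall>j' < n. f j = f j' \<longrightarrow> j = j')" for f :: "nat \<Rightarrow> nat" and n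
    by (auto simp: distinct_map inj_on_def)
  have fan: "fanin_ok (make_gate (tag w i) (fanin w i) (child w i)) \<longleftrightarrow>
      tag w i = 0 \<or> tag w i = 1 \<or> 2 \<le> fanin w i \<and>
       (\<forall>j < fanin w i. \<forall>j' < fanin w i. child w i j = child w i j' \<longrightarrow> j = j')" for i
    unfolding dist[symmetric] by (auto simp: make_gate_def)
  have "circuit (gates w) \<longleftrightarrow> 0 < token w 1 \<and> (\<forall>i < token w 1. fanin_ok (gates w ! i) \<and> (\<forall>j \<in> set (preds (gates w ! i)). j < i))"
    unfolding circuit_def len[symmetric] by simp
  also have "\<dots> \<longleftrightarrow> circuit_ok w"
    unfolding circuit_ok_def using gate fan preds by auto
  finally show ?thesis by simp
qed

lemma feasb_circuit_ok: "feasb (\<lambda>w \<rho>. circuit_ok w)"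
proof -
  have 1: "feasb (\<lambda>w \<rho>. \<forall>j < fanin w (\<rho> 0). child w (\<rho> 0) j < \<rho> 0)"
    by (rule feasb_all_less) (intro feasb_less feas_fanin feas_child feas_var)+
  have 2: "feasb (\<lambda>w \<rho>. \<forall>j < fanin w (\<rho> 0). \<forall>j' < fanin w (\<rho> 0). child w (\<rho> 0) j = child w (\<rho> 0) j' \<longrightarrow> j = j')"
    by (rule feasb_all_less, intro feas_fanin feas_var, rule feasb_all_less)
      (intro feasb_imp feasb_eq feas_fanin feas_child feas_var)+
  have "feasb (\<lambda>w \<rho>. \<forall>i < token w 1. (\<forall>j < fanin w i. child w i j < i) \<and>
     (tag w i = 0 \<or> tag w i = 1 \<or> 2 \<le> fanin w i \<and>
       (\<forall>j < fanin w i. \<forall>j' < fanin w i. child w i j = child w i j' \<longrightarrow> j = j')))"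
    by (rule feasb_all_less, intro feas_token feas_const)
      (intro feasb_conj feasb_disj feasb_eq feasb_le feas_tag feas_fanin feas_var feas_const 1 2)
  then show ?thesis
    unfolding circuit_ok_def by (intro feasb_conj feasb_less feas_token feas_const)
qed

definition legal_input :: "nat \<Rightarrow> bool list \<Rightarrow> bool" where
  "legal_input d w \<longleftrightarrow> circuit_ok w \<and> \<not> view.chain (fanin w) (child w) (Suc d) (token w 1 - 1) \<and>
     \<not> view.two_large_within (fanin w) (child w) (Suc d) (token w 1 - 1) \<and> code_wcs (gates w, token w 0) = w"

lemma feasb_legal_input: "feasb (\<lambda>w \<rho>. legal_input d w)"
proof -
  have "feasb (\<lambda>w \<rho>. code_wcs (gates w, token w 0) = w)"
    unfolding eq_iff_cells
    by (intro feasb_conj feasb_eq feas_string_length[OF feas_string_code_wcs] feas_length feasb_all_less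
        feas_string_cell feas_string_code_wcs feas_cell feas_var)
  then show ?thesis
    unfolding legal_input_def
    by (intro feasb_conj feasb_not feasb_circuit_ok feasb_chain feasb_two_large_within feas_diff feas_token feas_const)
qed

definition num_vars :: "nat \<Rightarrow> bool list \<Rightarrow> nat" where
  "num_vars d w = (if legal_input d w then view.num_coords (token w 0) d ^ (2 ^ (d + 2)) else 0)"

text \<open>The base \<open>length w + 2\<close> exceeds \<open>Suc m\<close>, as every gate takes
  at least one bit of the input. The exponent is constant for fixed \<open>d\<close>, so this is
  polynomial.\<close>

definition num_values :: "nat \<Rightarrow> bool list \<Rightarrow> nat" where
  "num_values d w = (length w + 2) ^ (2 ^ (d + 2))"

definition bad_pair :: "nat \<Rightarrow> bool list \<Rightarrow> nat \<Rightarrow> nat \<Rightarrow> nat \<Rightarrow> nat \<Rightarrow> bool" where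
  "bad_pair d w = view.conflicting (tag w) (fanin w) (child w) (token w 1) (token w 0) (length w + 2) d"

text \<open>Strings that encode no legal circuit are mapped to the empty graph with target 1.\<close>

definition target_value :: "nat \<Rightarrow> bool list \<Rightarrow> nat" where
  "target_value d w = (if legal_input d w then gadget.goal (num_vars d w) (num_values d w) else 1)"

definition reduct :: "bool \<Rightarrow> nat \<Rightarrow> bool list \<Rightarrow> mhe_instance" where
  "reduct tri d w = gadget.inst tri (num_vars d w) (num_values d w) (bad_pair d w) (target_value d w)"

lemma feas_string_reduct: "feas_string (\<lambda>w \<rho>. code_mhe (reduct tri d w))"
proof -
  have q: "feas (\<lambda>w \<rho>. num_vars d w)"
    unfolding num_vars_def view.num_coords_def
    by (intro feas_if feasb_legal_input feas_power feas_add feas_token feas_const)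
  have V: "feas (\<lambda>w \<rho>. num_values d w)"
    unfolding num_values_def by (intro feas_power feas_add feas_length feas_const)
  have bad: "feasb (\<lambda>w \<rho>. bad_pair d w (X w \<rho>) (A w \<rho>) (Y w \<rho>) (U w \<rho>))"
    if "feas X" "feas A" "feas Y" "feas U" for X A Y U
    unfolding bad_pair_def
    by (rule feasb_conflicting[OF _ _ _ that]) (intro feas_token feas_add feas_length feas_const)+
  have T: "feas (\<lambda>w \<rho>. target_value d w)"
    unfolding target_value_def by (intro feas_if feasb_legal_input feas_goal[OF q V] feas_const)
  show ?thesis
    unfolding reduct_def by (rule feas_string_code_mhe[where bad = "bad_pair d", OF q V _ T]) (rule bad)
qed

lemma circuit_view_gates:
  assumes "circuit (gates w)" "code_wcs (gates w, token w 0) = w"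
  shows "circuit_view (tag w) (fanin w) (child w) (token w 1) (length w + 2) (gates w)"
proof
  show "circuit (gates w)" by (rule assms)
  show "token w 1 = length (gates w)" by (simp add: gates_def)
  have "length (gates w) \<le> length w"
    using assms length_le_length_code_wcs[of "gates w" "token w 0"] by simp
  then show "Suc (token w 1) < length w + 2" by (simp add: gates_def)
  show "gates w ! i = make_gate (tag w i) (fanin w i) (child w i)" if "i < token w 1" for i
    using that by (simp add: gates_def)
qed (simp_all add: fanin_def)

text \<open>The bounded weft test is exact only for circuits of bounded depth, so the two tests are
  justified jointly.\<close>

lemma legal_input_iff:
  "legal_input d w \<longleftrightarrow> circuit (gates w) \<and> weft_at_most 1 (gates w) \<and> depth_at_most d (gates w) \<and>
     code_wcs (gates w, token w 0) = w"
proof (cases "circuit (gates w) \<and> code_wcs (gates w, token w 0) = w")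
  case True
  then interpret circuit_view "tag w" "fanin w" "child w" "token w 1" "token w 0" "length w + 2" d "gates w"
    by (intro circuit_view_gates) simp_all
  show ?thesis
    using depth_iff[of d] weft_iff[of d] True circuit_ok_iff[of w] unfolding legal_input_def by blast
next
  case False
  then show ?thesis using circuit_ok_iff[of w] unfolding legal_input_def by blast
qed

lemma mhe_legal_reduct: "mhe_legal (reduct tri d w)"
  unfolding reduct_def by (rule gadget.mhe_legal_inst)

lemma mhe_yes_reduct:
  assumes l: "legal_input d w"
  shows "mhe_yes (reduct tri d w) \<longleftrightarrow> (\<exists>a. weight a (gates w) = token w 0 \<and> satisfies a (gates w))"
proof -
  have C: "circuit (gates w)" "code_wcs (gates w, token w 0) = w" using l legal_input_iff by blast+
  then interpret circuit_view "tag w" "fanin w" "child w" "token w 1" "token w 0" "length w + 2" d "gates w"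
    by (intro circuit_view_gates)
  have q: "num_vars d w = num_coords ^ (2 ^ (d + 2))" using l by (simp add: num_vars_def)
  have T: "target_value d w = gadget.goal (num_vars d w) (num_values d w)" using l by (simp add: target_value_def)
  have q2: "2 \<le> num_vars d w" unfolding q by (rule num_tuples_ge)
  have V: "0 < num_values d w" by (simp add: num_values_def)
  have "mhe_yes (reduct tri d w) \<longleftrightarrow> (\<exists>f. gadget.solves (num_vars d w) (num_values d w) (bad_pair d w) f)"
    unfolding reduct_def T by (rule gadget.mhe_yes_inst[OF V q2])
  also have "\<dots> \<longleftrightarrow> (\<exists>\<sigma>. assigns \<sigma> \<and> \<not> violated (full \<sigma>))"
    unfolding gadget.solves_def q num_values_def bad_pair_def
    by (rule conflict_free_iff) simp
  also have "\<dots> \<longleftrightarrow> (\<exists>a. weight a (gates w) = token w 0 \<and> satisfies a (gates w))"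
    using l by (intro weighted_sat_iff[symmetric]) (simp_all only: legal_input_def not_False_eq_True)
  finally show ?thesis .
qed

lemma weight_le: "weight a C \<le> length C"
proof -
  have "weight a C \<le> card {..<length C}" unfolding weight_def by (intro card_mono) auto
  then show ?thesis by simp
qed

lemma inj_on_code_wcs: "inj_on code_wcs A"
  using inj_code_wcs by (rule inj_on_subset) simp

lemma wcs_iff_mhe_yes: "w \<in> fst (wcs 1 d) \<longleftrightarrow> mhe_yes (reduct tri d w)"
proof (cases "legal_input d w")
  case True
  then have l: "(\<lambda>(C, k). circuit C \<and> weft_at_most 1 C \<and> depth_at_most d C) (gates w, token w 0)"
    and w: "code_wcs (gates w, token w 0) = w"
    using legal_input_iff by simp_all
  from encoded_problem_simps(1)[where legal = "\<lambda>(C, k). circuit C \<and> weft_at_most 1 C \<and> depth_at_most d C",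
      OF inj_on_code_wcs l, of "\<lambda>(C, k). \<exists>a. weight a C = k \<and> satisfies a C" "\<lambda>(C, k). k"]
  show ?thesis unfolding wcs_def w mhe_yes_reduct[OF True] by simp
next
  case False
  have "\<not> mhe_yes (reduct tri d w)"
  proof -
    have 1: "num_vars d w = 0" and 2: "target_value d w = 1"
      using False by (simp_all add: target_value_def num_vars_def)
    show ?thesis unfolding reduct_def 1 2 by (rule gadget.not_mhe_yes_inst_1) (rule refl)
  qed
  moreover have "w \<notin> fst (wcs 1 d)"
  proof
    assume "w \<in> fst (wcs 1 d)"
    then obtain C k a where C: "w = code_wcs (C, k)" "circuit C" "weft_at_most 1 C" "depth_at_most d C" "weight a C = k"
      unfolding wcs_def encoded_problem_def by auto
    \<comment> \<open>A yes-instance meets the weight bound under which decoding is faithful. Codes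
      of circuits with a larger weight may be rejected, being no-instances anyway.\<close>
    have "k \<le> length C" using weight_le[of a C] C(5) by simp
    from decode_code_wcs[OF C(2,1) this] have "gates w = C" "token w 0 = k" .
    then show False using C False legal_input_iff[of d w] by simp
  qed
  ultimately show ?thesis by blast
qed

text \<open>For accepted strings this is an equality, the base being \<open>num_coords\<close>. All
  others yield no variables, so neither junk nor a weight too large to decode spoils the
  parameter.\<close>

lemma num_vars_le: "num_vars d w \<le> (snd (wcs 1 d) w + (2 + 2 ^ (d + 2))) ^ (2 ^ (d + 2))"
proof (cases "legal_input d w")
  case True
  then have l: "(\<lambda>(C, k). circuit C \<and> weft_at_most 1 C \<and> depth_at_most d C) (gates w, token w 0)"
    and w: "code_wcs (gates w, token w 0) = w"
    using legal_input_iff by simp_all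
  from encoded_problem_simps(2)[where legal = "\<lambda>(C, k). circuit C \<and> weft_at_most 1 C \<and> depth_at_most d C",
      OF inj_on_code_wcs l, of "\<lambda>(C, k). \<exists>a. weight a C = k \<and> satisfies a C" "\<lambda>(C, k). k"]
  have "snd (wcs 1 d) w = token w 0" unfolding wcs_def w by simp
  then show ?thesis using True by (simp add: num_vars_def view.num_coords_def add.assoc)
next
  case False
  then show ?thesis by (simp add: num_vars_def)
qed

text \<open>One reduction serves both classes: \<open>tri\<close> only decides which kind of
  component remains after the variables are deleted.\<close>

lemma W_hard_mhe:
  assumes P: "\<And>q j. P ({gadget.va q j, gadget.vb q j, gadget.vc q j}, gadget.inner_edges tri q j)"
  shows "W_hard 1 (mhe_by_distance_to (disjoint_union_of P))"
  unfolding W_hard_def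
proof
  fix A assume "A \<in> W 1"
  then obtain d where A: "A \<le>\<^sub>f\<^sub>p\<^sub>t wcs 1 d" unfolding W_def by blast
  show "A \<le>\<^sub>f\<^sub>p\<^sub>t mhe_by_distance_to (disjoint_union_of P)"
  proof (rule fpt_reducible_feas[OF A feas_string_reduct[of tri d]])
    fix w
    show "w \<in> fst (wcs 1 d) \<longleftrightarrow> code_mhe (reduct tri d w) \<in> fst (mhe_by_distance_to (disjoint_union_of P))"
      unfolding mhe_by_distance_to_def
        encoded_problem_simps(1)[where legal = mhe_legal, OF inj_code_mhe mhe_legal_reduct[of tri d w]]
      by (rule wcs_iff_mhe_yes)
    have "distance_to (disjoint_union_of P) (graph (reduct tri d w)) \<le> num_vars d w"
      unfolding reduct_def by (rule gadget.distance_to_le) (rule P)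
    then show "snd (mhe_by_distance_to (disjoint_union_of P)) (code_mhe (reduct tri d w)) \<le>
        (snd (wcs 1 d) w + (2 + 2 ^ (d + 2))) ^ (2 ^ (d + 2))"
      unfolding mhe_by_distance_to_def
        encoded_problem_simps(2)[where legal = mhe_legal, OF inj_code_mhe mhe_legal_reduct[of tri d w]]
      using num_vars_le by (rule le_trans)
  qed
qed

theorem theorem2:
  shows "W_hard 1 (mhe_by_distance_to (disjoint_union_of (is_path 3))) \<and>
         W_hard 1 (mhe_by_distance_to (disjoint_union_of (is_cycle 3)))"
  using W_hard_mhe[of "is_path 3" False] gadget.is_path_component[of False]
    W_hard_mhe[of "is_cycle 3" True] gadget.is_cycle_component[of True] by simp

end
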